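(* Let $G/\Gamma$ be an $s$-step nilmanifold of dimension $d$ and degree $k$ with a Mal'cev basis of complexity at most $M$. Let $G'$ be a closed connected subgroup of $G$ which is $Q$-rational and nilpotent of step at most $s-1$. Then there exist $r\le d$ and linearly independent horizontal characters $\eta_1,\dots,\eta_r$ of $G$ of size at most $(QM)^{O_k(d^{O_k(1)})}$ such that $\eta_i(G')=0$ for all $i$, and such that whenever $w_1,\dots,w_s\in G$ satisfy $\eta_i(w_j)=0$ for all $i,j$, we have $[w_1,w_2,\dots,w_s]=\mathrm{id}_G$.
   Context: Nilmanifold: a nilmanifold $G/\Gamma$ of degree $k$, step $s$, dimension $d$ and complexity at most $M$ consists of a connected, simply connected $s$-step nilpotent Lie group $G$ of dimension $d$, a discrete cocompact $\Gamma$, a filtration $G=G_0=G_1\supseteq G_2\supseteq\cdots$ with $[G_i,G_j]\subseteq G_{i+j}$, $G_i=\{\mathrm{id}\}$ for $i>k$, and a Mal'cev basis $X_1,\dots,X_d$ of $\mathfrak g$ with $[X_i,X_j]=\sum_{l>\max(i,j)}a_{ijl}X_l$, $a_{ijl}$ rationals of height at most $M$, adapted to the filtration, with Mal'cev coordinates $\psi$ and $\Gamma=\{g:\psi(g)\in\mathbb Z^d\}$. A subgroup is $Q$-rational if its Lie algebra has a basis with coordinates in $X_1,\dots,X_d$ rationals of height at most $Q$. Horizontal character: continuous homomorphism $\eta\colon G\to\mathbb R$ with $\eta(\Gamma)\subseteq\mathbb Z$, $\eta=k\cdot\psi$, size $|k|_\infty$. $[w_1,\dots,w_s]=[[[w_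1,w_2],w_3],\dots,w_s]$.
   Formalization: The complexity bound is taken with M ≥ 2 and Q ≥ 1, so that QM ≥ 2; for Q = M = 1 the stated size bound equals 1 and the claim fails. *)

theory Defs
  imports "HOL-Analysis.Analysis" "HOL-Algebra.Generated_Groups"
begin

text \<open>Model: a nilmanifold G/Gamma of dimension d is identified, via its Mal'cev
coordinate map psi, with R^d, represented as functions nat => real vanishing
at all indices >= d.  Coordinates are indexed 0..d-1 (paper: 1..d).\<close>

type_synonym vec = "nat \<Rightarrow> real"

definition Vsp :: "nat \<Rightarrow> vec set" where
  "Vsp d = {x. \<forall>i\<ge>d. x i = 0}"

text \<open>sc t i = exp(t X_i) in Mal'cev coordinates, i.e. t e_i.\<close>
definition sc :: "real \<Rightarrow> nat \<Rightarrow> vec" where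
  "sc t i = (\<lambda>j. if j = i then t else 0)"

definition nilgrp :: "nat \<Rightarrow> (vec \<Rightarrow> vec \<Rightarrow> vec) \<Rightarrow> vec monoid" where
  "nilgrp d mul = \<lparr>carrier = Vsp d, mult = mul, one = (\<lambda>_. 0)\<rparr>"

definition lattice :: "nat \<Rightarrow> vec set" where
  "lattice d = {x \<in> Vsp d. \<forall>i<d. x i \<in> \<int>}"

inductive polyfun2 :: "(vec \<Rightarrow> vec \<Rightarrow> real) \<Rightarrow> bool" where
  pconst: "polyfun2 (\<lambda>x y. c)"
| pprojx: "polyfun2 (\<lambda>x y. x i)"
| pprojy: "polyfun2 (\<lambda>x y. y i)"
| padd: "polyfun2 p \<Longrightarrow> polyfun2 q \<Longrightarrow> polyfun2 (\<lambda>x y. p x y + q x y)"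
| pmult: "polyfun2 p \<Longrightarrow> polyfun2 q \<Longrightarrow> polyfun2 (\<lambda>x y. p x y * q x y)"

definition gcomm :: "('a, 'b) monoid_scheme \<Rightarrow> 'a \<Rightarrow> 'a \<Rightarrow> 'a" where
  "gcomm G x y = inv\<^bsub>G\<^esub> x \<otimes>\<^bsub>G\<^esub> inv\<^bsub>G\<^esub> y \<otimes>\<^bsub>G\<^esub> x \<otimes>\<^bsub>G\<^esub> y"

definition iter_comm :: "('a, 'b) monoid_scheme \<Rightarrow> nat \<Rightarrow> (nat \<Rightarrow> 'a) \<Rightarrow> 'a" where
  "iter_comm G s w = foldl (gcomm G) (w 0) (map w [1..<s])"

text \<open>Lower central series of a subgroup H: lcs G H 0 = gamma_1(H) = H,
  lcs G H (n+1) = gamma_{n+2}(H) = [gamma_{n+1}(H), H].\<close>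
fun lcs :: "('a, 'b) monoid_scheme \<Rightarrow> 'a set \<Rightarrow> nat \<Rightarrow> 'a set" where
  "lcs G H 0 = H"
| "lcs G H (Suc n) = generate G {gcomm G x y | x y. x \<in> lcs G H n \<and> y \<in> H}"

definition nilp_step_le :: "('a, 'b) monoid_scheme \<Rightarrow> 'a set \<Rightarrow> nat \<Rightarrow> bool" where
  "nilp_step_le G H c \<longleftrightarrow> lcs G H c = {\<one>\<^bsub>G\<^esub>}"

text \<open>One-parameter subgroups and the Lie algebra of a closed subgroup H,
  as tangent vectors at the identity (= origin in Mal'cev coordinates).\<close>
definition one_param :: "vec monoid \<Rightarrow> (real \<Rightarrow> vec) \<Rightarrow> bool" where
  "one_param G \<phi> \<longleftrightarrow> (\<forall>t. \<phi> t \<in> carrier G) \<and> continuous_on UNIV \<phi>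
      \<and> (\<forall>s t. \<phi> (s + t) = \<phi> s \<otimes>\<^bsub>G\<^esub> \<phi> t)"

definition lie_alg :: "vec monoid \<Rightarrow> vec set \<Rightarrow> vec set" where
  "lie_alg G H = {v. \<exists>\<phi>. one_param G \<phi> \<and> range \<phi> \<subseteq> H
      \<and> (\<forall>l. ((\<lambda>t. \<phi> t l) has_real_derivative v l) (at 0))}"

text \<open>l-th Mal'cev coordinate of [X_i, X_j] = ad(X_i) X_j, computed as
  d/ds d/dt ( exp(s X_i) exp(t X_j) exp(s X_i)^-1 ) at s = t = 0.\<close>
definition lie_br :: "vec monoid \<Rightarrow> nat \<Rightarrow> nat \<Rightarrow> nat \<Rightarrow> real" where
  "lie_br G i j l = deriv (\<lambda>s. deriv (\<lambda>t.
       (sc s i \<otimes>\<^bsub>G\<^esub> sc t j \<otimes>\<^bsub>G\<^esub> inv\<^bsub>G\<^esub> (sc s i)) l) 0) 0"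

definition rat_height :: "rat \<Rightarrow> int" where
  "rat_height q = (case quotient_of q of (a, b) \<Rightarrow> max \<bar>a\<bar> \<bar>b\<bar>)"

text \<open>Nilmanifold G/Gamma of degree k, step (at most) s, dimension d, complexity
  at most M, with filtration Gf and Mal'cev basis structure constants a,
  presented in Mal'cev coordinates (psi = identity, group law mul).\<close>
definition nilmanifold ::
  "nat \<Rightarrow> nat \<Rightarrow> nat \<Rightarrow> real \<Rightarrow> (vec \<Rightarrow> vec \<Rightarrow> vec) \<Rightarrow> (nat \<Rightarrow> vec set)
     \<Rightarrow> (nat \<Rightarrow> nat \<Rightarrow> nat \<Rightarrow> rat) \<Rightarrow> bool" where
  "nilmanifold d s k M mul Gf a \<longleftrightarrow>
    (let G = nilgrp d mul; \<Gamma> = lattice d in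
      group G
    \<comment> \<open>Lie group structure: group law smooth (indeed polynomial) in coordinates\<close>
    \<and> (\<forall>l. \<exists>p. polyfun2 p \<and> (\<forall>x\<in>Vsp d. \<forall>y\<in>Vsp d. mul x y l = p x y))
    \<comment> \<open>s-step nilpotent\<close>
    \<and> nilp_step_le G (carrier G) s
    \<comment> \<open>Gamma = psi^-1(Z^d) is a discrete cocompact subgroup\<close>
    \<and> subgroup \<Gamma> G
    \<and> (\<forall>\<gamma>\<in>\<Gamma>. \<exists>U. open U \<and> U \<inter> \<Gamma> = {\<gamma>})
    \<and> (\<exists>K. compact K \<and> K \<subseteq> carrier G \<and> carrier G = {x \<otimes>\<^bsub>G\<^esub> \<gamma> | x \<gamma>. x \<in> K \<and> \<gamma> \<in> \<Gamma>})
    \<comment> \<open>Mal'cev coordinates of the second kind w.r.t. X_0..X_{d-1}, X_i = e_i\<close>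
    \<and> (\<forall>i<d. one_param G (\<lambda>t. sc t i))
    \<and> (\<forall>x\<in>Vsp d. x = foldl (mult G) (one G) (map (\<lambda>i. sc (x i) i) [0..<d]))
    \<and> lie_alg G (carrier G) = Vsp d
    \<comment> \<open>filtration of degree k\<close>
    \<and> Gf 0 = carrier G \<and> Gf 1 = carrier G
    \<and> (\<forall>i. subgroup (Gf i) G \<and> closed (Gf i) \<and> connected (Gf i) \<and> Gf (Suc i) \<subseteq> Gf i)
    \<and> (\<forall>i j. generate G {gcomm G x y | x y. x \<in> Gf i \<and> y \<in> Gf j} \<subseteq> Gf (i + j))
    \<and> (\<forall>i>k. Gf i = {one G})
    \<comment> \<open>basis adapted to the filtration\<close>
    \<and> (\<forall>i. \<exists>m\<le>d. lie_alg G (Gf i) = {v. \<forall>j. (j < m \<or> d \<le> j) \<longrightarrow> v j = 0})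
    \<comment> \<open>structure constants, rationals of height at most M\<close>
    \<and> (\<forall>i<d. \<forall>j<d. \<forall>l<d.
          lie_br G i j l = (if max i j < l then real_of_rat (a i j l) else 0)
          \<and> (max i j < l \<longrightarrow> real_of_int (rat_height (a i j l)) \<le> M)))"

definition Q_rational :: "nat \<Rightarrow> vec monoid \<Rightarrow> real \<Rightarrow> vec set \<Rightarrow> bool" where
  "Q_rational d G Q H \<longleftrightarrow> (\<exists>(m::nat) (b::nat \<Rightarrow> vec). (\<forall>t<m. b t \<in> Vsp d \<and>
        (\<forall>j<d. \<exists>q. b t j = real_of_rat q \<and> real_of_int (rat_height q) \<le> Q))
      \<and> (\<forall>c. (\<forall>j. (\<Sum>t<m. c t * b t j) = 0) \<longrightarrow> (\<forall>t<m. c t = 0))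
      \<and> lie_alg G H = {(\<lambda>j. \<Sum>t<m. c t * b t j) | c. True})"

definition horiz_char :: "nat \<Rightarrow> vec monoid \<Rightarrow> (vec \<Rightarrow> real) \<Rightarrow> bool" where
  "horiz_char d G \<eta> \<longleftrightarrow> continuous_on (carrier G) \<eta>
     \<and> (\<forall>x\<in>carrier G. \<forall>y\<in>carrier G. \<eta> (x \<otimes>\<^bsub>G\<^esub> y) = \<eta> x + \<eta> y)
     \<and> (\<forall>\<gamma>\<in>lattice d. \<eta> \<gamma> \<in> \<int>)"

end

theory Submission
  imports "Jordan_Normal_Form.Determinant" Defs
begin

text \<open>
  Let \<open>\<eta>\<^sub>1, \<dots>, \<eta>\<^sub>r\<close> be an integral basis of the linear functionals on \<open>\<real>\<^sup>d\<close> that annihilate the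
  Lie algebra of \<open>G'\<close> and all brackets \<open>[X\<^sub>i, X\<^sub>j]\<close>; Cramer's rule bounds its size. A functional
  annihilating the brackets is invariant under the adjoint action, and since in Mal'cev coordinates of
  the second kind a coordinate direction at any point is a translate of a conjugate of some \<open>X\<^sub>i\<close>, it
  is a homomorphism \<open>G \<rightarrow> \<real>\<close>.

  An \<open>s\<close>-fold commutator in \<open>G\<close> depends only on the classes of its entries modulo commutators, and
  hence modulo any closed subgroup generated by them. The common kernel of the \<open>\<eta>\<^sub>i\<close> is the product of
  \<open>G'\<close> with such a subgroup, and \<open>s\<close>-fold commutators in \<open>G'\<close> are trivial.

  The passage from Lie algebras to closed connected subgroups is Cartan's argument: a limit of
  directions of elements of a closed subgroup that tend to the identity is tangent to a one-parameter
  group inside the subgroup.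
\<close>

section \<open>Integral annihilators of bounded size\<close>

text \<open>A Lie algebra enters only as the set of velocities at 0 of one-parameter groups, so the
  dictionary between subgroups and Lie algebras has to be built from limits and derivatives of the
  polynomial group law. The abstract commutator subgroup is not evidently closed. Two closed
  subgroups take its place: \<open>char_kernel\<close>, the common kernel of all linear functionals
  annihilating the brackets, and \<open>comm_invisible\<close>, the elements that entries of s-fold
  commutators absorb. Duality places the former inside the latter. An element x killed by all
  \<eta>_i has a coordinate vector v + b, with v in the Lie algebra of G' and b in the span of the
  brackets. The one-parameter group \<phi> with velocity v lies in G', and \<phi>(1) has the same
  value as v, hence as x, under every functional annihilating the brackets. So \<phi>(1)^-1 x lies
  in \<open>char_kernel\<close>, and no product of subgroups has to be shown closed. As to size,
  with R = QM, clearing denominators gives integer vectors bounded by R^d, and their minors are at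
  most d! (R^d)^d, which is at most R^(2 d^2).\<close>

lemma det_integral_bound:
  fixes A :: "real mat"
  assumes A: "A \<in> carrier_mat n n"
    and int: "\<And>i j. i < n \<Longrightarrow> j < n \<Longrightarrow> A $$ (i, j) \<in> \<int>"
    and bound: "\<And>i j. i < n \<Longrightarrow> j < n \<Longrightarrow> \<bar>A $$ (i, j)\<bar> \<le> B"
  shows "Determinant.det A \<in> \<int> \<and> \<bar>Determinant.det A\<bar> \<le> fact n * B ^ n"
proof
  have eq: "Determinant.det A =
      (\<Sum>p\<in>{p. p permutes {0..<n}}. signof p * (\<Prod>i = 0..<n. A $$ (i, p i)))"
    by (rule det_def'[OF A])
  have lt: "p i < n" if "p permutes {0..<n}" "i < n" for p i
    using permutes_in_image[OF that(1), of i] that(2) by auto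
  have sg: "signof p \<in> (\<int> :: real set)" "\<bar>signof p :: real\<bar> = 1" for p :: "nat \<Rightarrow> nat"
    by (auto simp: sign_def)
  show "Determinant.det A \<in> \<int>"
    unfolding eq
  proof (rule Ints_sum, rule Ints_mult[OF sg(1)], rule Ints_prod)
    fix p i assume "p \<in> {p. p permutes {0..<n}}" "i \<in> {0..<n}"
    then show "A $$ (i, p i) \<in> \<int>" using lt[of p i] by (intro int) auto
  qed
  have "\<bar>Determinant.det A\<bar> \<le> (\<Sum>p\<in>{p. p permutes {0..<n}}. B ^ n)"
    unfolding eq
  proof (rule order_trans[OF sum_abs], rule sum_mono)
    fix p assume p: "p \<in> {p. p permutes {0..<n}}"
    have "\<bar>\<Prod>i = 0..<n. A $$ (i, p i)\<bar> \<le> (\<Prod>i = 0..<n. B)"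
      unfolding abs_prod using p lt[of p] by (intro prod_mono) (auto intro: bound)
    then show "\<bar>signof p * (\<Prod>i = 0..<n. A $$ (i, p i))\<bar> \<le> B ^ n"
      by (simp add: abs_mult sg)
  qed
  also have "\<dots> = fact n * B ^ n"
    by (simp add: card_permutations)
  finally show "\<bar>Determinant.det A\<bar> \<le> fact n * B ^ n" .
qed

text \<open>The index set \<open>I\<close> marks the vectors \<open>p i\<close> taken from \<open>S\<close>; they are completed by unit vectors to
  a basis \<open>p\<close> of \<open>\<real>\<^sup>d\<close>. The rows of the adjugate of the matrix with columns \<open>p i\<close> form the dual
  basis up to the factor \<open>\<Delta>\<close>, and being minors they inherit integrality and size.\<close>

lemma dual_basis_extension:
  fixes S :: "vec set" and d :: nat
  shows "\<exists>I \<mu> p \<Delta>. I \<subseteq> {..<d} \<and> \<Delta> \<noteq> 0 \<and> (\<forall>i\<in>I. p i \<in> S)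
    \<and> (\<forall>j<d. j \<notin> I \<longrightarrow> (\<forall>s\<in>S. (\<Sum>l<d. \<mu> j l * s l) = 0))
    \<and> (\<forall>i<d. \<forall>j<d. (\<Sum>l<d. \<mu> j l * p i l) = (if i = j then \<Delta> else 0))
    \<and> (\<forall>x. \<forall>l<d. \<Delta> * x l = (\<Sum>j<d. (\<Sum>m<d. \<mu> j m * x m) * p j l))
    \<and> (\<forall>B\<ge>1. (\<forall>s\<in>S. \<forall>l<d. s l \<in> \<int> \<and> \<bar>s l\<bar> \<le> B) \<longrightarrow>
         (\<forall>j<d. \<forall>l<d. \<mu> j l \<in> \<int> \<and> \<bar>\<mu> j l\<bar> \<le> fact d * B ^ d))"
proof -
  define matof where "matof p = Matrix.mat d d (\<lambda>(l, j). p j l :: real)" for p :: "nat \<Rightarrow> vec"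
  have matof: "matof p \<in> carrier_mat d d" for p
    by (simp add: matof_def)
  \<comment> \<open>Exchange process: starting from the unit vectors, elements of \<open>S\<close>
    are swapped in as long as the determinant stays nonzero; below, a configuration with the most
    swaps is chosen.\<close>
  define good where "good I p \<longleftrightarrow> I \<subseteq> {..<d} \<and> (\<forall>i\<in>I. p i \<in> S)
      \<and> (\<forall>i<d. i \<notin> I \<longrightarrow> (\<exists>m. p i = sc 1 m)) \<and> Determinant.det (matof p) \<noteq> 0" for I p
  have "matof (sc 1) = 1\<^sub>m d"
    by (rule eq_matI) (auto simp: matof_def sc_def)
  then have "good {} (sc 1)"
    by (auto simp: good_def)
  then have ex: "\<exists>I p. good I p \<and> card I = 0"
    using card.empty by blast
  have le: "\<And>n. \<exists>I p. good I p \<and> card I = n \<Longrightarrow> n \<le> d"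
    unfolding good_def by (metis card_lessThan card_mono finite_lessThan)
  define n where "n = (GREATEST n. \<exists>I p. good I p \<and> card I = n)"
  have "\<exists>I p. good I p \<and> card I = n"
    unfolding n_def by (rule GreatestI_nat[of "\<lambda>n. \<exists>I p. good I p \<and> card I = n", OF ex le])
  moreover have max: "m \<le> n" if "\<exists>I p. good I p \<and> card I = m" for m
    unfolding n_def by (rule Greatest_le_nat[of "\<lambda>n. \<exists>I p. good I p \<and> card I = n", OF that le])
  ultimately obtain I p where g: "good I p" and cI: "card I = n" by blast
  define A where "A = matof p"
  define \<Delta> where "\<Delta> = Determinant.det A"
  define \<mu> where "\<mu> j l = adj_mat A $$ (j, l)" for j l
  have A: "A \<in> carrier_mat d d" by (simp add: A_def matof)
  note adj = adj_mat[OF A]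
  have dim[simp]: "dim_row (adj_mat A) = d" "dim_col (adj_mat A) = d" "dim_row A = d" "dim_col A = d"
    using adj(1) A by auto
  have \<Delta>: "\<Delta> \<noteq> 0" using g by (simp add: good_def \<Delta>_def A_def)
  have Aent: "A $$ (l, j) = p j l" if "l < d" "j < d" for l j
    using that by (simp add: A_def matof_def)
  have dual: "(\<Sum>l<d. \<mu> j l * p i l) = (if i = j then \<Delta> else 0)" if "i < d" "j < d" for i j
  proof -
    have "(adj_mat A * A) $$ (j, i) = (\<Sum>l<d. \<mu> j l * p i l)"
      using that by (auto simp: scalar_prod_def \<mu>_def Aent atLeast0LessThan intro!: sum.cong)
    then show ?thesis
      using that by (auto simp: adj(3) \<Delta>_def)
  qed
  have dual': "(\<Sum>j<d. p j l * \<mu> j m) = (if l = m then \<Delta> else 0)" if "l < d" "m < d" for l m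
  proof -
    have "(A * adj_mat A) $$ (l, m) = (\<Sum>j<d. p j l * \<mu> j m)"
      using that by (auto simp: scalar_prod_def \<mu>_def Aent atLeast0LessThan intro!: sum.cong)
    then show ?thesis
      using that by (auto simp: adj(2) \<Delta>_def)
  qed
  have recon: "\<Delta> * x l = (\<Sum>j<d. (\<Sum>m<d. \<mu> j m * x m) * p j l)" if "l < d" for x :: "nat \<Rightarrow> real" and l
  proof -
    have "(\<Sum>j<d. (\<Sum>m<d. \<mu> j m * x m) * p j l) = (\<Sum>j<d. \<Sum>m<d. (p j l * \<mu> j m) * x m)"
      by (simp add: sum_distrib_left mult_ac)
    also have "\<dots> = (\<Sum>m<d. (\<Sum>j<d. p j l * \<mu> j m) * x m)"
      by (subst sum.swap) (simp add: sum_distrib_right)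
    also have "\<dots> = (\<Sum>m<d. (if m = l then \<Delta> * x l else 0))"
      using that by (intro sum.cong) (auto simp: dual')
    finally show ?thesis using that by simp
  qed
  have ann: "(\<Sum>l<d. \<mu> k l * s l) = 0" if k: "k < d" "k \<notin> I" and s: "s \<in> S" for k s
  proof (rule ccontr)
    assume nz: "(\<Sum>l<d. \<mu> k l * s l) \<noteq> 0"
    \<comment> \<open>\<open>y\<close> holds the coordinates of \<open>s\<close> in the basis
      \<open>p\<close>. By Cramer's rule, putting \<open>s\<close> into column \<open>k\<close>
      multiplies the determinant by entry \<open>k\<close> of \<open>y\<close>, which is nonzero;
      the swap would enlarge \<open>I\<close>, against maximality.\<close>
    define y where "y = Matrix.vec d (\<lambda>j. (\<Sum>m<d. \<mu> j m * s m) / \<Delta>)"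
    have y: "y \<in> carrier_vec d" by (simp add: y_def)
    have "A *\<^sub>v y = Matrix.vec d s"
    proof (rule eq_vecI)
      fix l assume "l < dim_vec (Matrix.vec d s)"
      then have l: "l < d" by simp
      have "vec_index (A *\<^sub>v y) l = (\<Sum>j<d. p j l * ((\<Sum>m<d. \<mu> j m * s m) / \<Delta>))"
        using l by (auto simp: scalar_prod_def Aent y_def atLeast0LessThan intro!: sum.cong)
      also have "\<dots> = (\<Sum>j<d. (\<Sum>m<d. \<mu> j m * s m) * p j l) / \<Delta>"
        by (subst sum_divide_distrib) (simp add: mult_ac)
      also have "\<dots> = s l" using recon[OF l, of s] \<Delta> by (simp add: field_simps)
      finally show "vec_index (A *\<^sub>v y) l = vec_index (Matrix.vec d s) l" using l by simp
    qed simp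
    moreover have "replace_col A (Matrix.vec d s) k = matof (p(k := s))"
      by (rule eq_matI) (auto simp: replace_col_def A_def matof_def)
    ultimately have "Determinant.det (matof (p(k := s))) = vec_index y k * \<Delta>"
      using cramer_lemma_mat[OF A y k(1)] by (simp add: \<Delta>_def)
    also have "\<dots> \<noteq> 0" using nz \<Delta> k by (simp add: y_def)
    finally have "good (insert k I) (p(k := s))"
      using g k s by (auto simp: good_def)
    moreover have "card (insert k I) = Suc n"
      using k cI g by (subst card_insert_disjoint) (auto simp: good_def intro: finite_subset)
    ultimately show False using max[of "Suc n"] by auto
  qed
  have bd: "\<mu> j l \<in> \<int> \<and> \<bar>\<mu> j l\<bar> \<le> fact d * B ^ d"
    if B: "1 \<le> B" and S: "\<forall>s\<in>S. \<forall>l<d. s l \<in> \<int> \<and> \<bar>s l\<bar> \<le> B" and jl: "j < d" "l < d" for B j l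
  proof -
    have ent: "p i m \<in> \<int> \<and> \<bar>p i m\<bar> \<le> B" if im: "i < d" "m < d" for i m
    proof (cases "i \<in> I")
      case True
      then show ?thesis using g S im by (auto simp: good_def)
    next
      case False
      then obtain m' where "p i = sc 1 m'" using g im unfolding good_def by blast
      then show ?thesis using B by (auto simp: sc_def)
    qed
    define D where "D = mat_delete A l j"
    have D: "D \<in> carrier_mat (d - 1) (d - 1)"
      using jl by (auto simp: D_def mat_delete_def)
    have Dent: "D $$ (i, m) \<in> \<int> \<and> \<bar>D $$ (i, m)\<bar> \<le> B" if "i < d - 1" "m < d - 1" for i m
      using that jl by (auto simp: D_def mat_delete_def Aent ent)
    have det: "Determinant.det D \<in> \<int>" "\<bar>Determinant.det D\<bar> \<le> fact (d - 1) * B ^ (d - 1)"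
      using det_integral_bound[OF D, of B] Dent by auto
    have \<mu>: "\<mu> j l = (- 1) ^ (l + j) * Determinant.det D"
      using jl by (simp add: \<mu>_def adj_mat_def cofactor_def D_def)
    have "fact (d - 1) * B ^ (d - 1) \<le> fact d * B ^ d"
      using B by (intro mult_mono power_increasing fact_mono) auto
    then show ?thesis
      using det by (auto simp: \<mu> abs_mult power_abs)
  qed
  have "I \<subseteq> {..<d}" "\<forall>i\<in>I. p i \<in> S" using g by (auto simp: good_def)
  then show ?thesis
    using \<Delta> dual recon ann bd by (intro exI[of _ I] exI[of _ \<mu>] exI[of _ p] exI[of _ \<Delta>]) simp
qed

section \<open>Iterated commutators modulo the commutator subgroup\<close>

lemma iter_comm_1: "iter_comm G (Suc 0) w = w 0"
  by (simp add: iter_comm_def)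

lemma iter_comm_Suc: "1 \<le> i \<Longrightarrow> iter_comm G (Suc i) w = gcomm G (iter_comm G i w) (w i)"
  by (simp add: iter_comm_def)

lemma iter_comm_cong:
  "1 \<le> i \<Longrightarrow> (\<And>j. j < i \<Longrightarrow> w j = w' j) \<Longrightarrow> iter_comm G i w = iter_comm G i w'"
  unfolding iter_comm_def by (intro foldl_cong map_cong) auto

text \<open>\<open>lcs\<close> counts from 0: an s-fold commutator lies in
  \<open>lcs G H (s - 1)\<close>, usually written gamma_s(H), which is exactly the term that
  \<open>nilp_step_le G H (s - 1)\<close> makes trivial.\<close>

lemma iter_comm_in_lcs:
  assumes "1 \<le> s" "\<And>j. j < s \<Longrightarrow> w j \<in> H"
  shows "iter_comm G s w \<in> lcs G H (s - 1)"
  using assms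
proof (induction s rule: nat_induct_at_least)
  case base
  then show ?case by (simp add: iter_comm_1)
next
  case (Suc n)
  then obtain m where n: "n = Suc m" by (cases n) auto
  have "iter_comm G n w \<in> lcs G H (n - 1)" "w n \<in> H" using Suc by auto
  then show ?case
    using Suc.hyps by (auto simp: iter_comm_Suc n intro!: generate.incl)
qed

context group
begin

lemma gcomm_closed[simp, intro]: "x \<in> carrier G \<Longrightarrow> y \<in> carrier G \<Longrightarrow> gcomm G x y \<in> carrier G"
  by (simp add: gcomm_def)

lemma gcomm_eq: "x \<in> carrier G \<Longrightarrow> y \<in> carrier G \<Longrightarrow> y \<otimes> x \<otimes> gcomm G x y = x \<otimes> y"
  by (simp add: gcomm_def inv_mult_group[symmetric] m_assoc[symmetric])

lemma gcomm_one_iff: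
  assumes "x \<in> carrier G" "y \<in> carrier G"
  shows "gcomm G x y = \<one> \<longleftrightarrow> x \<otimes> y = y \<otimes> x"
proof -
  have "gcomm G x y = \<one> \<longleftrightarrow> y \<otimes> x \<otimes> gcomm G x y = y \<otimes> x \<otimes> \<one>"
    using assms by (subst Units_l_cancel) auto
  then show ?thesis using assms by (auto simp: gcomm_eq)
qed

lemma gcomm_mult_central:
  assumes "u \<in> carrier G" "w \<in> carrier G" "z \<in> carrier G"
    and z: "\<And>y. y \<in> carrier G \<Longrightarrow> z \<otimes> y = y \<otimes> z"
  shows "gcomm G (u \<otimes> z) w = gcomm G u w"
proof -
  have "w \<otimes> (u \<otimes> z) \<otimes> gcomm G (u \<otimes> z) w = u \<otimes> z \<otimes> w"
    using assms by (intro gcomm_eq) auto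
  also have "\<dots> = u \<otimes> w \<otimes> z" using assms by (simp add: m_assoc)
  also have "\<dots> = w \<otimes> u \<otimes> gcomm G u w \<otimes> z" using assms by (simp add: gcomm_eq)
  also have "\<dots> = w \<otimes> (u \<otimes> z) \<otimes> gcomm G u w" using assms by (simp add: m_assoc)
  finally show ?thesis using assms by (subst (asm) Units_l_cancel) auto
qed

text \<open>\<open>gcomm G u (w \<otimes> h)\<close> equals u^-1 h^-1 (w^-1 u w) h, so it suffices
  that \<open>h\<close> commutes with the conjugate of \<open>u\<close> by \<open>w\<close>.\<close>

lemma gcomm_mult_right:
  assumes c: "u \<in> carrier G" "w \<in> carrier G" "h \<in> carrier G"
    and h: "(inv w \<otimes> u \<otimes> w) \<otimes> h = h \<otimes> (inv w \<otimes> u \<otimes> w)"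
  shows "gcomm G u (w \<otimes> h) = gcomm G u w"
proof -
  have "gcomm G u (w \<otimes> h) = inv u \<otimes> (inv h \<otimes> ((inv w \<otimes> u \<otimes> w) \<otimes> h))"
    using c by (simp add: gcomm_def inv_mult_group m_assoc)
  also have "inv h \<otimes> ((inv w \<otimes> u \<otimes> w) \<otimes> h) = inv w \<otimes> u \<otimes> w"
    unfolding h using c by (simp add: m_assoc[symmetric])
  finally show ?thesis using c by (simp add: gcomm_def m_assoc)
qed

text \<open>Conjugation by \<open>a\<close> and by \<open>b\<close> multiplies \<open>x\<close> by central elements, so the two conjugations
  commute on \<open>x\<close>.\<close>

lemma gcomm_gcomm_central:
  assumes c: "x \<in> carrier G" "a \<in> carrier G" "b \<in> carrier G"
    and ca: "\<And>y. y \<in> carrier G \<Longrightarrow> gcomm G x a \<otimes> y = y \<otimes> gcomm G x a"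
    and cb: "\<And>y. y \<in> carrier G \<Longrightarrow> gcomm G x b \<otimes> y = y \<otimes> gcomm G x b"
  shows "x \<otimes> gcomm G a b = gcomm G a b \<otimes> x"
proof -
  define p q g where "p = gcomm G x a" and "q = gcomm G x b" and "g = gcomm G a b"
  have pq: "p \<in> carrier G" "q \<in> carrier G" "g \<in> carrier G" using c by (auto simp: p_def q_def g_def)
  have xa: "x \<otimes> a = a \<otimes> x \<otimes> p" and xb: "x \<otimes> b = b \<otimes> x \<otimes> q"
    using c by (simp_all add: gcomm_eq p_def q_def)
  have p: "p \<otimes> y = y \<otimes> p" and q: "q \<otimes> y = y \<otimes> q" if "y \<in> carrier G" for y
    using that ca cb by (auto simp: p_def q_def)
  have 1: "x \<otimes> (a \<otimes> b) = (a \<otimes> b) \<otimes> x \<otimes> (p \<otimes> q)"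
  proof -
    have "x \<otimes> (a \<otimes> b) = a \<otimes> x \<otimes> (p \<otimes> b)" using c pq by (simp add: m_assoc[symmetric] xa)
    also have "\<dots> = a \<otimes> (x \<otimes> b) \<otimes> p" using c pq by (simp add: m_assoc p)
    also have "\<dots> = (a \<otimes> b) \<otimes> x \<otimes> (q \<otimes> p)" using c pq by (simp add: m_assoc xb)
    finally show ?thesis using pq p[of q] by simp
  qed
  have 2: "x \<otimes> (b \<otimes> a) = (b \<otimes> a) \<otimes> x \<otimes> (p \<otimes> q)"
  proof -
    have "x \<otimes> (b \<otimes> a) = b \<otimes> x \<otimes> (q \<otimes> a)" using c pq by (simp add: m_assoc[symmetric] xb)
    also have "\<dots> = b \<otimes> (x \<otimes> a) \<otimes> q" using c pq by (simp add: m_assoc q)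
    also have "\<dots> = (b \<otimes> a) \<otimes> x \<otimes> (p \<otimes> q)" using c pq by (simp add: m_assoc xa)
    finally show ?thesis .
  qed
  have ab: "a \<otimes> b = b \<otimes> a \<otimes> g" using c by (simp add: gcomm_eq g_def)
  have r: "(p \<otimes> q) \<otimes> g = g \<otimes> (p \<otimes> q)"
    using pq p[of g] q[of g] by (metis m_assoc)
  have "(b \<otimes> a) \<otimes> (x \<otimes> g \<otimes> (p \<otimes> q)) = ((b \<otimes> a) \<otimes> x \<otimes> (p \<otimes> q)) \<otimes> g"
    using c pq r by (simp add: m_assoc)
  also have "\<dots> = x \<otimes> (a \<otimes> b)"
    unfolding 2[symmetric] using c pq by (simp add: ab m_assoc)
  also have "\<dots> = (b \<otimes> a) \<otimes> (g \<otimes> x \<otimes> (p \<otimes> q))"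
    using c pq unfolding 1 by (simp add: ab m_assoc)
  finally have "x \<otimes> g \<otimes> (p \<otimes> q) = g \<otimes> x \<otimes> (p \<otimes> q)"
    using c pq by (subst (asm) Units_l_cancel) auto
  then show ?thesis
    using c pq unfolding g_def[symmetric] by (subst (asm) right_cancel) auto
qed

lemma inv_cancel_left: "x \<in> carrier G \<Longrightarrow> y \<in> carrier G \<Longrightarrow> inv x \<otimes> (x \<otimes> y) = y"
  by (simp add: m_assoc[symmetric])

text \<open>By induction, conjugation permutes the generating commutators. Normality allows
  centrality to be expressed in quotients by terms of the series.\<close>

lemma lcs_normal: "lcs G (carrier G) n \<lhd> G"
proof (induction n)
  case 0
  show ?case by (simp add: normal_inv_iff subgroup_self)
next
  case (Suc n)
  have sub: "lcs G (carrier G) n \<subseteq> carrier G"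
    using Suc by (simp add: normal_imp_subgroup subgroup.subset)
  show ?case unfolding lcs.simps
  proof (rule normal_generateI)
    show "{gcomm G x y |x y. x \<in> lcs G (carrier G) n \<and> y \<in> carrier G} \<subseteq> carrier G"
      using sub by auto
  next
    fix h g assume "h \<in> {gcomm G x y |x y. x \<in> lcs G (carrier G) n \<and> y \<in> carrier G}"
      and g: "g \<in> carrier G"
    then obtain x y where h: "h = gcomm G x y" and x: "x \<in> lcs G (carrier G) n" and y: "y \<in> carrier G"
      by auto
    have xc: "x \<in> carrier G" using x sub by auto
    have "g \<otimes> h \<otimes> inv g = gcomm G (g \<otimes> x \<otimes> inv g) (g \<otimes> y \<otimes> inv g)"
      using g xc y by (simp add: h gcomm_def inv_mult_group m_assoc inv_cancel_left)
    moreover have "g \<otimes> x \<otimes> inv g \<in> lcs G (carrier G) n"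
      using Suc g x normal_inv_iff by blast
    ultimately show "g \<otimes> h \<otimes> inv g \<in> {gcomm G x y |x y. x \<in> lcs G (carrier G) n \<and> y \<in> carrier G}"
      using g y by auto
  qed
qed

lemma lcs_subset: "lcs G (carrier G) n \<subseteq> carrier G"
  using lcs_normal normal_imp_subgroup subgroup.subset by blast

lemma gcomm_in_lcs:
  "x \<in> lcs G (carrier G) n \<Longrightarrow> y \<in> carrier G \<Longrightarrow> gcomm G x y \<in> lcs G (carrier G) (Suc n)"
  by (auto intro: generate.incl)

lemma quotient_hom: "N \<lhd> G \<Longrightarrow> group_hom G (G Mod N) ((#>) N)"
  by (simp add: group_hom_def group_hom_axioms_def group_axioms normal.factorgroup_is_group
      normal.r_coset_hom_Mod)

lemma quotient_one_iff: "N \<lhd> G \<Longrightarrow> x \<in> carrier G \<Longrightarrow> N #> x = \<one>\<^bsub>G Mod N\<^esub> \<longleftrightarrow> x \<in> N"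
  by (metis FactGroup_def coset_join1 coset_join2 monoid.simps(2) normal_imp_subgroup subgroup.subset)

end

lemma (in group_hom) hom_gcomm:
  "x \<in> carrier G \<Longrightarrow> y \<in> carrier G \<Longrightarrow> h (gcomm G x y) = gcomm H (h x) (h y)"
  by (simp add: gcomm_def)

text \<open>Commutators of \<open>lcs n\<close> with the whole group lie in
  \<open>lcs (Suc n)\<close> and hence become trivial in the quotient.\<close>

lemma (in group) quotient_lcs_central:
  assumes x: "x \<in> lcs G (carrier G) n"
    and y: "y \<in> carrier (G Mod lcs G (carrier G) (Suc n))"
  shows "(lcs G (carrier G) (Suc n) #> x) \<otimes>\<^bsub>G Mod lcs G (carrier G) (Suc n)\<^esub> y
    = y \<otimes>\<^bsub>G Mod lcs G (carrier G) (Suc n)\<^esub> (lcs G (carrier G) (Suc n) #> x)"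
proof -
  let ?N = "lcs G (carrier G) (Suc n)"
  interpret f: group_hom G "G Mod ?N" "(#>) ?N" by (rule quotient_hom[OF lcs_normal])
  obtain z where z: "z \<in> carrier G" "y = ?N #> z"
    using y by (auto simp: FactGroup_def RCOSETS_def)
  have xc: "x \<in> carrier G" using x lcs_subset by auto
  have "gcomm (G Mod ?N) (?N #> x) (?N #> z) = \<one>\<^bsub>G Mod ?N\<^esub>"
    using gcomm_in_lcs[OF x z(1)] xc z(1)
    by (simp add: f.hom_gcomm[symmetric] quotient_one_iff[OF lcs_normal] del: lcs.simps one_FactGroup)
  then show ?thesis
    using xc z by (simp add: f.H.gcomm_one_iff del: lcs.simps one_FactGroup mult_FactGroup)
qed

text \<open>An i-fold commutator need only be tracked modulo \<open>lcs i\<close>, one term deeper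
  than the term \<open>lcs (i - 1)\<close> containing it. At i = s this modulus is trivial, so
  congruence becomes equality.\<close>

proposition (in group) iter_comm_mult_gcomm:
  assumes nil: "nilp_step_le G (carrier G) s" and j: "j < s"
    and w: "\<And>i. i < s \<Longrightarrow> w i \<in> carrier G" and ab: "a \<in> carrier G" "b \<in> carrier G"
  shows "iter_comm G s (w(j := w j \<otimes> gcomm G a b)) = iter_comm G s w"
proof -
  define w' where "w' = w(j := w j \<otimes> gcomm G a b)"
  let ?\<gamma> = "lcs G (carrier G)"
  have w': "w' i \<in> carrier G" if "i < s" for i using w[OF that] ab j w by (auto simp: w'_def)
  have u: "iter_comm G i w \<in> ?\<gamma> (i - 1)" if "1 \<le> i" "i \<le> s" for i
    using that w by (intro iter_comm_in_lcs) auto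
  have u': "iter_comm G i w' \<in> ?\<gamma> (i - 1)" if "1 \<le> i" "i \<le> s" for i
    using that w' by (intro iter_comm_in_lcs) auto
  note sub = subsetD[OF lcs_subset]
  have key: "?\<gamma> i #> iter_comm G i w' = ?\<gamma> i #> iter_comm G i w" if "Suc j \<le> i" "i \<le> s" for i
    using that
  proof (induction i rule: nat_induct_at_least)
    case base
    let ?N = "?\<gamma> (Suc j)"
    interpret f: group_hom G "G Mod ?N" "(#>) ?N" by (rule quotient_hom[OF lcs_normal])
    show ?case
    proof (cases j)
      case 0
      have "?N #> gcomm G a b = \<one>\<^bsub>G Mod ?N\<^esub>"
        using ab gcomm_in_lcs[of a 0 b] by (subst quotient_one_iff[OF lcs_normal]) (auto simp: 0)
      then have "?N #> (w j \<otimes> gcomm G a b) = ?N #> w j"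
        using w[OF j] ab by (simp add: f.hom_mult del: lcs.simps one_FactGroup mult_FactGroup)
      then show ?thesis by (simp add: 0 iter_comm_1 w'_def del: lcs.simps)
    next
      case (Suc m)
      define u where "u = iter_comm G j w"
      have uu: "u \<in> ?\<gamma> m" using u[of j] j Suc by (simp add: u_def)
      \<comment> \<open>\<open>v\<close> is the conjugate demanded by
        \<open>gcomm_mult_right\<close>. Its commutators with anything lie in \<open>lcs j\<close>,
        which is central modulo \<open>lcs (Suc j)\<close>, so \<open>gcomm_gcomm_central\<close>
        makes \<open>v\<close> commute with \<open>gcomm G a b\<close> there. This is the inclusion
        of [gamma_j, gamma_2] in gamma_(j+2).\<close>
      define v where "v = inv (w j) \<otimes> u \<otimes> w j"
      have v: "v \<in> ?\<gamma> m"
        using normal.inv_op_closed1[OF lcs_normal w[OF j] uu] by (simp add: v_def)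
      have c: "u \<in> carrier G" "v \<in> carrier G" using uu v sub by auto
      have "(?N #> gcomm G v x) \<otimes>\<^bsub>G Mod ?N\<^esub> y = y \<otimes>\<^bsub>G Mod ?N\<^esub> (?N #> gcomm G v x)"
        if "x \<in> carrier G" "y \<in> carrier (G Mod ?N)" for x y
        using quotient_lcs_central[OF gcomm_in_lcs[OF v that(1)]] that(2) unfolding Suc by blast
      then have vg: "(?N #> v) \<otimes>\<^bsub>G Mod ?N\<^esub> (?N #> gcomm G a b)
          = (?N #> gcomm G a b) \<otimes>\<^bsub>G Mod ?N\<^esub> (?N #> v)"
        using c ab unfolding f.hom_gcomm[OF ab]
        by (intro f.H.gcomm_gcomm_central f.hom_closed) (simp_all only: f.hom_gcomm[symmetric])
      have "?N #> gcomm G u (w j \<otimes> gcomm G a b) = ?N #> gcomm G u (w j)"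
        using c ab w[OF j] vg
        by (simp add: f.hom_gcomm v_def f.H.gcomm_mult_right del: lcs.simps mult_FactGroup)
      moreover have "iter_comm G j w' = u"
        unfolding u_def using Suc by (intro iter_comm_cong) (auto simp: w'_def)
      moreover have "w' j = w j \<otimes> gcomm G a b" by (simp add: w'_def)
      ultimately show ?thesis
        using Suc by (simp add: iter_comm_Suc u_def del: lcs.simps)
    qed
  next
    case (Suc i)
    let ?N = "?\<gamma> (Suc i)"
    interpret f: group_hom G "G Mod ?N" "(#>) ?N" by (rule quotient_hom[OF lcs_normal])
    define u u' where "u = iter_comm G i w" and "u' = iter_comm G i w'"
    have i: "1 \<le> i" "i \<le> s" "i < s" "j \<noteq> i" using Suc by auto
    have c: "u \<in> carrier G" "u' \<in> carrier G"
      using u[OF i(1,2)] u'[OF i(1,2)] sub by (auto simp: u_def u'_def)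
    \<comment> \<open>By the induction hypothesis the discrepancy \<open>z\<close> lies in
      \<open>lcs i\<close>, so it is central modulo \<open>lcs (Suc i)\<close> and the next
      commutator does not see it.\<close>
    define z where "z = inv u \<otimes> u'"
    have zc: "z \<in> carrier G" using c by (simp add: z_def)
    interpret g: group_hom G "G Mod ?\<gamma> i" "(#>) (?\<gamma> i)" by (rule quotient_hom[OF lcs_normal])
    have "?\<gamma> i #> u' = ?\<gamma> i #> u" using Suc.IH i by (simp add: u_def u'_def)
    then have "?\<gamma> i #> z = \<one>\<^bsub>G Mod ?\<gamma> i\<^esub>" using c by (simp add: z_def del: mult_FactGroup one_FactGroup)
    then have z: "z \<in> ?\<gamma> i" using quotient_one_iff[OF lcs_normal zc] by simp
    have "u' = u \<otimes> z" using c by (simp add: z_def m_assoc[symmetric])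
    then have "?N #> gcomm G u' (w i) = ?N #> gcomm G u (w i)"
      using c zc w[OF i(3)]
      by (simp add: f.hom_gcomm f.H.gcomm_mult_central quotient_lcs_central[OF z] del: lcs.simps mult_FactGroup)
    moreover have "w' i = w i" using i by (simp add: w'_def)
    ultimately show ?case
      using i by (simp add: iter_comm_Suc u_def u'_def del: lcs.simps)
  qed
  have "?\<gamma> s = {\<one>}" using nil by (simp add: nilp_step_le_def)
  moreover have "iter_comm G s w \<in> carrier G" "iter_comm G s w' \<in> carrier G"
    using u[of s] u'[of s] j sub by auto
  ultimately show ?thesis
    using key[of s] j unfolding w'_def[symmetric] by (simp add: r_coset_def)
qed

section \<open>Polynomial maps on coordinate space\<close>

text \<open>The l1 distance on the first \<open>d\<close> coordinates. Quantitative estimates need a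
  homogeneous size, whereas \<open>vec\<close> carries the product topology; on \<open>Vsp d\<close>
  the two are linked coordinate by coordinate.\<close>

definition ldist :: "nat \<Rightarrow> vec \<Rightarrow> vec \<Rightarrow> real" where
  "ldist d x y = (\<Sum>l<d. \<bar>x l - y l\<bar>)"

abbreviation lnorm :: "nat \<Rightarrow> vec \<Rightarrow> real" where
  "lnorm d x \<equiv> ldist d x (\<lambda>_. 0)"

lemma ldist_nonneg[simp]: "0 \<le> ldist d x y"
  by (simp add: ldist_def sum_nonneg)

lemma ldist_triangle: "ldist d x z \<le> ldist d x y + ldist d y z"
  unfolding ldist_def sum.distrib[symmetric] by (intro sum_mono) linarith

lemma ldist_commute: "ldist d x y = ldist d y x"
  by (simp add: ldist_def abs_minus_commute)

lemma coord_le_ldist: "l < d \<Longrightarrow> \<bar>x l - y l\<bar> \<le> ldist d x y"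
  unfolding ldist_def by (rule member_le_sum) auto

lemma coord_le_ldist_Vsp: "x \<in> Vsp d \<Longrightarrow> y \<in> Vsp d \<Longrightarrow> \<bar>x l - y l\<bar> \<le> ldist d x y"
  by (cases "l < d") (auto simp: Vsp_def coord_le_ldist)

lemma zero_in_Vsp[simp]: "(\<lambda>_. 0) \<in> Vsp d"
  by (simp add: Vsp_def)

lemma sc_in_Vsp[simp]: "i < d \<Longrightarrow> sc t i \<in> Vsp d"
  by (simp add: Vsp_def sc_def)

lemma sc_0[simp]: "sc 0 i = (\<lambda>_. 0)"
  by (auto simp: sc_def)

text \<open>The mixed second difference is the decisive clause: for the group law, whose identity is
  0, taking x' = y' = 0 turns it into a bound for xy - x - y by a multiple of |x| |y|.\<close>

definition lipschitz2 :: "nat \<Rightarrow> real \<Rightarrow> real \<Rightarrow> (vec \<Rightarrow> vec \<Rightarrow> real) \<Rightarrow> bool" where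
  "lipschitz2 d R C p \<longleftrightarrow> (\<forall>x\<in>Vsp d. \<forall>x'\<in>Vsp d. \<forall>y\<in>Vsp d. \<forall>y'\<in>Vsp d.
    lnorm d x \<le> R \<longrightarrow> lnorm d x' \<le> R \<longrightarrow> lnorm d y \<le> R \<longrightarrow> lnorm d y' \<le> R \<longrightarrow>
      \<bar>p x y\<bar> \<le> C \<and> \<bar>p x y - p x' y\<bar> \<le> C * ldist d x x' \<and> \<bar>p x y - p x y'\<bar> \<le> C * ldist d y y'
      \<and> \<bar>p x y - p x' y - p x y' + p x' y'\<bar> \<le> C * ldist d x x' * ldist d y y')"

lemma lipschitz2D:
  assumes "lipschitz2 d R C p" "x \<in> Vsp d" "x' \<in> Vsp d" "y \<in> Vsp d" "y' \<in> Vsp d"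
    "lnorm d x \<le> R" "lnorm d x' \<le> R" "lnorm d y \<le> R" "lnorm d y' \<le> R"
  shows "\<bar>p x y\<bar> \<le> C \<and> \<bar>p x y - p x' y\<bar> \<le> C * ldist d x x' \<and> \<bar>p x y - p x y'\<bar> \<le> C * ldist d y y'
    \<and> \<bar>p x y - p x' y - p x y' + p x' y'\<bar> \<le> C * ldist d x x' * ldist d y y'"
  using assms unfolding lipschitz2_def by blast

text \<open>In the product case the mixed second difference of \<open>p q\<close> is expanded by the
  discrete Leibniz rule.\<close>

lemma polyfun2_estimates:
  assumes "polyfun2 p"
  shows "\<exists>C\<ge>0. lipschitz2 d R C p"
  using assms
proof (induction rule: polyfun2.induct)
  case (pconst c)
  show ?case by (rule exI[of _ "\<bar>c\<bar>"]) (auto simp: lipschitz2_def)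
next
  case (pprojx i)
  show ?case
  proof (unfold lipschitz2_def, rule exI[of _ "1 + \<bar>R\<bar>"], safe)
    fix x x' y y' assume *: "x \<in> Vsp d" "x' \<in> Vsp d" "lnorm d x \<le> R"
    show "\<bar>x i\<bar> \<le> 1 + \<bar>R\<bar>" using coord_le_ldist_Vsp[OF *(1) zero_in_Vsp, of i] *(3) by simp
    have "\<bar>x i - x' i\<bar> \<le> 1 * ldist d x x'" using coord_le_ldist_Vsp[OF *(1,2), of i] by simp
    also have "\<dots> \<le> (1 + \<bar>R\<bar>) * ldist d x x'" by (intro mult_right_mono) auto
    finally show "\<bar>x i - x' i\<bar> \<le> (1 + \<bar>R\<bar>) * ldist d x x'" .
  qed auto
next
  case (pprojy i)
  show ?case
  proof (unfold lipschitz2_def, rule exI[of _ "1 + \<bar>R\<bar>"], safe)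
    fix x x' y y' assume *: "y \<in> Vsp d" "y' \<in> Vsp d" "lnorm d y \<le> R"
    show "\<bar>y i\<bar> \<le> 1 + \<bar>R\<bar>" using coord_le_ldist_Vsp[OF *(1) zero_in_Vsp, of i] *(3) by simp
    have "\<bar>y i - y' i\<bar> \<le> 1 * ldist d y y'" using coord_le_ldist_Vsp[OF *(1,2), of i] by simp
    also have "\<dots> \<le> (1 + \<bar>R\<bar>) * ldist d y y'" by (intro mult_right_mono) auto
    finally show "\<bar>y i - y' i\<bar> \<le> (1 + \<bar>R\<bar>) * ldist d y y'" .
  qed auto
next
  case (padd p q)
  then obtain C D where C: "0 \<le> C" "lipschitz2 d R C p" and D: "0 \<le> D" "lipschitz2 d R D q"
    by blast
  show ?case
  proof (unfold lipschitz2_def, rule exI[of _ "C + D"], intro conjI ballI impI)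
    show "0 \<le> C + D" using C(1) D(1) by simp
    fix x x' y y' assume *: "x \<in> Vsp d" "x' \<in> Vsp d" "y \<in> Vsp d" "y' \<in> Vsp d"
      "lnorm d x \<le> R" "lnorm d x' \<le> R" "lnorm d y \<le> R" "lnorm d y' \<le> R"
    note c = lipschitz2D[OF C(2) *] and e = lipschitz2D[OF D(2) *]
    have "\<bar>p x y\<bar> \<le> C" "\<bar>q x y\<bar> \<le> D" using c e by blast+
    then show "\<bar>p x y + q x y\<bar> \<le> C + D" by linarith
    have "\<bar>p x y - p x' y\<bar> \<le> C * ldist d x x'" "\<bar>q x y - q x' y\<bar> \<le> D * ldist d x x'"
      using c e by blast+
    then show "\<bar>p x y + q x y - (p x' y + q x' y)\<bar> \<le> (C + D) * ldist d x x'"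
      unfolding distrib_right by linarith
    have "\<bar>p x y - p x y'\<bar> \<le> C * ldist d y y'" "\<bar>q x y - q x y'\<bar> \<le> D * ldist d y y'"
      using c e by blast+
    then show "\<bar>p x y + q x y - (p x y' + q x y')\<bar> \<le> (C + D) * ldist d y y'"
      unfolding distrib_right by linarith
    have "\<bar>p x y - p x' y - p x y' + p x' y'\<bar> \<le> C * ldist d x x' * ldist d y y'"
      "\<bar>q x y - q x' y - q x y' + q x' y'\<bar> \<le> D * ldist d x x' * ldist d y y'"
      using c e by blast+
    then show "\<bar>p x y + q x y - (p x' y + q x' y) - (p x y' + q x y') + (p x' y' + q x' y')\<bar>
        \<le> (C + D) * ldist d x x' * ldist d y y'"
      unfolding distrib_right by linarith
  qed
next
  case (pmult p q)
  then obtain C D where C: "0 \<le> C" "lipschitz2 d R C p" and D: "0 \<le> D" "lipschitz2 d R D q"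
    by blast
  show ?case
  \<comment> \<open>The 4 counts the terms in the expansion of the mixed difference of a product;
    the first differences produce only two terms.\<close>
  proof (unfold lipschitz2_def, rule exI[of _ "4 * (C * D)"], intro conjI ballI impI)
    show "0 \<le> 4 * (C * D)" using C(1) D(1) by simp
    fix x x' y y' assume *: "x \<in> Vsp d" "x' \<in> Vsp d" "y \<in> Vsp d" "y' \<in> Vsp d"
      "lnorm d x \<le> R" "lnorm d x' \<le> R" "lnorm d y \<le> R" "lnorm d y' \<le> R"
    define a b where "a = ldist d x x'" and "b = ldist d y y'"
    have ab: "0 \<le> a" "0 \<le> b" by (simp_all add: a_def b_def)
    have sw: "ldist d x' x = a" "ldist d y' y = b" by (simp_all add: a_def b_def ldist_commute)
    note c11 = lipschitz2D[OF C(2) *, folded a_def b_def] and e11 = lipschitz2D[OF D(2) *, folded a_def b_def]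
    note c10 = lipschitz2D[OF C(2) *(1,2,4,3,5,6,8,7), folded a_def, unfolded sw]
    note c01 = lipschitz2D[OF C(2) *(2,1,3,4,6,5,7,8), folded b_def, unfolded sw]
    note c00 = lipschitz2D[OF C(2) *(2,1,4,3,6,5,8,7)]
    have m: "\<bar>u * v\<bar> \<le> s * t" if "\<bar>u\<bar> \<le> s" "\<bar>v\<bar> \<le> t" for u v s t :: real
      using that unfolding abs_mult by (intro mult_mono) linarith+
    have CD: "0 \<le> C * D" using C(1) D(1) by simp
    have "\<bar>p x y * q x y\<bar> \<le> C * D" using c11 e11 by (intro m) auto
    then show "\<bar>p x y * q x y\<bar> \<le> 4 * (C * D)" using CD by linarith
    have "\<bar>(p x y - p x' y) * q x y\<bar> \<le> (C * a) * D" "\<bar>p x' y * (q x y - q x' y)\<bar> \<le> C * (D * a)"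
      using c11 e11 c01 by (auto intro!: m)
    moreover have "p x y * q x y - p x' y * q x' y
        = (p x y - p x' y) * q x y + p x' y * (q x y - q x' y)" by (simp add: algebra_simps)
    ultimately have "\<bar>p x y * q x y - p x' y * q x' y\<bar> \<le> 2 * ((C * D) * a)"
      by (simp add: mult_ac)
    moreover have "0 \<le> (C * D) * a" "0 \<le> (C * D) * b" "0 \<le> (C * D) * a * b" using CD ab by auto
    ultimately show "\<bar>p x y * q x y - p x' y * q x' y\<bar> \<le> 4 * (C * D) * ldist d x x'"
      unfolding a_def[symmetric] by linarith
    have "\<bar>(p x y - p x y') * q x y\<bar> \<le> (C * b) * D" "\<bar>p x y' * (q x y - q x y')\<bar> \<le> C * (D * b)"
      using c11 e11 c10 by (auto intro!: m)
    moreover have "p x y * q x y - p x y' * q x y'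
        = (p x y - p x y') * q x y + p x y' * (q x y - q x y')" by (simp add: algebra_simps)
    ultimately have "\<bar>p x y * q x y - p x y' * q x y'\<bar> \<le> 2 * ((C * D) * b)"
      by (simp add: mult_ac)
    then show "\<bar>p x y * q x y - p x y' * q x y'\<bar> \<le> 4 * (C * D) * ldist d y y'"
      unfolding b_def[symmetric] using \<open>0 \<le> (C * D) * b\<close> by linarith
    have "\<bar>(p x y - p x' y - p x y' + p x' y') * q x y\<bar> \<le> (C * a * b) * D"
      "\<bar>(p x y' - p x' y') * (q x y - q x y')\<bar> \<le> (C * a) * (D * b)"
      "\<bar>(p x' y - p x' y') * (q x y - q x' y)\<bar> \<le> (C * b) * (D * a)"
      "\<bar>p x' y' * (q x y - q x' y - q x y' + q x' y')\<bar> \<le> C * (D * a * b)"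
      using c11 e11 c10 c01 c00 by (auto intro!: m)
    moreover have "p x y * q x y - p x' y * q x' y - p x y' * q x y' + p x' y' * q x' y'
      = (p x y - p x' y - p x y' + p x' y') * q x y + (p x y' - p x' y') * (q x y - q x y')
       + (p x' y - p x' y') * (q x y - q x' y) + p x' y' * (q x y - q x' y - q x y' + q x' y')"
      by (simp add: algebra_simps)
    ultimately have "\<bar>p x y * q x y - p x' y * q x' y - p x y' * q x y' + p x' y' * q x' y'\<bar>
        \<le> 4 * ((C * D) * a * b)"
      by (simp add: mult_ac)
    then show "\<bar>p x y * q x y - p x' y * q x' y - p x y' * q x y' + p x' y' * q x' y'\<bar>
        \<le> 4 * (C * D) * ldist d x x' * ldist d y y'"
      by (simp add: a_def b_def mult_ac)
  qed
qed

text \<open>Coordinatewise, since the infinite product \<open>vec\<close> is not a normed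
  space.\<close>

definition curve_deriv :: "(real \<Rightarrow> vec) \<Rightarrow> vec \<Rightarrow> real \<Rightarrow> bool" where
  "curve_deriv X v t \<longleftrightarrow> (\<forall>l. ((\<lambda>t. X t l) has_real_derivative v l) (at t))"

lemma curve_deriv_const: "curve_deriv (\<lambda>_. x) (\<lambda>_. 0) t"
  by (simp add: curve_deriv_def)

lemma curve_deriv_sc: "curve_deriv (\<lambda>t. sc (c * t) i) (sc c i) t"
  by (auto simp: curve_deriv_def sc_def intro!: derivative_eq_intros)

text \<open>The partial derivatives are again polynomial, so that the adjoint matrix, itself a first
  derivative of the group law, can be differentiated once more.\<close>

lemma polyfun2_chain:
  assumes "polyfun2 p"
  shows "\<exists>gx gy. (\<forall>j. polyfun2 (gx j) \<and> polyfun2 (gy j)) \<and>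
    (\<forall>X Y v w t. (\<forall>t. X t \<in> Vsp d \<and> Y t \<in> Vsp d) \<longrightarrow> curve_deriv X v t \<longrightarrow> curve_deriv Y w t \<longrightarrow>
      ((\<lambda>t. p (X t) (Y t)) has_real_derivative
        (\<Sum>j<d. gx j (X t) (Y t) * v j) + (\<Sum>j<d. gy j (X t) (Y t) * w j)) (at t))"
  using assms
proof (induction rule: polyfun2.induct)
  case (pconst c)
  show ?case
    by (rule exI[of _ "\<lambda>_ _ _. 0"], rule exI[of _ "\<lambda>_ _ _. 0"]) (auto intro: polyfun2.intros)
next
  case (pprojx i)
  show ?case
  proof (rule exI[of _ "\<lambda>j _ _. if j = i then 1 else 0"], rule exI[of _ "\<lambda>_ _ _. 0"], safe)
    fix X Y :: "real \<Rightarrow> vec" and v w t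
    assume "\<forall>t. X t \<in> Vsp d \<and> Y t \<in> Vsp d" "curve_deriv X v t"
    then show "((\<lambda>t. X t i) has_real_derivative
        (\<Sum>j<d. (if j = i then 1 else 0) * v j) + (\<Sum>j<d. 0 * w j)) (at t)"
      by (cases "i < d") (auto simp: Vsp_def curve_deriv_def if_distrib[of "\<lambda>x. x * _"] cong: if_cong)
  qed (auto intro: polyfun2.intros)
next
  case (pprojy i)
  show ?case
  proof (rule exI[of _ "\<lambda>_ _ _. 0"], rule exI[of _ "\<lambda>j _ _. if j = i then 1 else 0"], safe)
    fix X Y :: "real \<Rightarrow> vec" and v w t
    assume "\<forall>t. X t \<in> Vsp d \<and> Y t \<in> Vsp d" "curve_deriv Y w t"
    then show "((\<lambda>t. Y t i) has_real_derivative
        (\<Sum>j<d. 0 * v j) + (\<Sum>j<d. (if j = i then 1 else 0) * w j)) (at t)"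
      by (cases "i < d") (auto simp: Vsp_def curve_deriv_def if_distrib[of "\<lambda>x. x * _"] cong: if_cong)
  qed (auto intro: polyfun2.intros)
next
  case (padd p q)
  then obtain gx gy hx hy where
    p: "\<forall>j. polyfun2 (gx j) \<and> polyfun2 (gy j)" "\<And>X Y v w t. (\<forall>t. X t \<in> Vsp d \<and> Y t \<in> Vsp d) \<Longrightarrow>
      curve_deriv X v t \<Longrightarrow> curve_deriv Y w t \<Longrightarrow> ((\<lambda>t. p (X t) (Y t)) has_real_derivative
        (\<Sum>j<d. gx j (X t) (Y t) * v j) + (\<Sum>j<d. gy j (X t) (Y t) * w j)) (at t)" and
    q: "\<forall>j. polyfun2 (hx j) \<and> polyfun2 (hy j)" "\<And>X Y v w t. (\<forall>t. X t \<in> Vsp d \<and> Y t \<in> Vsp d) \<Longrightarrow>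
      curve_deriv X v t \<Longrightarrow> curve_deriv Y w t \<Longrightarrow> ((\<lambda>t. q (X t) (Y t)) has_real_derivative
        (\<Sum>j<d. hx j (X t) (Y t) * v j) + (\<Sum>j<d. hy j (X t) (Y t) * w j)) (at t)"
    by blast
  show ?case
  proof (rule exI[of _ "\<lambda>j x y. gx j x y + hx j x y"], rule exI[of _ "\<lambda>j x y. gy j x y + hy j x y"],
      intro conjI allI impI)
    fix X Y v w t assume *: "\<forall>t. X t \<in> Vsp d \<and> Y t \<in> Vsp d" "curve_deriv X v t" "curve_deriv Y w t"
    show "((\<lambda>t. p (X t) (Y t) + q (X t) (Y t)) has_real_derivative
        (\<Sum>j<d. (gx j (X t) (Y t) + hx j (X t) (Y t)) * v j)
        + (\<Sum>j<d. (gy j (X t) (Y t) + hy j (X t) (Y t)) * w j)) (at t)"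
      by (rule DERIV_cong[OF DERIV_add[OF p(2)[OF *] q(2)[OF *]]]) (simp add: ring_distribs sum.distrib)
  qed (use p(1) q(1) in \<open>simp_all add: polyfun2.padd\<close>)
next
  case (pmult p q)
  then obtain gx gy hx hy where
    p: "\<forall>j. polyfun2 (gx j) \<and> polyfun2 (gy j)" "\<And>X Y v w t. (\<forall>t. X t \<in> Vsp d \<and> Y t \<in> Vsp d) \<Longrightarrow>
      curve_deriv X v t \<Longrightarrow> curve_deriv Y w t \<Longrightarrow> ((\<lambda>t. p (X t) (Y t)) has_real_derivative
        (\<Sum>j<d. gx j (X t) (Y t) * v j) + (\<Sum>j<d. gy j (X t) (Y t) * w j)) (at t)" and
    q: "\<forall>j. polyfun2 (hx j) \<and> polyfun2 (hy j)" "\<And>X Y v w t. (\<forall>t. X t \<in> Vsp d \<and> Y t \<in> Vsp d) \<Longrightarrow>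
      curve_deriv X v t \<Longrightarrow> curve_deriv Y w t \<Longrightarrow> ((\<lambda>t. q (X t) (Y t)) has_real_derivative
        (\<Sum>j<d. hx j (X t) (Y t) * v j) + (\<Sum>j<d. hy j (X t) (Y t) * w j)) (at t)"
    by blast
  show ?case
  proof (rule exI[of _ "\<lambda>j x y. gx j x y * q x y + p x y * hx j x y"],
      rule exI[of _ "\<lambda>j x y. gy j x y * q x y + p x y * hy j x y"], intro conjI allI impI)
    fix X Y v w t assume *: "\<forall>t. X t \<in> Vsp d \<and> Y t \<in> Vsp d" "curve_deriv X v t" "curve_deriv Y w t"
    show "((\<lambda>t. p (X t) (Y t) * q (X t) (Y t)) has_real_derivative
        (\<Sum>j<d. (gx j (X t) (Y t) * q (X t) (Y t) + p (X t) (Y t) * hx j (X t) (Y t)) * v j)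
        + (\<Sum>j<d. (gy j (X t) (Y t) * q (X t) (Y t) + p (X t) (Y t) * hy j (X t) (Y t)) * w j)) (at t)"
      by (rule DERIV_cong[OF DERIV_mult[OF p(2)[OF *] q(2)[OF *]]])
         (simp add: ring_distribs sum.distrib sum_distrib_left sum_distrib_right mult_ac)
  qed (use p(1) q(1) pmult.hyps in \<open>simp_all add: polyfun2.padd polyfun2.pmult\<close>)
qed

lemma polyfun2_continuous:
  assumes "polyfun2 p" and f: "continuous_on S f" and g: "continuous_on S g"
  shows "continuous_on S (\<lambda>t. p (f t) (g t))"
  using assms(1)
proof (induction rule: polyfun2.induct)
  case (padd p q)
  then show ?case by (intro continuous_on_add)
next
  case (pmult p q)
  then show ?case by (intro continuous_on_mult)
qed (simp_all add: continuous_on_product_then_coordinatewise[OF f]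
      continuous_on_product_then_coordinatewise[OF g])

lemma tendsto_coordinatewise:
  fixes f :: "'a \<Rightarrow> vec"
  assumes "\<And>l. ((\<lambda>n. f n l) \<longlongrightarrow> x l) F"
  shows "(f \<longlongrightarrow> x) F"
proof -
  have "limitin (product_topology (\<lambda>_. euclidean) UNIV) f x F"
    using assms by (simp add: limitin_componentwise)
  then show ?thesis by (simp add: euclidean_product_topology)
qed

lemma closed_Vsp: "closed (Vsp d)"
proof -
  have "Vsp d = (\<Inter>i\<in>{d..}. {x. x i = 0})" by (auto simp: Vsp_def)
  then show ?thesis by (simp add: closed_INT closed_Collect_eq)
qed

lemma continuous_on_ldist:
  "continuous_on S f \<Longrightarrow> continuous_on S g \<Longrightarrow> continuous_on S (\<lambda>t. ldist d (f t) (g t))"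
  unfolding ldist_def
  by (intro continuous_on_sum continuous_on_rabs continuous_on_diff)
     (simp_all add: continuous_on_product_then_coordinatewise)

text \<open>Bolzano-Weierstrass, refining the subsequence for one coordinate at a time.\<close>

lemma bounded_coords_convergent_subseq:
  fixes y :: "nat \<Rightarrow> nat \<Rightarrow> real"
  assumes "\<And>n l. \<bar>y n l\<bar> \<le> B"
  shows "\<exists>r v. strict_mono r \<and> (\<forall>l<d. (\<lambda>n. y (r n) l) \<longlonglongrightarrow> v l)"
proof (induction d)
  case 0
  show ?case by (rule exI[of _ id]) (auto simp: strict_mono_def)
next
  case (Suc d)
  then obtain r v where r: "strict_mono r" "\<And>l. l < d \<Longrightarrow> (\<lambda>n. y (r n) l) \<longlonglongrightarrow> v l" by blast
  have "bounded (range (\<lambda>n. y (r n) d))"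
    using assms by (auto simp: bounded_iff)
  then obtain c s where s: "strict_mono s" "((\<lambda>n. y (r n) d) \<circ> s) \<longlonglongrightarrow> c"
    using bounded_imp_convergent_subsequence by blast
  show ?case
  proof (intro exI conjI allI impI)
    show "strict_mono (r \<circ> s)" using r(1) s(1) by (rule strict_mono_o)
    fix l assume l: "l < Suc d"
    show "(\<lambda>n. y ((r \<circ> s) n) l) \<longlonglongrightarrow> (v(d := c)) l"
    proof (cases "l = d")
      case True
      then show ?thesis using s(2) by (simp add: o_def)
    next
      case False
      then have "(\<lambda>n. y (r n) l) \<longlonglongrightarrow> v l" using r(2) l by simp
      from LIMSEQ_subseq_LIMSEQ[OF this s(1)] False show ?thesis by (simp add: o_def)
    qed
  qed
qed

section \<open>Groups with polynomial multiplication\<close>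

text \<open>Only the group law and its coordinates; nilpotency is assumed separately by the lemmas
  that use it. \<open>lie_alg_all\<close> provides a one-parameter group in every direction and thus
  does the work of an exponential map.\<close>

locale malcev_group =
  fixes d :: nat and mul :: "vec \<Rightarrow> vec \<Rightarrow> vec"
  assumes group: "group (nilgrp d mul)"
    and poly: "\<exists>p. polyfun2 p \<and> (\<forall>x\<in>Vsp d. \<forall>y\<in>Vsp d. mul x y l = p x y)"
    and one_param_sc: "i < d \<Longrightarrow> one_param (nilgrp d mul) (\<lambda>t. sc t i)"
    and second_kind: "x \<in> Vsp d \<Longrightarrow> x = foldl mul (\<lambda>_. 0) (map (\<lambda>i. sc (x i) i) [0..<d])"
    and lie_alg_all: "lie_alg (nilgrp d mul) (Vsp d) = Vsp d"
begin

abbreviation G where "G \<equiv> nilgrp d mul"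
abbreviation iv where "iv x \<equiv> inv\<^bsub>nilgrp d mul\<^esub> x"

sublocale G: group "nilgrp d mul" by (rule group)

lemma carrier_G[simp]: "carrier G = Vsp d" and mult_G[simp]: "monoid.mult G = mul"
  and one_G[simp]: "one G = (\<lambda>_. 0)"
  by (simp_all add: nilgrp_def)

lemma mul_closed[simp]: "x \<in> Vsp d \<Longrightarrow> y \<in> Vsp d \<Longrightarrow> mul x y \<in> Vsp d"
  using G.m_closed by simp

lemma iv_closed[simp]: "x \<in> Vsp d \<Longrightarrow> iv x \<in> Vsp d"
  using G.inv_closed by simp

lemma mul_assoc: "x \<in> Vsp d \<Longrightarrow> y \<in> Vsp d \<Longrightarrow> z \<in> Vsp d \<Longrightarrow> mul (mul x y) z = mul x (mul y z)"
  using G.m_assoc by simp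

lemma mul_zero[simp]: "x \<in> Vsp d \<Longrightarrow> mul x (\<lambda>_. 0) = x" "x \<in> Vsp d \<Longrightarrow> mul (\<lambda>_. 0) x = x"
  using G.r_one G.l_one by simp_all

lemma mul_iv[simp]: "x \<in> Vsp d \<Longrightarrow> mul x (iv x) = (\<lambda>_. 0)" "x \<in> Vsp d \<Longrightarrow> mul (iv x) x = (\<lambda>_. 0)"
  using G.r_inv G.l_inv by simp_all

lemma mul_iv_cancel[simp]:
  "x \<in> Vsp d \<Longrightarrow> y \<in> Vsp d \<Longrightarrow> mul x (mul (iv x) y) = y"
  "x \<in> Vsp d \<Longrightarrow> y \<in> Vsp d \<Longrightarrow> mul (iv x) (mul x y) = y"
  by (simp_all flip: mul_assoc)

lemma iv_iv[simp]: "x \<in> Vsp d \<Longrightarrow> iv (iv x) = x"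
  using G.inv_inv by simp

lemma iv_mul: "x \<in> Vsp d \<Longrightarrow> y \<in> Vsp d \<Longrightarrow> iv (mul x y) = mul (iv y) (iv x)"
  using G.inv_mult_group by simp

section \<open>One-parameter groups and products of the second kind\<close>

lemma one_paramD:
  assumes "one_param G \<phi>"
  shows "\<phi> t \<in> Vsp d" "\<phi> (s + t) = mul (\<phi> s) (\<phi> t)" "\<phi> 0 = (\<lambda>_. 0)" "\<phi> (- t) = iv (\<phi> t)"
    "continuous_on UNIV \<phi>"
proof -
  have V: "\<phi> t \<in> Vsp d" and add: "\<phi> (s + t) = mul (\<phi> s) (\<phi> t)" for s t
    using assms by (auto simp: one_param_def)
  show "\<phi> t \<in> Vsp d" "\<phi> (s + t) = mul (\<phi> s) (\<phi> t)" by (fact V add)+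
  have "mul (iv (\<phi> 0)) (\<phi> (0 + 0)) = \<phi> 0" unfolding add using V[of 0] by simp
  then show 0: "\<phi> 0 = (\<lambda>_. 0)" using V[of 0] by simp
  have "mul (iv (\<phi> t)) (\<phi> (t + - t)) = \<phi> (- t)" unfolding add using V by simp
  then show "\<phi> (- t) = iv (\<phi> t)" using V[of t] by (simp add: 0)
  show "continuous_on UNIV \<phi>" using assms by (simp add: one_param_def)
qed

lemma sc_add: "i < d \<Longrightarrow> sc (s + t) i = mul (sc s i) (sc t i)"
  using one_paramD(2)[OF one_param_sc] .

lemma iv_sc: "i < d \<Longrightarrow> iv (sc t i) = sc (- t) i"
  using one_paramD(4)[OF one_param_sc] by metis

lemma continuous_on_mul:
  assumes f: "continuous_on S f" "\<And>t. t \<in> S \<Longrightarrow> f t \<in> Vsp d"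
    and g: "continuous_on S g" "\<And>t. t \<in> S \<Longrightarrow> g t \<in> Vsp d"
  shows "continuous_on S (\<lambda>t. mul (f t) (g t))"
proof (rule continuous_on_coordinatewise_then_product)
  fix l
  obtain p where p: "polyfun2 p" "\<And>x y. x \<in> Vsp d \<Longrightarrow> y \<in> Vsp d \<Longrightarrow> mul x y l = p x y"
    using poly[of l] by blast
  have "continuous_on S (\<lambda>t. p (f t) (g t))"
    by (rule polyfun2_continuous[OF p(1) f(1) g(1)])
  then show "continuous_on S (\<lambda>t. mul (f t) (g t) l)"
    by (rule continuous_on_cong[THEN iffD1, rotated -1]) (simp_all add: p f g)
qed

text \<open>Arbitrary index lists allow the second-kind factorisation of an element to be cut at any
  position.\<close>

definition prodsc :: "vec \<Rightarrow> nat list \<Rightarrow> vec" where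
  "prodsc x ks = foldl mul (\<lambda>_. 0) (map (\<lambda>i. sc (x i) i) ks)"

lemma prodsc_Nil[simp]: "prodsc x [] = (\<lambda>_. 0)"
  by (simp add: prodsc_def)

lemma prodsc_snoc[simp]: "prodsc x (ks @ [k]) = mul (prodsc x ks) (sc (x k) k)"
  by (simp add: prodsc_def)

lemma prodsc_closed: "set ks \<subseteq> {..<d} \<Longrightarrow> prodsc x ks \<in> Vsp d"
  by (induction ks rule: rev_induct) auto

lemma prodsc_append:
  "set ks \<subseteq> {..<d} \<Longrightarrow> set ms \<subseteq> {..<d} \<Longrightarrow> prodsc x (ks @ ms) = mul (prodsc x ks) (prodsc x ms)"
proof (induction ms rule: rev_induct)
  case Nil
  then show ?case by (simp add: prodsc_closed)
next
  case (snoc m ms)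
  have "prodsc x (ks @ ms @ [m]) = mul (prodsc x (ks @ ms)) (sc (x m) m)"
    using prodsc_snoc[of x "ks @ ms" m] by simp
  then show ?case using snoc by (simp add: mul_assoc prodsc_closed)
qed

lemma prodsc_cong: "(\<And>k. k \<in> set ks \<Longrightarrow> x k = y k) \<Longrightarrow> prodsc x ks = prodsc y ks"
  unfolding prodsc_def by (metis (mono_tags, lifting) map_cong)

lemma prodsc_all: "x \<in> Vsp d \<Longrightarrow> prodsc x [0..<d] = x"
  unfolding prodsc_def using second_kind by metis

lemma second_kind_induct:
  assumes "x \<in> Vsp d" "P (\<lambda>_. 0)" "\<And>i t. i < d \<Longrightarrow> P (sc t i)"
    and "\<And>x y. x \<in> Vsp d \<Longrightarrow> y \<in> Vsp d \<Longrightarrow> P x \<Longrightarrow> P y \<Longrightarrow> P (mul x y)"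
  shows "P x"
proof -
  have "P (prodsc x ks)" if "set ks \<subseteq> {..<d}" for ks
    using that by (induction ks rule: rev_induct) (auto intro!: assms prodsc_closed)
  then show ?thesis using prodsc_all[OF assms(1)] by (metis atLeast_upt order_refl)
qed

text \<open>Inversion is not assumed polynomial. By second-kind coordinates the inverse is the
  product, in reverse order, of the continuous factors exp(-x_i X_i).\<close>

lemma continuous_on_iv:
  assumes f: "continuous_on S f" "\<And>t. t \<in> S \<Longrightarrow> f t \<in> Vsp d"
  shows "continuous_on S (\<lambda>t. iv (f t))"
proof -
  have sc: "continuous_on S (\<lambda>t. sc (- f t k) k)" for k
  proof (rule continuous_on_coordinatewise_then_product)
    fix l show "continuous_on S (\<lambda>t. sc (- f t k) k l)"
      by (cases "l = k")
         (simp_all add: sc_def continuous_on_minus continuous_on_product_then_coordinatewise[OF f(1)])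
  qed
  have "continuous_on S (\<lambda>t. iv (prodsc (f t) ks))" if "set ks \<subseteq> {..<d}" for ks
    using that
  proof (induction ks rule: rev_induct)
    case Nil
    then show ?case by simp
  next
    case (snoc k ks)
    then have "continuous_on S (\<lambda>t. mul (sc (- f t k) k) (iv (prodsc (f t) ks)))"
      by (intro continuous_on_mul sc) (auto simp: prodsc_closed)
    then show ?case using snoc.prems by (simp add: iv_mul iv_sc prodsc_closed)
  qed
  from this[of "[0..<d]"] show ?thesis
    by (rule continuous_on_cong[THEN iffD1, rotated -1]) (auto simp: prodsc_all f(2))
qed

lemma continuous_on_iter_comm:
  assumes "1 \<le> s" "\<And>i. i < s \<Longrightarrow> continuous_on S (\<lambda>t. W t i)" "\<And>i t. i < s \<Longrightarrow> t \<in> S \<Longrightarrow> W t i \<in> Vsp d"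
  shows "continuous_on S (\<lambda>t. iter_comm G s (W t)) \<and> (\<forall>t\<in>S. iter_comm G s (W t) \<in> Vsp d)"
  using assms
proof (induction s rule: nat_induct_at_least)
  case base
  then show ?case by (simp add: iter_comm_def)
next
  case (Suc s)
  then have *: "continuous_on S (\<lambda>t. iter_comm G s (W t))" "\<And>t. t \<in> S \<Longrightarrow> iter_comm G s (W t) \<in> Vsp d"
    "continuous_on S (\<lambda>t. W t s)" "\<And>t. t \<in> S \<Longrightarrow> W t s \<in> Vsp d" by auto
  have "iter_comm G (Suc s) (W t) = mul (mul (mul (iv (iter_comm G s (W t))) (iv (W t s)))
      (iter_comm G s (W t))) (W t s)" for t
    using Suc.hyps by (simp add: iter_comm_def gcomm_def)
  then show ?case using * by (simp add: continuous_on_mul continuous_on_iv)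
qed

text \<open>The last two bounds use the mixed difference with y' = 0, and the last also x' = 0,
  where multiplication is trivial. There \<open>ldist d x (\<lambda>l. - y l)\<close> is the norm of
  x + y, so the group product is the vector sum up to C |x| |y|.\<close>

lemma mul_estimates:
  assumes "0 \<le> R"
  shows "\<exists>C\<ge>0. \<forall>x\<in>Vsp d. \<forall>x'\<in>Vsp d. \<forall>y\<in>Vsp d. \<forall>y'\<in>Vsp d.
    lnorm d x \<le> R \<longrightarrow> lnorm d x' \<le> R \<longrightarrow> lnorm d y \<le> R \<longrightarrow> lnorm d y' \<le> R \<longrightarrow>
      ldist d (mul x y) (mul x y') \<le> C * ldist d y y'
      \<and> ldist d (mul x y) (mul x' y) \<le> (1 + C * lnorm d y) * ldist d x x'
      \<and> lnorm d (mul x y) \<le> ldist d x (\<lambda>l. - y l) + C * lnorm d x * lnorm d y"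
proof -
  have "\<exists>c\<ge>0. lipschitz2 d R c (\<lambda>x y. mul x y l)" for l
  proof -
    obtain p where p: "polyfun2 p" "\<And>x y. x \<in> Vsp d \<Longrightarrow> y \<in> Vsp d \<Longrightarrow> mul x y l = p x y"
      using poly[of l] by blast
    obtain c where "c \<ge> 0" "lipschitz2 d R c p" using polyfun2_estimates[OF p(1)] by blast
    then show ?thesis using p(2) by (intro exI[of _ c]) (simp add: lipschitz2_def)
  qed
  then obtain c where c: "\<And>l. 0 \<le> c l" "\<And>l. lipschitz2 d R (c l) (\<lambda>x y. mul x y l)" by metis
  define C where "C = (\<Sum>l<d. c l)"
  have "0 \<le> C" by (simp add: C_def c sum_nonneg)
  moreover have "ldist d (mul x y) (mul x y') \<le> C * ldist d y y'
      \<and> ldist d (mul x y) (mul x' y) \<le> (1 + C * lnorm d y) * ldist d x x'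
      \<and> lnorm d (mul x y) \<le> ldist d x (\<lambda>l. - y l) + C * lnorm d x * lnorm d y"
    if *: "x \<in> Vsp d" "x' \<in> Vsp d" "y \<in> Vsp d" "y' \<in> Vsp d"
      "lnorm d x \<le> R" "lnorm d x' \<le> R" "lnorm d y \<le> R" "lnorm d y' \<le> R" for x x' y y'
  proof (intro conjI)
    have z: "lnorm d (\<lambda>_. 0) \<le> R" using assms by (simp add: ldist_def)
    have "ldist d (mul x y) (mul x y') \<le> (\<Sum>l<d. c l * ldist d y y')"
      unfolding ldist_def[of d "mul x y"] using lipschitz2D[OF c(2) *] by (intro sum_mono) blast
    then show "ldist d (mul x y) (mul x y') \<le> C * ldist d y y'"
      by (simp add: C_def sum_distrib_right)
    have "\<bar>mul x y l - mul x' y l\<bar> \<le> \<bar>x l - x' l\<bar> + c l * ldist d x x' * lnorm d y" for l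
      using lipschitz2D[OF c(2) *(1,2,3) zero_in_Vsp *(5,6,7) z, of l] *(1,2) by simp linarith
    then have "ldist d (mul x y) (mul x' y) \<le> (\<Sum>l<d. \<bar>x l - x' l\<bar> + c l * ldist d x x' * lnorm d y)"
      unfolding ldist_def[of d "mul x y"] by (intro sum_mono)
    also have "\<dots> = ldist d x x' + C * ldist d x x' * lnorm d y"
      by (simp add: sum.distrib C_def sum_distrib_right ldist_def[of d x x'])
    finally show "ldist d (mul x y) (mul x' y) \<le> (1 + C * lnorm d y) * ldist d x x'"
      by (simp add: algebra_simps)
    have "\<bar>mul x y l - 0\<bar> \<le> \<bar>x l - - y l\<bar> + c l * lnorm d x * lnorm d y" for l
      using lipschitz2D[OF c(2) *(1) zero_in_Vsp *(3) zero_in_Vsp *(5) z *(7) z, of l] *(1,3) by simp linarith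
    then have "lnorm d (mul x y) \<le> (\<Sum>l<d. \<bar>x l - - y l\<bar> + c l * lnorm d x * lnorm d y)"
      unfolding ldist_def[of d "mul x y"] by (intro sum_mono)
    also have "\<dots> = ldist d x (\<lambda>l. - y l) + C * lnorm d x * lnorm d y"
      by (simp add: sum.distrib C_def sum_distrib_right ldist_def[of d x "\<lambda>l. - y l"])
    finally show "lnorm d (mul x y) \<le> ldist d x (\<lambda>l. - y l) + C * lnorm d x * lnorm d y" .
  qed
  ultimately show ?thesis by (intro exI[of _ C]) blast
qed

text \<open>The powers of \<open>y\<close> follow the one-parameter group through \<open>v\<close>: a discrete Gronwall estimate.\<close>

lemma power_near_one_param:
  assumes \<phi>: "one_param G \<phi>" and t: "0 \<le> t"
  shows "\<exists>C\<ge>0. \<forall>A \<epsilon> y. 0 < \<epsilon> \<longrightarrow> 0 \<le> A \<longrightarrow> y \<in> Vsp d \<longrightarrow> lnorm d y \<le> 1 \<longrightarrow> lnorm d y \<le> A * \<epsilon> \<longrightarrow>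
      (t / \<epsilon>) * C * ldist d y (\<phi> \<epsilon>) * exp (C * A * t) \<le> 1 \<longrightarrow>
      (\<forall>k. real k * \<epsilon> \<le> t \<longrightarrow>
        ldist d (y [^]\<^bsub>G\<^esub> k) (\<phi> (real k * \<epsilon>)) \<le> (t / \<epsilon>) * C * ldist d y (\<phi> \<epsilon>) * exp (C * A * t))"
proof -
  note V = one_paramD(1)[OF \<phi>]
  have "continuous_on {0..t} (\<lambda>s. lnorm d (\<phi> s))"
    using one_paramD(5)[OF \<phi>] by (intro continuous_on_ldist) (auto intro: continuous_on_subset)
  then have "bounded ((\<lambda>s. lnorm d (\<phi> s)) ` {0..t})"
    by (intro compact_imp_bounded compact_continuous_image) auto
  then obtain B where B: "\<And>s. 0 \<le> s \<Longrightarrow> s \<le> t \<Longrightarrow> lnorm d (\<phi> s) \<le> B"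
    unfolding bounded_iff by (metis abs_le_D1 atLeastAtMost_iff imageI real_norm_def)
  \<comment> \<open>\<open>B\<close> bounds \<phi> on [0, t]; the extra 1 leaves room for the powers
    of \<open>y\<close>, whose distance from \<phi> the smallness hypothesis keeps at most
    1.\<close>
  define R where "R = max B 0 + 1"
  have "0 \<le> R" by (simp add: R_def)
  from mul_estimates[OF this] obtain C where C: "0 \<le> C"
    "\<And>x y y'. x \<in> Vsp d \<Longrightarrow> y \<in> Vsp d \<Longrightarrow> y' \<in> Vsp d \<Longrightarrow> lnorm d x \<le> R \<Longrightarrow> lnorm d y \<le> R \<Longrightarrow>
      lnorm d y' \<le> R \<Longrightarrow> ldist d (mul x y) (mul x y') \<le> C * ldist d y y'"
    "\<And>x x' y. x \<in> Vsp d \<Longrightarrow> x' \<in> Vsp d \<Longrightarrow> y \<in> Vsp d \<Longrightarrow> lnorm d x \<le> R \<Longrightarrow> lnorm d x' \<le> R \<Longrightarrow>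
      lnorm d y \<le> R \<Longrightarrow> ldist d (mul x y) (mul x' y) \<le> (1 + C * lnorm d y) * ldist d x x'"
    by blast
  show ?thesis
  proof (intro exI[of _ C] conjI allI impI)
    fix A \<epsilon> :: real and y k
    assume \<epsilon>: "0 < \<epsilon>" and A: "0 \<le> A" and y: "y \<in> Vsp d" "lnorm d y \<le> 1" "lnorm d y \<le> A * \<epsilon>"
      and small: "(t / \<epsilon>) * C * ldist d y (\<phi> \<epsilon>) * exp (C * A * t) \<le> 1"
      and k: "real k * \<epsilon> \<le> t"
    define \<delta> where "\<delta> = ldist d y (\<phi> \<epsilon>)"
    \<comment> \<open>Each multiplication by \<open>y\<close> enlarges the error by at most the
      factor \<open>q\<close> and adds at most C \<delta>; over m steps with m \<epsilon> \<le> t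
      the factors accumulate to at most exp(C A t).\<close>
    define q where "q = 1 + C * (A * \<epsilon>)"
    have q: "1 \<le> q" using C(1) A \<epsilon> by (simp add: q_def)
    have \<delta>: "0 \<le> \<delta>" by (simp add: \<delta>_def)
    have pw: "y [^]\<^bsub>G\<^esub> m \<in> Vsp d" for m :: nat using G.nat_pow_closed[of y m] y by simp
    have le: "real m * (C * \<delta>) * q ^ m \<le> (t / \<epsilon>) * C * \<delta> * exp (C * A * t)" if "real m * \<epsilon> \<le> t" for m
    proof -
      have "q ^ m \<le> exp (C * (A * \<epsilon>)) ^ m"
        unfolding q_def using C(1) A \<epsilon> by (intro power_mono exp_ge_add_one_self) auto
      also have "\<dots> = exp (C * A * (real m * \<epsilon>))"
        by (simp add: exp_of_nat_mult[symmetric] mult_ac)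
      also have "\<dots> \<le> exp (C * A * t)" using that C(1) A by (auto intro!: mult_left_mono)
      finally have 1: "q ^ m \<le> exp (C * A * t)" .
      have "real m \<le> t / \<epsilon>" using that \<epsilon> by (simp add: field_simps)
      then have "real m * (C * \<delta>) \<le> (t / \<epsilon>) * (C * \<delta>)" using C(1) \<delta> by (intro mult_right_mono) auto
      then have "real m * (C * \<delta>) * q ^ m \<le> (t / \<epsilon>) * (C * \<delta>) * exp (C * A * t)"
        using q C(1) \<delta> t \<epsilon> by (intro mult_mono[OF _ 1]) auto
      then show ?thesis by (simp add: mult_ac)
    qed
    have "ldist d (y [^]\<^bsub>G\<^esub> m) (\<phi> (real m * \<epsilon>)) \<le> real m * (C * \<delta>) * q ^ m" if "real m * \<epsilon> \<le> t" for m
      using that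
    proof (induction m)
      case 0
      then show ?case by (simp add: one_paramD(3)[OF \<phi>] ldist_def)
    next
      case (Suc m)
      have "real (Suc m) * \<epsilon> = real m * \<epsilon> + \<epsilon>" "0 \<le> real m * \<epsilon>" using \<epsilon> by (simp_all add: algebra_simps)
      then have m: "real m * \<epsilon> \<le> t" and e: "\<epsilon> \<le> t" using Suc.prems \<epsilon> by linarith+
      define x x' where "x = y [^]\<^bsub>G\<^esub> m" and "x' = \<phi> (real m * \<epsilon>)"
      have xV: "x \<in> Vsp d" "x' \<in> Vsp d" using pw V by (auto simp: x_def x'_def)
      have IH: "ldist d x x' \<le> real m * (C * \<delta>) * q ^ m" using Suc.IH[OF m] by (simp add: x_def x'_def)
      have x'R: "lnorm d x' \<le> max B 0" unfolding x'_def using B[of "real m * \<epsilon>"] m \<epsilon> by auto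
      have "ldist d x x' \<le> 1" using IH le[OF m] small by (simp add: \<delta>_def)
      then have xR: "lnorm d x \<le> R" using x'R ldist_triangle[of d x "\<lambda>_. 0" x'] by (simp add: R_def)
      have yR: "lnorm d y \<le> R" "lnorm d (\<phi> \<epsilon>) \<le> R" using y(2) B[of \<epsilon>] e \<epsilon> by (auto simp: R_def)
      have "ldist d (mul x y) (mul x' (\<phi> \<epsilon>)) \<le> ldist d (mul x y) (mul x' y) + ldist d (mul x' y) (mul x' (\<phi> \<epsilon>))"
        by (rule ldist_triangle)
      also have "\<dots> \<le> (1 + C * lnorm d y) * ldist d x x' + C * \<delta>"
        unfolding \<delta>_def using xV xR x'R yR y(1) V by (intro add_mono C) (auto simp: R_def)
      also have "\<dots> \<le> q * (real m * (C * \<delta>) * q ^ m) + C * \<delta> * q ^ Suc m"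
      proof (rule add_mono[OF mult_mono[OF _ IH]])
        show "1 + C * lnorm d y \<le> q" unfolding q_def using C(1) y(3) by (auto intro: mult_left_mono)
        show "C * \<delta> \<le> C * \<delta> * q ^ Suc m"
          using mult_left_mono[OF one_le_power[OF q, of "Suc m"], of "C * \<delta>"] C(1) \<delta> by simp
      qed (use q in auto)
      also have "\<dots> = real (Suc m) * (C * \<delta>) * q ^ Suc m" by (simp add: algebra_simps)
      finally have "ldist d (mul x y) (mul x' (\<phi> \<epsilon>)) \<le> real (Suc m) * (C * \<delta>) * q ^ Suc m" .
      moreover have "\<phi> (real (Suc m) * \<epsilon>) = mul x' (\<phi> \<epsilon>)"
        using one_paramD(2)[OF \<phi>, of "real m * \<epsilon>" \<epsilon>] by (simp add: x'_def algebra_simps)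
      moreover have "y [^]\<^bsub>G\<^esub> Suc m = mul x y" by (simp add: x_def)
      ultimately show ?case by simp
    qed
    from this[OF k] le[OF k]
    show "ldist d (y [^]\<^bsub>G\<^esub> k) (\<phi> (real k * \<epsilon>)) \<le> (t / \<epsilon>) * C * ldist d y (\<phi> \<epsilon>) * exp (C * A * t)"
      by (simp add: \<delta>_def)
  qed (rule C(1))
qed

section \<open>Closed subgroups and their Lie algebras\<close>

lemma lie_algD:
  assumes "v \<in> lie_alg G H"
  obtains \<phi> where "one_param G \<phi>" "range \<phi> \<subseteq> H" "curve_deriv \<phi> v 0"
  using assms unfolding lie_alg_def curve_deriv_def by blast

lemma lie_algI: "one_param G \<phi> \<Longrightarrow> range \<phi> \<subseteq> H \<Longrightarrow> curve_deriv \<phi> v 0 \<Longrightarrow> v \<in> lie_alg G H"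
  unfolding lie_alg_def curve_deriv_def by blast

lemma curve_deriv_seq:
  assumes "curve_deriv X v 0" "X 0 = (\<lambda>_. 0)" "\<epsilon> \<longlonglongrightarrow> 0" "\<And>n. \<epsilon> n \<noteq> (0::real)"
  shows "(\<lambda>n. X (\<epsilon> n) l / \<epsilon> n) \<longlonglongrightarrow> v l"
proof -
  have "(\<lambda>h. X h l / h) \<midarrow>0\<rightarrow> v l"
    using assms(1,2) unfolding curve_deriv_def DERIV_def by simp
  moreover have "filterlim \<epsilon> (at 0) sequentially"
    using assms(3,4) by (simp add: filterlim_at)
  ultimately show ?thesis by (rule filterlim_compose)
qed

text \<open>Let \<phi> be the one-parameter group with velocity \<open>v\<close>. For t \<ge> 0 the
  powers of \<open>y n\<close> with exponent floor(t / \<epsilon> n) stay in \<open>H\<close> and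
  converge to \<phi> t, which is therefore in \<open>H\<close>; negative times follow by
  inversion.\<close>

lemma lie_alg_sequentialI:
  assumes H: "subgroup H G" "closed H" and y: "\<And>n. y n \<in> H"
    and \<epsilon>: "\<And>n. 0 < \<epsilon> n" "\<epsilon> \<longlonglongrightarrow> 0"
    and lim: "\<And>l. l < d \<Longrightarrow> (\<lambda>n. y n l / \<epsilon> n) \<longlonglongrightarrow> v l" and v: "v \<in> Vsp d"
  shows "v \<in> lie_alg G H"
proof -
  have HV: "H \<subseteq> Vsp d" using subgroup.subset[OF H(1)] by simp
  obtain \<phi> where \<phi>: "one_param G \<phi>" "curve_deriv \<phi> v 0"
    using v lie_alg_all by (metis lie_algD)
  note V = one_paramD(1)[OF \<phi>(1)]
  have pos: "\<phi> t \<in> H" if t: "0 \<le> t" for t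
  proof -
    obtain C where C: "0 \<le> C" "\<And>A \<epsilon> y k. 0 < \<epsilon> \<Longrightarrow> 0 \<le> A \<Longrightarrow> y \<in> Vsp d \<Longrightarrow> lnorm d y \<le> 1 \<Longrightarrow>
      lnorm d y \<le> A * \<epsilon> \<Longrightarrow> (t / \<epsilon>) * C * ldist d y (\<phi> \<epsilon>) * exp (C * A * t) \<le> 1 \<Longrightarrow> real k * \<epsilon> \<le> t \<Longrightarrow>
        ldist d (y [^]\<^bsub>G\<^esub> k) (\<phi> (real k * \<epsilon>)) \<le> (t / \<epsilon>) * C * ldist d y (\<phi> \<epsilon>) * exp (C * A * t)"
      using power_near_one_param[OF \<phi>(1) t] by blast
    define A where "A = lnorm d v + 1"
    have A: "0 \<le> A" by (simp add: A_def add_nonneg_nonneg)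
    define m where "m n = nat \<lfloor>t / \<epsilon> n\<rfloor>" for n
    \<comment> \<open>The error bound of \<open>power_near_one_param\<close>. It tends to 0 because
      \<open>y n\<close> and \<open>\<phi> (\<epsilon> n)\<close> agree to first order, so their
      distance is o(\<epsilon> n).\<close>
    define \<eta> where "\<eta> n = (t / \<epsilon> n) * C * ldist d (y n) (\<phi> (\<epsilon> n)) * exp (C * A * t)" for n
    have q: "(\<lambda>n. lnorm d (y n) / \<epsilon> n) \<longlonglongrightarrow> lnorm d v"
    proof -
      have "(\<lambda>n. \<Sum>l<d. \<bar>y n l / \<epsilon> n\<bar>) \<longlonglongrightarrow> (\<Sum>l<d. \<bar>v l\<bar>)"
        by (intro tendsto_sum tendsto_rabs) (simp add: lim)
      moreover have "lnorm d (y n) / \<epsilon> n = (\<Sum>l<d. \<bar>y n l / \<epsilon> n\<bar>)" for n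
        using \<epsilon>(1)[of n] by (simp add: ldist_def sum_divide_distrib abs_divide)
      ultimately show ?thesis by (simp add: ldist_def)
    qed
    have "(\<lambda>n. lnorm d (y n) / \<epsilon> n * \<epsilon> n) \<longlonglongrightarrow> lnorm d v * 0"
      by (intro tendsto_mult q \<epsilon>)
    then have y0: "(\<lambda>n. lnorm d (y n)) \<longlonglongrightarrow> 0"
      using \<epsilon>(1) by (simp add: less_imp_neq[symmetric])
    have "(\<lambda>n. \<Sum>l<d. \<bar>y n l / \<epsilon> n - \<phi> (\<epsilon> n) l / \<epsilon> n\<bar>) \<longlonglongrightarrow> (\<Sum>l<d. \<bar>v l - v l\<bar>)"
      using \<epsilon>(1) by (intro tendsto_sum tendsto_rabs tendsto_diff lim
          curve_deriv_seq[OF \<phi>(2) one_paramD(3)[OF \<phi>(1)] \<epsilon>(2)]) (auto simp: less_imp_neq[symmetric])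
    moreover have "(\<Sum>l<d. \<bar>y n l / \<epsilon> n - \<phi> (\<epsilon> n) l / \<epsilon> n\<bar>) = ldist d (y n) (\<phi> (\<epsilon> n)) / \<epsilon> n" for n
      using \<epsilon>(1)[of n] by (simp add: ldist_def sum_divide_distrib abs_divide flip: diff_divide_distrib)
    ultimately have "(\<lambda>n. ldist d (y n) (\<phi> (\<epsilon> n)) / \<epsilon> n) \<longlonglongrightarrow> 0" by simp
    then have "(\<lambda>n. ldist d (y n) (\<phi> (\<epsilon> n)) / \<epsilon> n * (t * C * exp (C * A * t))) \<longlonglongrightarrow> 0"
      by (rule tendsto_mult_left_zero)
    moreover have "\<eta> = (\<lambda>n. ldist d (y n) (\<phi> (\<epsilon> n)) / \<epsilon> n * (t * C * exp (C * A * t)))"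
      by (simp add: fun_eq_iff \<eta>_def)
    ultimately have \<eta>0: "\<eta> \<longlonglongrightarrow> 0" by simp
    have me: "real (m n) * \<epsilon> n \<le> t" "t - \<epsilon> n \<le> real (m n) * \<epsilon> n" for n
    proof -
      have "real (m n) = of_int \<lfloor>t / \<epsilon> n\<rfloor>" using t \<epsilon>(1)[of n] by (simp add: m_def)
      then have "real (m n) \<le> t / \<epsilon> n" "t / \<epsilon> n - 1 \<le> real (m n)" by linarith+
      then show "real (m n) * \<epsilon> n \<le> t" "t - \<epsilon> n \<le> real (m n) * \<epsilon> n"
        using \<epsilon>(1)[of n] by (auto simp: field_simps)
    qed
    have mt: "(\<lambda>n. real (m n) * \<epsilon> n) \<longlonglongrightarrow> t"
    proof (rule tendsto_sandwich)
      show "(\<lambda>n. t - \<epsilon> n) \<longlonglongrightarrow> t" using tendsto_diff[OF tendsto_const \<epsilon>(2), of t] by simp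
    qed (use me in auto)
    have "eventually (\<lambda>n. lnorm d (y n) < 1) sequentially" using order_tendstoD(2)[OF y0, of 1] by simp
    moreover have "eventually (\<lambda>n. lnorm d (y n) / \<epsilon> n < A) sequentially"
      using order_tendstoD(2)[OF q, of A] by (simp add: A_def)
    moreover have "eventually (\<lambda>n. \<eta> n < 1) sequentially" using order_tendstoD(2)[OF \<eta>0, of 1] by simp
    ultimately have ev: "eventually (\<lambda>n. ldist d (y n [^]\<^bsub>G\<^esub> m n) (\<phi> (real (m n) * \<epsilon> n)) \<le> \<eta> n) sequentially"
    proof eventually_elim
      case (elim n)
      show ?case unfolding \<eta>_def
        using elim \<epsilon>(1)[of n] y[of n] HV A me(1)[of n]
        by (intro C) (auto simp: \<eta>_def divide_less_eq less_imp_le)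
    qed
    have pwH: "y n [^]\<^bsub>G\<^esub> k \<in> H" for n and k :: nat
      by (induction k) (use subgroup.one_closed[OF H(1)] subgroup.m_closed[OF H(1)] y in \<open>auto\<close>)
    have "(\<lambda>n. y n [^]\<^bsub>G\<^esub> m n) \<longlonglongrightarrow> \<phi> t"
    proof (rule tendsto_coordinatewise)
      fix l
      have "isCont (\<lambda>s. \<phi> s l) t"
        using continuous_on_product_then_coordinatewise[OF one_paramD(5)[OF \<phi>(1)], of l]
        by (simp add: continuous_on_eq_continuous_at)
      then have 1: "(\<lambda>n. \<phi> (real (m n) * \<epsilon> n) l) \<longlonglongrightarrow> \<phi> t l"
        using mt by (rule isCont_tendsto_compose)
      have "(\<lambda>n. (y n [^]\<^bsub>G\<^esub> m n) l - \<phi> (real (m n) * \<epsilon> n) l) \<longlonglongrightarrow> 0"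
      proof (rule Lim_null_comparison[OF _ \<eta>0])
        show "eventually (\<lambda>n. norm ((y n [^]\<^bsub>G\<^esub> m n) l - \<phi> (real (m n) * \<epsilon> n) l) \<le> \<eta> n) sequentially"
          using ev
        proof eventually_elim
          case (elim n)
          have "y n [^]\<^bsub>G\<^esub> m n \<in> Vsp d" using pwH HV by auto
          from coord_le_ldist_Vsp[OF this V] elim show ?case by (metis order_trans real_norm_def)
        qed
      qed
      from tendsto_add[OF this 1] show "(\<lambda>n. (y n [^]\<^bsub>G\<^esub> m n) l) \<longlonglongrightarrow> \<phi> t l" by simp
    qed
    then show ?thesis by (rule closed_sequentially[OF H(2), rotated]) (simp add: pwH)
  qed
  have "\<phi> t \<in> H" for t
  proof (cases "0 \<le> t")
    case False
    then have "iv (\<phi> (- t)) \<in> H" using pos[of "- t"] subgroup.m_inv_closed[OF H(1)] by simp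
    then show ?thesis using one_paramD(4)[OF \<phi>(1), of "- t"] by simp
  qed (rule pos)
  then show ?thesis using \<phi> by (intro lie_algI) auto
qed

text \<open>Curves that are not homomorphisms become admissible, such as products of one-parameter
  groups or commutator curves; their values at 1/(n+1) form the required sequence.\<close>

lemma lie_alg_curveI:
  assumes H: "subgroup H G" "closed H" and X: "\<And>t. X t \<in> H" "X 0 = (\<lambda>_. 0)" "curve_deriv X v 0"
    and v: "v \<in> Vsp d"
  shows "v \<in> lie_alg G H"
proof (rule lie_alg_sequentialI[OF H _ _ _ _ v])
  show e: "(\<lambda>n. inverse (real (Suc n))) \<longlonglongrightarrow> 0" by (rule LIMSEQ_inverse_real_of_nat)
  show "(\<lambda>n. X (inverse (real (Suc n))) l / inverse (real (Suc n))) \<longlonglongrightarrow> v l" for l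
    by (rule curve_deriv_seq[OF X(3,2) e]) simp
qed (auto intro: X)

lemma lie_alg_subset: "lie_alg G H \<subseteq> Vsp d"
proof
  fix v assume "v \<in> lie_alg G H"
  then obtain \<phi> where \<phi>: "one_param G \<phi>" "curve_deriv \<phi> v 0" by (metis lie_algD)
  have "v l = 0" if "d \<le> l" for l
  proof (rule DERIV_unique)
    show "((\<lambda>t. \<phi> t l) has_real_derivative v l) (at 0)" using \<phi>(2) by (simp add: curve_deriv_def)
    have "(\<lambda>t. \<phi> t l) = (\<lambda>_. 0)" using one_paramD(1)[OF \<phi>(1)] that by (auto simp: Vsp_def)
    then show "((\<lambda>t. \<phi> t l) has_real_derivative 0) (at 0)" by simp
  qed
  then show "v \<in> Vsp d" by (simp add: Vsp_def)
qed

text \<open>Outside \<open>K\<close> but close to the identity, almost minimise the norm on a coset of \<open>K\<close>. The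
  directions of the minimisers accumulate at some \<open>v\<close> in the Lie algebra of \<open>H\<close>; translating by the
  one-parameter group of \<open>v\<close>, which lies in \<open>K\<close>, makes the norm much smaller.\<close>

proposition connected_subgroup_subset:
  assumes H: "subgroup H G" "closed H" "connected H" and K: "subgroup K G" "closed K" "K \<subseteq> H"
    and lie: "lie_alg G H \<subseteq> lie_alg G K"
  shows "H \<subseteq> K"
proof (rule ccontr)
  assume neq: "\<not> H \<subseteq> K"
  have HV: "H \<subseteq> Vsp d" using subgroup.subset[OF H(1)] by simp
  have KV: "K \<subseteq> Vsp d" using K(3) HV by blast
  have K1: "(\<lambda>_. 0) \<in> K" using subgroup.one_closed[OF K(1)] by simp
  have Km: "mul x y \<in> K" if "x \<in> K" "y \<in> K" for x y using subgroup.m_closed[OF K(1) that] by simp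
  have Ki: "iv x \<in> K" if "x \<in> K" for x using subgroup.m_inv_closed[OF K(1) that] .
  have Hm: "mul x y \<in> H" if "x \<in> H" "y \<in> H" for x y using subgroup.m_closed[OF H(1) that] by simp
  \<comment> \<open>Otherwise \<open>K\<close> contains a neighbourhood of the identity in
    \<open>H\<close>, hence is open and closed in \<open>H\<close>, and equals \<open>H\<close> by
    connectedness.\<close>
  have near: "\<exists>x\<in>H - K. lnorm d x < \<delta>" if \<delta>: "0 < \<delta>" for \<delta>
  proof (rule ccontr)
    assume "\<not> ?thesis"
    then have small: "x \<in> K" if "x \<in> H" "lnorm d x < \<delta>" for x using that by auto
    have "openin (top_of_set H) K"
    proof (subst openin_subopen, intro ballI)
      fix k assume k: "k \<in> K"
      let ?f = "\<lambda>x. lnorm d (mul (iv k) x)"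
      have "continuous_on H ?f"
        using k KV HV by (intro continuous_on_ldist continuous_on_mul continuous_on_const continuous_on_id) auto
      then have "openin (top_of_set H) (H \<inter> ?f -` {..<\<delta>})"
        by (rule continuous_openin_preimage_gen) simp
      moreover have "k \<in> H \<inter> ?f -` {..<\<delta>}" using k K(3) KV \<delta> by (auto simp: ldist_def)
      moreover have "H \<inter> ?f -` {..<\<delta>} \<subseteq> K"
      proof
        fix x assume x: "x \<in> H \<inter> ?f -` {..<\<delta>}"
        then have "mul (iv k) x \<in> K" using k K(3) Ki Hm by (intro small) auto
        then have "mul k (mul (iv k) x) \<in> K" by (rule Km[OF k])
        then show "x \<in> K" using k x KV HV by (auto simp: subset_iff)
      qed
      ultimately show "\<exists>T. openin (top_of_set H) T \<and> k \<in> T \<and> T \<subseteq> K" by blast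
    qed
    moreover have "closedin (top_of_set H) K" using K(2,3) by (simp add: closed_subset)
    ultimately have "K = {} \<or> K = H" using H(3) unfolding connected_clopen by blast
    then show False using K1 neq by auto
  qed
  have minim: "\<exists>y\<in>H. 0 < lnorm d y \<and> lnorm d y \<le> 2 * lnorm d x
      \<and> (\<forall>k\<in>K. lnorm d y / 2 \<le> lnorm d (mul k y))" if x: "x \<in> H - K" for x
  proof -
    have xV: "x \<in> Vsp d" using x HV by auto
    define A where "A = (\<lambda>k. lnorm d (mul k x)) ` K"
    define \<rho> where "\<rho> = Inf A"
    have ne: "A \<noteq> {}" using K1 by (auto simp: A_def)
    have bdd: "bdd_below A" by (rule bdd_belowI[of _ 0]) (auto simp: A_def)
    have le: "\<rho> \<le> lnorm d (mul k x)" if "k \<in> K" for k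
      unfolding \<rho>_def using that bdd by (intro cInf_lower) (auto simp: A_def)
    \<comment> \<open>Infimum 0 would give k_n x tending to the identity, so k_n tends to x^-1,
      which then lies in the closed \<open>K\<close>. Positivity makes room for an element of norm
      below 2 \<rho>, whether or not the infimum is attained.\<close>
    have "0 < \<rho>"
    proof (rule ccontr)
      assume "\<not> 0 < \<rho>"
      then have "\<exists>a\<in>A. a < inverse (real (Suc n))" for n
        using cInf_lessD[OF ne, of "inverse (real (Suc n))"] unfolding \<rho>_def[symmetric]
        by (metis inverse_positive_iff_positive leI of_nat_0_less_iff order_le_less_trans zero_less_Suc)
      then have "\<exists>k\<in>K. lnorm d (mul k x) < inverse (real (Suc n))" for n by (auto simp: A_def)
      then obtain k where k: "\<And>n. k n \<in> K" "\<And>n. lnorm d (mul (k n) x) < inverse (real (Suc n))" by metis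
      have kV: "k n \<in> Vsp d" for n using k(1) KV by auto
      have "(\<lambda>n. mul (k n) x) \<longlonglongrightarrow> (\<lambda>_. 0)"
      proof (rule tendsto_coordinatewise, rule Lim_null_comparison[OF _ LIMSEQ_inverse_real_of_nat])
        fix l
        show "\<forall>\<^sub>F n in sequentially. norm (mul (k n) x l) \<le> inverse (real (Suc n))"
        proof (intro always_eventually allI)
          fix n
          have "\<bar>mul (k n) x l - 0\<bar> \<le> lnorm d (mul (k n) x)"
            using kV xV by (intro coord_le_ldist_Vsp) auto
          then show "norm (mul (k n) x l) \<le> inverse (real (Suc n))" using k(2)[of n] by simp
        qed
      qed
      then have "(\<lambda>n. mul (mul (k n) x) (iv x)) \<longlonglongrightarrow> mul (\<lambda>_. 0) (iv x)"
        using kV xV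
        by (intro continuous_on_tendsto_compose[of "Vsp d" "\<lambda>u. mul u (iv x)"] continuous_on_mul
              continuous_on_const continuous_on_id) auto
      then have "k \<longlonglongrightarrow> iv x" using kV xV by (simp add: mul_assoc)
      then have "iv x \<in> K" by (rule closed_sequentially[OF K(2), rotated]) (simp add: k(1))
      then have "x \<in> K" using Ki[of "iv x"] xV by simp
      then show False using x by simp
    qed
    then have "\<rho> < 2 * \<rho>" by simp
    then obtain k where k: "k \<in> K" "lnorm d (mul k x) < 2 * \<rho>"
      using cInf_lessD[OF ne, of "2 * \<rho>"] by (auto simp: \<rho>_def A_def)
    have kV: "k \<in> Vsp d" using k KV by auto
    show ?thesis
    proof (intro bexI conjI ballI)
      show "mul k x \<in> H" using k(1) K(3) x Hm by auto
      show "0 < lnorm d (mul k x)" using le[OF k(1)] \<open>0 < \<rho>\<close> by linarith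
      show "lnorm d (mul k x) \<le> 2 * lnorm d x" using k(2) le[OF K1] xV by simp
      fix k' assume k': "k' \<in> K"
      then have "\<rho> \<le> lnorm d (mul k' (mul k x))"
        using le[OF Km[OF k' k(1)]] KV kV xV by (simp add: mul_assoc subset_iff)
      then show "lnorm d (mul k x) / 2 \<le> lnorm d (mul k' (mul k x))" using k(2) by linarith
    qed
  qed
  have "\<exists>y\<in>H. 0 < lnorm d y \<and> lnorm d y \<le> 2 * inverse (real (Suc n))
      \<and> (\<forall>k\<in>K. lnorm d y / 2 \<le> lnorm d (mul k y))" for n
  proof -
    obtain x where x: "x \<in> H - K" "lnorm d x < inverse (real (Suc n))"
      using near[of "inverse (real (Suc n))"] by auto
    from minim[OF x(1)] x(2) show ?thesis by force
  qed
  then obtain y where y: "\<And>n. y n \<in> H" "\<And>n. 0 < lnorm d (y n)"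
      "\<And>n. lnorm d (y n) \<le> 2 * inverse (real (Suc n))"
      "\<And>n k. k \<in> K \<Longrightarrow> lnorm d (y n) / 2 \<le> lnorm d (mul k (y n))"
    by metis
  have yV: "y n \<in> Vsp d" for n using y(1) HV by auto
  have "(\<lambda>n. lnorm d (y n)) \<longlonglongrightarrow> 0"
  proof (rule tendsto_sandwich[of "\<lambda>_. 0"])
    show "(\<lambda>n. 2 * inverse (real (Suc n))) \<longlonglongrightarrow> 0"
      using tendsto_mult_right_zero[OF LIMSEQ_inverse_real_of_nat] by simp
    show "\<forall>\<^sub>F n in sequentially. lnorm d (y n) \<le> 2 * inverse (real (Suc n))"
      by (intro always_eventually allI y(3))
  qed auto
  moreover have "\<bar>y n l / lnorm d (y n)\<bar> \<le> 1" for n l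
    using coord_le_ldist_Vsp[OF yV zero_in_Vsp, of n l] y(2)[of n] by (simp add: abs_divide divide_le_eq)
  then obtain r u where r: "strict_mono r" "\<And>l. l < d \<Longrightarrow> (\<lambda>n. y (r n) l / lnorm d (y (r n))) \<longlonglongrightarrow> u l"
    using bounded_coords_convergent_subseq[of "\<lambda>n l. y n l / lnorm d (y n)" 1 d] by blast
  define z where "z n = y (r n)" for n
  define \<epsilon> where "\<epsilon> n = lnorm d (z n)" for n
  define v where "v l = (if l < d then u l else 0)" for l
  ultimately have \<epsilon>0: "\<epsilon> \<longlonglongrightarrow> 0"
    using r(1) LIMSEQ_subseq_LIMSEQ[of "\<lambda>n. lnorm d (y n)" 0 r] by (simp add: \<epsilon>_def[abs_def] z_def o_def)
  have \<epsilon>: "0 < \<epsilon> n" for n using y(2) by (simp add: \<epsilon>_def z_def)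
  have lim: "(\<lambda>n. z n l / \<epsilon> n) \<longlonglongrightarrow> v l" if "l < d" for l
    using r(2)[OF that] that by (simp add: v_def z_def \<epsilon>_def)
  have vV: "v \<in> Vsp d" by (simp add: v_def Vsp_def)
  have "v \<in> lie_alg G H"
    by (rule lie_alg_sequentialI[OF H(1,2) _ \<epsilon> \<epsilon>0 lim vV]) (simp add: z_def y)
  then have "v \<in> lie_alg G K" using lie by auto
  then obtain \<phi> where \<phi>: "one_param G \<phi>" "range \<phi> \<subseteq> K" "curve_deriv \<phi> v 0" by (rule lie_algD)
  have \<phi>lim: "(\<lambda>n. \<phi> (- \<epsilon> n) l / \<epsilon> n) \<longlonglongrightarrow> - v l" for l
  proof -
    have "(\<lambda>n. \<phi> (- \<epsilon> n) l / - \<epsilon> n) \<longlonglongrightarrow> v l"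
      using tendsto_minus[OF \<epsilon>0] \<epsilon>
      by (intro curve_deriv_seq[OF \<phi>(3) one_paramD(3)[OF \<phi>(1)]]) (auto simp: less_imp_neq[symmetric])
    from tendsto_minus[OF this] show ?thesis by simp
  qed
  obtain C where C: "0 \<le> C" "\<And>x y. x \<in> Vsp d \<Longrightarrow> y \<in> Vsp d \<Longrightarrow> lnorm d x \<le> 1 \<Longrightarrow> lnorm d y \<le> 1 \<Longrightarrow>
      lnorm d (mul x y) \<le> ldist d x (\<lambda>l. - y l) + C * lnorm d x * lnorm d y"
    using mul_estimates[of 1] by (metis zero_le_one)
  have "isCont (\<lambda>s. lnorm d (\<phi> s)) 0"
    using continuous_on_ldist[OF one_paramD(5)[OF \<phi>(1)] continuous_on_const]
    by (simp add: continuous_on_eq_continuous_at)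
  from isCont_tendsto_compose[OF this] tendsto_minus[OF \<epsilon>0]
  have \<phi>0: "(\<lambda>n. lnorm d (\<phi> (- \<epsilon> n))) \<longlonglongrightarrow> 0"
    by (simp add: one_paramD(3)[OF \<phi>(1)] ldist_def)
  \<comment> \<open>This dominates the norm of \<open>mul (\<phi> (- \<epsilon> n)) (z n)\<close>
    divided by \<open>\<epsilon> n\<close>: the first-order parts cancel, and the product error
    retains the factor \<open>lnorm d (\<phi> (- \<epsilon> n))\<close>. Almost minimality keeps
    that quotient at least 1/2.\<close>
  have "(\<lambda>n. (\<Sum>l<d. \<bar>\<phi> (- \<epsilon> n) l / \<epsilon> n + z n l / \<epsilon> n\<bar>) + C * lnorm d (\<phi> (- \<epsilon> n)))
      \<longlonglongrightarrow> (\<Sum>l<d. \<bar>- v l + v l\<bar>) + C * 0"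
    by (intro tendsto_add tendsto_sum tendsto_rabs tendsto_mult tendsto_const \<phi>lim \<phi>0 lim) simp
  then have "(\<lambda>n. (\<Sum>l<d. \<bar>\<phi> (- \<epsilon> n) l / \<epsilon> n + z n l / \<epsilon> n\<bar>) + C * lnorm d (\<phi> (- \<epsilon> n))) \<longlonglongrightarrow> 0" by simp
  then have "\<forall>\<^sub>F n in sequentially. (\<Sum>l<d. \<bar>\<phi> (- \<epsilon> n) l / \<epsilon> n + z n l / \<epsilon> n\<bar>) + C * lnorm d (\<phi> (- \<epsilon> n)) < 1/2"
    by (rule order_tendstoD(2)) simp
  moreover have "\<forall>\<^sub>F n in sequentially. lnorm d (\<phi> (- \<epsilon> n)) < 1" using order_tendstoD(2)[OF \<phi>0, of 1] by simp
  moreover have "\<forall>\<^sub>F n in sequentially. \<epsilon> n < 1" using order_tendstoD(2)[OF \<epsilon>0, of 1] by simp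
  ultimately have "\<forall>\<^sub>F n in sequentially. False"
  proof eventually_elim
    case (elim n)
    have "(\<Sum>l<d. \<bar>\<phi> (- \<epsilon> n) l / \<epsilon> n + z n l / \<epsilon> n\<bar>) = ldist d (\<phi> (- \<epsilon> n)) (\<lambda>l. - z n l) / \<epsilon> n"
      using \<epsilon>[of n] by (simp add: ldist_def sum_divide_distrib abs_divide flip: add_divide_distrib)
    then have "ldist d (\<phi> (- \<epsilon> n)) (\<lambda>l. - z n l) / \<epsilon> n + C * lnorm d (\<phi> (- \<epsilon> n)) < 1/2"
      using elim(1) by simp
    from mult_strict_right_mono[OF this \<epsilon>[of n]] \<epsilon>[of n]
    have "ldist d (\<phi> (- \<epsilon> n)) (\<lambda>l. - z n l) + C * lnorm d (\<phi> (- \<epsilon> n)) * \<epsilon> n < \<epsilon> n / 2"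
      by (simp add: ring_distribs)
    moreover have "lnorm d (mul (\<phi> (- \<epsilon> n)) (z n))
        \<le> ldist d (\<phi> (- \<epsilon> n)) (\<lambda>l. - z n l) + C * lnorm d (\<phi> (- \<epsilon> n)) * \<epsilon> n"
    proof -
      have "z n \<in> Vsp d" by (simp add: z_def yV)
      moreover have "lnorm d (z n) = \<epsilon> n" by (simp add: \<epsilon>_def)
      ultimately show ?thesis using elim one_paramD(1)[OF \<phi>(1)] C(2)[of "\<phi> (- \<epsilon> n)" "z n"] by simp
    qed
    moreover have "\<epsilon> n / 2 \<le> lnorm d (mul (\<phi> (- \<epsilon> n)) (z n))"
      unfolding z_def \<epsilon>_def using \<phi>(2) by (intro y(4)) auto
    ultimately show False by linarith
  qed
  then show False by simp
qed

text \<open>\<open>gx l j\<close> and \<open>gy l j\<close> act as the partial derivatives of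
  coordinate \<open>l\<close> of the product in coordinate \<open>j\<close> of the left and right
  factor, specified through the chain rule along curves.\<close>

definition mul_partials :: "(nat \<Rightarrow> nat \<Rightarrow> vec \<Rightarrow> vec \<Rightarrow> real) \<Rightarrow>
    (nat \<Rightarrow> nat \<Rightarrow> vec \<Rightarrow> vec \<Rightarrow> real) \<Rightarrow> bool" where
  "mul_partials gx gy \<longleftrightarrow> (\<forall>l j. polyfun2 (gx l j) \<and> polyfun2 (gy l j)) \<and>
    (\<forall>X Y v w t. (\<forall>t. X t \<in> Vsp d \<and> Y t \<in> Vsp d) \<longrightarrow> curve_deriv X v t \<longrightarrow> curve_deriv Y w t \<longrightarrow>
      curve_deriv (\<lambda>t. mul (X t) (Y t))
        (\<lambda>l. (\<Sum>j<d. gx l j (X t) (Y t) * v j) + (\<Sum>j<d. gy l j (X t) (Y t) * w j)) t)"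

lemma mul_partialsD:
  assumes "mul_partials gx gy" "\<And>t. X t \<in> Vsp d" "\<And>t. Y t \<in> Vsp d" "curve_deriv X v t" "curve_deriv Y w t"
  shows "curve_deriv (\<lambda>t. mul (X t) (Y t))
    (\<lambda>l. (\<Sum>j<d. gx l j (X t) (Y t) * v j) + (\<Sum>j<d. gy l j (X t) (Y t) * w j)) t"
  using assms unfolding mul_partials_def by blast

lemma mul_partials_exist: "\<exists>gx gy. mul_partials gx gy"
proof -
  have "\<forall>l. \<exists>p. polyfun2 p \<and> (\<forall>x\<in>Vsp d. \<forall>y\<in>Vsp d. mul x y l = p x y)"
    using poly by blast
  then obtain p where p: "\<And>l. polyfun2 (p l)" "\<And>l x y. x \<in> Vsp d \<Longrightarrow> y \<in> Vsp d \<Longrightarrow> mul x y l = p l x y"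
    by metis
  have "\<forall>l. \<exists>g. (\<forall>j. polyfun2 (fst g j) \<and> polyfun2 (snd g j)) \<and>
    (\<forall>X Y v w t. (\<forall>t. X t \<in> Vsp d \<and> Y t \<in> Vsp d) \<longrightarrow> curve_deriv X v t \<longrightarrow> curve_deriv Y w t \<longrightarrow>
      ((\<lambda>t. p l (X t) (Y t)) has_real_derivative
        (\<Sum>j<d. fst g j (X t) (Y t) * v j) + (\<Sum>j<d. snd g j (X t) (Y t) * w j)) (at t))"
    using polyfun2_chain[OF p(1), of d] by simp
  then obtain g where g: "\<forall>l. (\<forall>j. polyfun2 (fst (g l) j) \<and> polyfun2 (snd (g l) j)) \<and>
    (\<forall>X Y v w t. (\<forall>t. X t \<in> Vsp d \<and> Y t \<in> Vsp d) \<longrightarrow> curve_deriv X v t \<longrightarrow> curve_deriv Y w t \<longrightarrow>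
      ((\<lambda>t. p l (X t) (Y t)) has_real_derivative
        (\<Sum>j<d. fst (g l) j (X t) (Y t) * v j) + (\<Sum>j<d. snd (g l) j (X t) (Y t) * w j)) (at t))"
    by (rule choice[THEN exE])
  have "mul_partials (\<lambda>l. fst (g l)) (\<lambda>l. snd (g l))"
    unfolding mul_partials_def
  proof (intro conjI allI impI)
    fix X Y v w t
    assume *: "\<forall>t. X t \<in> Vsp d \<and> Y t \<in> Vsp d" "curve_deriv X v t" "curve_deriv Y w t"
    then have "(\<lambda>t. mul (X t) (Y t) l) = (\<lambda>t. p l (X t) (Y t))" for l
      using p(2) by auto
    then show "curve_deriv (\<lambda>t. mul (X t) (Y t)) (\<lambda>l. (\<Sum>j<d. fst (g l) j (X t) (Y t) * v j)
        + (\<Sum>j<d. snd (g l) j (X t) (Y t) * w j)) t"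
      using g * unfolding curve_deriv_def[of "\<lambda>t. mul (X t) (Y t)"] by simp
  qed (use g in auto)
  then show ?thesis by blast
qed

text \<open>Both partial derivatives at the identity are the identity map, as seen by multiplying a
  curve with the constant identity on either side and using uniqueness of derivatives.\<close>

lemma curve_deriv_mul_zero:
  assumes X: "\<And>t. X t \<in> Vsp d" "X 0 = (\<lambda>_. 0)" "curve_deriv X v 0"
    and Y: "\<And>t. Y t \<in> Vsp d" "Y 0 = (\<lambda>_. 0)" "curve_deriv Y w 0"
  shows "curve_deriv (\<lambda>t. mul (X t) (Y t)) (\<lambda>l. v l + w l) 0"
proof -
  obtain gx gy where g: "mul_partials gx gy" using mul_partials_exist by blast
  have c: "curve_deriv (\<lambda>_. \<lambda>_. 0) (\<lambda>_. 0) 0" by (rule curve_deriv_const)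
  have "curve_deriv X (\<lambda>l. (\<Sum>j<d. gx l j (\<lambda>_. 0) (\<lambda>_. 0) * v j)) 0"
    using mul_partialsD[OF g X(1) zero_in_Vsp X(3) c] X by simp
  then have "(\<Sum>j<d. gx l j (\<lambda>_. 0) (\<lambda>_. 0) * v j) = v l" for l
    using X(3) unfolding curve_deriv_def by (metis DERIV_unique)
  moreover have "curve_deriv Y (\<lambda>l. (\<Sum>j<d. gy l j (\<lambda>_. 0) (\<lambda>_. 0) * w j)) 0"
    using mul_partialsD[OF g zero_in_Vsp Y(1) c Y(3)] Y by simp
  then have "(\<Sum>j<d. gy l j (\<lambda>_. 0) (\<lambda>_. 0) * w j) = w l" for l
    using Y(3) unfolding curve_deriv_def by (metis DERIV_unique)
  ultimately show ?thesis using mul_partialsD[OF g X(1) Y(1) X(3) Y(3)] X Y by simp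
qed

lemma lie_alg_add:
  assumes H: "subgroup H G" "closed H" and "v \<in> lie_alg G H" "w \<in> lie_alg G H"
  shows "(\<lambda>l. v l + w l) \<in> lie_alg G H"
proof -
  obtain \<phi> where \<phi>: "one_param G \<phi>" "range \<phi> \<subseteq> H" "curve_deriv \<phi> v 0" using assms(3) by (rule lie_algD)
  obtain \<psi> where \<psi>: "one_param G \<psi>" "range \<psi> \<subseteq> H" "curve_deriv \<psi> w 0" using assms(4) by (rule lie_algD)
  have vw: "v \<in> Vsp d" "w \<in> Vsp d" using assms(3,4) lie_alg_subset by auto
  show ?thesis
  proof (rule lie_alg_curveI[OF H])
    show "mul (\<phi> t) (\<psi> t) \<in> H" for t
      using subgroup.m_closed[OF H(1), of "\<phi> t" "\<psi> t"] \<phi>(2) \<psi>(2) by auto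
    show "curve_deriv (\<lambda>t. mul (\<phi> t) (\<psi> t)) (\<lambda>l. v l + w l) 0"
      using one_paramD[OF \<phi>(1)] one_paramD[OF \<psi>(1)] \<phi>(3) \<psi>(3) by (intro curve_deriv_mul_zero)
    show "mul (\<phi> 0) (\<psi> 0) = (\<lambda>_. 0)" by (simp add: one_paramD(3)[OF \<phi>(1)] one_paramD(3)[OF \<psi>(1)])
  qed (use vw in \<open>auto simp: Vsp_def\<close>)
qed

lemma lie_alg_scale:
  assumes "v \<in> lie_alg G H"
  shows "(\<lambda>l. c * v l) \<in> lie_alg G H"
proof -
  obtain \<phi> where \<phi>: "one_param G \<phi>" "range \<phi> \<subseteq> H" "curve_deriv \<phi> v 0" using assms by (rule lie_algD)
  show ?thesis
  proof (rule lie_algI)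
    have "continuous_on UNIV (\<lambda>t. \<phi> (c * t))"
      by (rule continuous_on_compose2[OF one_paramD(5)[OF \<phi>(1)]]) (auto intro!: continuous_intros)
    then show "one_param G (\<lambda>t. \<phi> (c * t))"
      using one_paramD[OF \<phi>(1)] by (simp add: one_param_def distrib_left)
    show "curve_deriv (\<lambda>t. \<phi> (c * t)) (\<lambda>l. c * v l) 0"
      unfolding curve_deriv_def
    proof
      fix l
      have "((\<lambda>t. \<phi> (c * t) l) has_real_derivative v l * c) (at 0)"
        by (rule DERIV_chain2[where f = "\<lambda>t. \<phi> t l" and g = "\<lambda>t. c * t" and x = 0 and Db = c])
           (use \<phi>(3) in \<open>auto simp: curve_deriv_def intro!: derivative_eq_intros\<close>)
      then show "((\<lambda>t. \<phi> (c * t) l) has_real_derivative c * v l) (at 0)" by (simp add: mult.commute)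
    qed
  qed (use \<phi> in auto)
qed

lemma lie_alg_sum:
  assumes H: "subgroup H G" "closed H" and fin: "finite I" and v: "\<And>i. i \<in> I \<Longrightarrow> v i \<in> lie_alg G H"
  shows "(\<lambda>l. \<Sum>i\<in>I. c i * v i l) \<in> lie_alg G H"
  using fin v
proof (induction I rule: finite_induct)
  case empty
  have "(\<lambda>_. 0) \<in> lie_alg G H"
    using subgroup.one_closed[OF H(1)]
    by (intro lie_alg_curveI[OF H, of "\<lambda>_. \<lambda>_. 0"]) (auto simp: curve_deriv_const)
  then show ?case by simp
next
  case (insert i I)
  then have "(\<lambda>l. c i * v i l + (\<Sum>i\<in>I. c i * v i l)) \<in> lie_alg G H"
    by (intro lie_alg_add[OF H] lie_alg_scale) auto
  then show ?case using insert by simp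
qed

end

section \<open>The adjoint action and linear characters\<close>

context malcev_group
begin

text \<open>Entry (l, j) of the matrix of Ad g in the basis X_0, ..., X_(d-1).\<close>

definition Adm :: "vec \<Rightarrow> nat \<Rightarrow> nat \<Rightarrow> real" where
  "Adm g l j = deriv (\<lambda>t. mul (mul g (sc t j)) (iv g) l) 0"

lemma curve_deriv_sc': "curve_deriv (\<lambda>t. sc t j) (sc 1 j) t"
  using curve_deriv_sc[of 1 j] by simp

lemma sum_sc: "j < d \<Longrightarrow> (\<Sum>m<d. f m * sc c j m) = f j * c"
  by (simp add: sc_def if_distrib[of "\<lambda>x. _ * x"] cong: if_cong)

text \<open>Conjugation is left translation by \<open>g\<close>, with derivative \<open>gy\<close>
  at (g, 0), followed by right translation by \<open>iv g\<close>, with derivative \<open>gx\<close>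
  at (g, iv g). The resulting matrix is polynomial in \<open>g\<close> and
  \<open>iv g\<close>.\<close>

lemma Adm_polynomial:
  assumes gp: "mul_partials gx gy" and g: "g \<in> Vsp d"
  shows "j < d \<Longrightarrow> Adm g l j = (\<Sum>m<d. gx l m g (iv g) * gy m j g (\<lambda>_. 0))"
    and "(\<And>t. X t \<in> Vsp d) \<Longrightarrow> X 0 = (\<lambda>_. 0) \<Longrightarrow> curve_deriv X v 0 \<Longrightarrow>
      curve_deriv (\<lambda>t. mul (mul g (X t)) (iv g)) (\<lambda>l. \<Sum>j<d. Adm g l j * v j) 0"
proof -
  let ?c = "\<lambda>l j. \<Sum>m<d. gx l m g (iv g) * gy m j g (\<lambda>_. 0)"
  have *: "curve_deriv (\<lambda>t. mul (mul g (X t)) (iv g)) (\<lambda>l. \<Sum>j<d. ?c l j * v j) 0"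
    if X: "\<And>t. X t \<in> Vsp d" "X 0 = (\<lambda>_. 0)" "curve_deriv X v 0" for X v
  proof -
    have 1: "curve_deriv (\<lambda>t. mul g (X t)) (\<lambda>l. \<Sum>j<d. gy l j g (\<lambda>_. 0) * v j) 0"
      using mul_partialsD[OF gp g X(1) curve_deriv_const X(3)] X(2) by simp
    have "curve_deriv (\<lambda>t. mul (mul g (X t)) (iv g))
        (\<lambda>l. \<Sum>m<d. gx l m g (iv g) * (\<Sum>j<d. gy m j g (\<lambda>_. 0) * v j)) 0"
      using mul_partialsD[OF gp _ iv_closed[OF g] 1 curve_deriv_const] X g by simp
    moreover have "(\<Sum>m<d. gx l m g (iv g) * (\<Sum>j<d. gy m j g (\<lambda>_. 0) * v j)) = (\<Sum>j<d. ?c l j * v j)" for l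
      unfolding sum_distrib_left sum_distrib_right by (subst sum.swap) (simp add: mult_ac)
    ultimately show ?thesis by simp
  qed
  have c: "Adm g l j = ?c l j" if "j < d" for l j
  proof -
    have "((\<lambda>t. mul (mul g (sc t j)) (iv g) l) has_real_derivative ?c l j) (at 0)"
      using *[OF _ _ curve_deriv_sc', of j] that by (simp add: curve_deriv_def sum_sc)
    then show ?thesis unfolding Adm_def by (rule DERIV_imp_deriv)
  qed
  then show "j < d \<Longrightarrow> Adm g l j = ?c l j" .
  show "curve_deriv (\<lambda>t. mul (mul g (X t)) (iv g)) (\<lambda>l. \<Sum>j<d. Adm g l j * v j) 0"
    if "\<And>t. X t \<in> Vsp d" "X 0 = (\<lambda>_. 0)" "curve_deriv X v 0"
    using *[OF that] by (simp add: c)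
qed

lemma curve_deriv_conj:
  assumes "g \<in> Vsp d" "\<And>t. X t \<in> Vsp d" "X 0 = (\<lambda>_. 0)" "curve_deriv X v 0"
  shows "curve_deriv (\<lambda>t. mul (mul g (X t)) (iv g)) (\<lambda>l. \<Sum>j<d. Adm g l j * v j) 0"
  using mul_partials_exist Adm_polynomial(2)[OF _ assms] by blast

lemma curve_deriv_conj_sc:
  assumes "g \<in> Vsp d" "j < d"
  shows "curve_deriv (\<lambda>t. mul (mul g (sc t j)) (iv g)) (\<lambda>l. Adm g l j) 0"
  using curve_deriv_conj[OF assms(1) _ _ curve_deriv_sc', of j] assms by (simp add: sum_sc)

lemma curve_deriv_unique: "curve_deriv X v t \<Longrightarrow> curve_deriv X w t \<Longrightarrow> v l = w l"
  unfolding curve_deriv_def by (metis DERIV_unique)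

lemma Adm_zero: "j < d \<Longrightarrow> Adm (\<lambda>_. 0) l j = sc 1 j l"
proof -
  assume j: "j < d"
  have "iv (\<lambda>_. 0) = (\<lambda>_. 0)" using G.inv_one by simp
  then have "curve_deriv (\<lambda>t. sc t j) (\<lambda>l. Adm (\<lambda>_. 0) l j) 0"
    using curve_deriv_conj_sc[of "\<lambda>_. 0" j] j by simp
  then show ?thesis using curve_deriv_unique[OF _ curve_deriv_sc'] by blast
qed

lemma Adm_mul:
  assumes g: "g \<in> Vsp d" and h: "h \<in> Vsp d" and j: "j < d"
  shows "Adm (mul g h) l j = (\<Sum>m<d. Adm g l m * Adm h m j)"
proof -
  have "curve_deriv (\<lambda>t. mul (mul g (mul (mul h (sc t j)) (iv h))) (iv g)) (\<lambda>l. \<Sum>m<d. Adm g l m * Adm h m j) 0"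
    using g h j by (intro curve_deriv_conj curve_deriv_conj_sc) auto
  then have "curve_deriv (\<lambda>t. mul (mul (mul g h) (sc t j)) (iv (mul g h))) (\<lambda>l. \<Sum>m<d. Adm g l m * Adm h m j) 0"
    using g h j by (simp add: mul_assoc iv_mul)
  then show ?thesis using curve_deriv_unique curve_deriv_conj_sc[of "mul g h" j] g h j by auto
qed

lemma Adm_sc_deriv:
  assumes "i < d" "j < d"
  shows "((\<lambda>s. Adm (sc s i) l j) has_real_derivative lie_br G i j l) (at 0)"
proof -
  obtain gx gy where gp: "mul_partials gx gy" using mul_partials_exist by blast
  have D: "(\<lambda>s. p (sc s i) (sc (c * s) i)) differentiable at 0" if "polyfun2 p" for p c
  proof -
    from polyfun2_chain[OF that, of d] obtain hx hy where h: "\<forall>X Y v w t. (\<forall>t. X t \<in> Vsp d \<and> Y t \<in> Vsp d) \<longrightarrow>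
        curve_deriv X v t \<longrightarrow> curve_deriv Y w t \<longrightarrow> ((\<lambda>t. p (X t) (Y t)) has_real_derivative
          (\<Sum>j<d. hx j (X t) (Y t) * v j) + (\<Sum>j<d. hy j (X t) (Y t) * w j)) (at t)"
      by blast
    show ?thesis
      using h[rule_format, OF _ curve_deriv_sc' curve_deriv_sc, of i c i 0] assms
      by (auto simp: real_differentiable_def)
  qed
  \<comment> \<open>The inverse of exp(s X_i) and the identity are both written as
    \<open>sc (c * s) i\<close>, with c = -1 and c = 0, the form covered by
    \<open>D\<close>.\<close>
  have eq: "(\<lambda>s. Adm (sc s i) l j) = (\<lambda>s. \<Sum>m<d. gx l m (sc s i) (sc (- 1 * s) i) * gy m j (sc s i) (sc (0 * s) i))"
    using Adm_polynomial(1)[OF gp] assms by (auto simp: iv_sc)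
  have p: "polyfun2 (gx l m)" "polyfun2 (gy m j)" for m using gp by (auto simp: mul_partials_def)
  have "(\<lambda>s. Adm (sc s i) l j) differentiable at 0"
    unfolding eq by (intro differentiable_sum differentiable_mult D p ballI) auto
  then have "((\<lambda>s. Adm (sc s i) l j) has_real_derivative deriv (\<lambda>s. Adm (sc s i) l j) 0) (at 0)"
    by (simp add: DERIV_deriv_iff_real_differentiable)
  then show ?thesis by (simp add: lie_br_def Adm_def)
qed

text \<open>Used in two roles: as a functional on tangent vectors and, in the same coordinates, as a
  candidate character on group elements.\<close>

definition lin :: "vec \<Rightarrow> vec \<Rightarrow> real" where
  "lin c x = (\<Sum>l<d. c l * x l)"

lemma curve_deriv_lin: "curve_deriv X v t \<Longrightarrow> ((\<lambda>t. lin c (X t)) has_real_derivative lin c v) (at t)"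
  unfolding lin_def curve_deriv_def by (intro DERIV_sum DERIV_cmult) auto

lemma lin_add: "lin c (\<lambda>l. x l + y l) = lin c x + lin c y"
  by (simp add: lin_def distrib_left sum.distrib)

lemma continuous_on_lin: "continuous_on S f \<Longrightarrow> continuous_on S (\<lambda>t. lin c (f t))"
  unfolding lin_def
  by (intro continuous_on_sum continuous_on_mult continuous_on_const)
     (simp add: continuous_on_product_then_coordinatewise)

definition brackets_ann :: "vec \<Rightarrow> bool" where
  "brackets_ann c \<longleftrightarrow> (\<forall>i<d. \<forall>j<d. lin c (lie_br G i j) = 0)"

text \<open>Invariance passes to products because Ad is multiplicative, so it is enough to treat g =
  exp(t X_i), where the derivative in t vanishes.\<close>

lemma lin_Adm:
  assumes c: "brackets_ann c" and g: "g \<in> Vsp d" and j: "j < d"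
  shows "lin c (\<lambda>l. Adm g l j) = c j"
proof -
  have "\<forall>j<d. lin c (\<lambda>l. Adm g l j) = c j"
    using g
  proof (rule second_kind_induct)
    show zero: "\<forall>j<d. lin c (\<lambda>l. Adm (\<lambda>_. 0) l j) = c j"
      by (simp add: lin_def Adm_zero sum_sc)
    have swap: "lin c (\<lambda>l. \<Sum>m<d. f l m * h m) = (\<Sum>m<d. lin c (\<lambda>l. f l m) * h m)" for f h
      unfolding lin_def sum_distrib_left sum_distrib_right by (subst sum.swap) (simp add: mult_ac)
    fix x y assume xy: "x \<in> Vsp d" "y \<in> Vsp d" "\<forall>j<d. lin c (\<lambda>l. Adm x l j) = c j"
      "\<forall>j<d. lin c (\<lambda>l. Adm y l j) = c j"
    show "\<forall>j<d. lin c (\<lambda>l. Adm (mul x y) l j) = c j"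
    proof (intro allI impI)
      fix j assume j: "j < d"
      have "lin c (\<lambda>l. Adm (mul x y) l j) = (\<Sum>m<d. c m * Adm y m j)"
        using xy j by (simp add: Adm_mul swap)
      then show "lin c (\<lambda>l. Adm (mul x y) l j) = c j" using xy j by (simp add: lin_def)
    qed
  next
    fix i t assume i: "i < d"
    have swap: "lin c (\<lambda>l. \<Sum>m<d. f l m * h m) = (\<Sum>m<d. lin c (\<lambda>l. f l m) * h m)" for f h
      unfolding lin_def sum_distrib_left sum_distrib_right by (subst sum.swap) (simp add: mult_ac)
    show "\<forall>j<d. lin c (\<lambda>l. Adm (sc t i) l j) = c j"
    proof (intro allI impI)
      fix j assume j: "j < d"
      let ?f = "\<lambda>s. lin c (\<lambda>l. Adm (sc s i) l j)"
      \<comment> \<open>Multiplicativity of Ad moves the derivative at \<open>s\<close> to 0, where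
        it is a combination of the values of \<open>c\<close> on brackets [X_i, X_m].\<close>
      have "(?f has_real_derivative 0) (at s)" for s
      proof -
        have "?f (h + s) = (\<Sum>m<d. lin c (\<lambda>l. Adm (sc h i) l m) * Adm (sc s i) m j)" for h
          using i j by (simp add: sc_add Adm_mul swap)
        moreover have "((\<lambda>h. \<Sum>m<d. lin c (\<lambda>l. Adm (sc h i) l m) * Adm (sc s i) m j) has_real_derivative
            (\<Sum>m<d. lin c (lie_br G i m) * Adm (sc s i) m j)) (at 0)"
          unfolding lin_def using i by (intro DERIV_sum DERIV_cmult_right DERIV_cmult Adm_sc_deriv) auto
        moreover have "(\<Sum>m<d. lin c (lie_br G i m) * Adm (sc s i) m j) = 0"
          using c i by (simp add: brackets_ann_def)
        ultimately have "((\<lambda>h. ?f (h + s)) has_real_derivative 0) (at 0)" by simp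
        then show ?thesis using DERIV_shift[of ?f 0 0 s] by simp
      qed
      then have "?f t = ?f 0" by (intro DERIV_isconst_all) auto
      then show "?f t = c j" using j by (simp add: lin_def Adm_zero sum_sc)
    qed
  qed
  then show ?thesis using j by blast
qed

lemma update_coord_in_Vsp[simp]: "y \<in> Vsp d \<Longrightarrow> i < d \<Longrightarrow> y(i := t) \<in> Vsp d"
  by (auto simp: Vsp_def)

text \<open>In coordinates of the second kind, changing one coordinate is right translation by a
  conjugate of \<open>exp (t X\<^sub>i)\<close>.\<close>

lemma coordinate_curve:
  assumes y: "y \<in> Vsp d" and i: "i < d"
  shows "\<exists>q\<in>Vsp d. \<forall>t. y(i := y i + t) = mul y (mul (mul q (sc t i)) (iv q))"
proof -
  define p where "p = prodsc y [0..<i]"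
  define r where "r = prodsc y [Suc i..<d]"
  have pr: "p \<in> Vsp d" "r \<in> Vsp d" using i by (auto simp: p_def r_def intro!: prodsc_closed)
  have split: "[0..<d] = ([0..<i] @ [i]) @ [Suc i..<d]"
    using i upt_add_eq_append[of 0 "Suc i" "d - Suc i"] by simp
  have dec: "prodsc x [0..<d] = mul (mul (prodsc x [0..<i]) (sc (x i) i)) (prodsc x [Suc i..<d])" for x
    unfolding split using i by (subst prodsc_append) auto
  have yt: "y(i := y i + t) = mul (mul p (sc (y i + t) i)) r" for t
  proof -
    have "prodsc (y(i := y i + t)) [0..<i] = p" "prodsc (y(i := y i + t)) [Suc i..<d] = r"
      unfolding p_def r_def by (auto intro!: prodsc_cong)
    then show ?thesis
      using prodsc_all[of "y(i := y i + t)"] dec[of "y(i := y i + t)"] y i by simp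
  qed
  have yy: "y = mul (mul p (sc (y i) i)) r" using yt[of 0] by simp
  have "y(i := y i + t) = mul y (mul (mul (iv r) (sc t i)) (iv (iv r)))" for t
  proof -
    have "mul (mul (mul p (sc (y i) i)) r) (mul (mul (iv r) (sc t i)) r) = mul (mul p (sc (y i + t) i)) r"
      using pr i by (simp add: mul_assoc sc_add)
    then have "mul (mul p (sc (y i + t) i)) r = mul y (mul (mul (iv r) (sc t i)) r)"
      unfolding yy[symmetric] by (rule sym)
    then show ?thesis using pr by (simp add: yt)
  qed
  then show ?thesis using pr by (intro bexI[of _ "iv r"] allI) simp_all
qed

lemma curve_deriv_update: "curve_deriv (\<lambda>t. y(i := y i + t)) (sc 1 i) t"
  unfolding curve_deriv_def by (auto simp: sc_def intro!: derivative_eq_intros)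

text \<open>The one-form with constant coefficients \<open>c\<close> is left-invariant: translated
  back to the identity, the i-th coordinate direction at \<open>z\<close> is some Ad q X_i, on which
  \<open>c\<close> takes the value \<open>c i\<close>.\<close>

lemma lin_translate_deriv:
  assumes c: "brackets_ann c" and z: "z \<in> Vsp d"
    and X: "\<And>t. X t \<in> Vsp d" "X 0 = (\<lambda>_. 0)" "curve_deriv X v 0"
  shows "((\<lambda>t. lin c (mul z (X t))) has_real_derivative lin c v) (at 0)"
proof -
  obtain gx gy where gp: "mul_partials gx gy" using mul_partials_exist by blast
  have left: "curve_deriv (\<lambda>t. mul x (Y t)) (\<lambda>l. \<Sum>j<d. gy l j x (Y 0) * w j) 0"
    if "x \<in> Vsp d" "\<And>t. Y t \<in> Vsp d" "curve_deriv Y w 0" for x Y w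
    using mul_partialsD[OF gp that(1,2) curve_deriv_const that(3)] by simp
  \<comment> \<open>Column \<open>i\<close> of the derivative at \<open>z\<close> of left
    translation by \<open>iv z\<close>; \<open>c\<close> applied to it reproduces
    \<open>c i\<close>, so this derivative preserves \<open>lin c\<close>.\<close>
  have col: "lin c (\<lambda>l. gy l i (iv z) z) = c i" if i: "i < d" for i
  proof -
    obtain q where q: "q \<in> Vsp d" "\<And>t. z(i := z i + t) = mul z (mul (mul q (sc t i)) (iv q))"
      using coordinate_curve[OF z i] by blast
    have "curve_deriv (\<lambda>t. mul (iv z) (z(i := z i + t))) (\<lambda>l. gy l i (iv z) z) 0"
      using left[OF _ _ curve_deriv_update, of "iv z" z i] z i by (simp add: sum_sc)
    moreover have "mul (iv z) (z(i := z i + t)) = mul (mul q (sc t i)) (iv q)" for t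
      unfolding q(2) using z q(1) i by simp
    ultimately have "curve_deriv (\<lambda>t. mul (mul q (sc t i)) (iv q)) (\<lambda>l. gy l i (iv z) z) 0" by simp
    then have "gy l i (iv z) z = Adm q l i" for l
      using curve_deriv_unique curve_deriv_conj_sc[OF q(1) i] by blast
    then show ?thesis using lin_Adm[OF c q(1) i] by simp
  qed
  define u where "u l = (\<Sum>j<d. gy l j z (\<lambda>_. 0) * v j)" for l
  have u: "curve_deriv (\<lambda>t. mul z (X t)) u 0" using left[OF z X(1,3)] X(2) by (simp add: u_def[abs_def])
  have "curve_deriv (\<lambda>t. mul (iv z) (mul z (X t))) (\<lambda>l. \<Sum>j<d. gy l j (iv z) z * u j) 0"
    using left[OF _ _ u, of "iv z"] z X by simp
  then have "curve_deriv X (\<lambda>l. \<Sum>j<d. gy l j (iv z) z * u j) 0" using z X(1) by simp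
  then have "v l = (\<Sum>j<d. gy l j (iv z) z * u j)" for l using curve_deriv_unique[OF X(3)] by blast
  then have "lin c v = (\<Sum>j<d. lin c (\<lambda>l. gy l j (iv z) z) * u j)"
    unfolding lin_def sum_distrib_left sum_distrib_right by (simp add: sum_distrib_left) (subst sum.swap, simp add: mult_ac)
  also have "\<dots> = lin c u" using col by (simp add: lin_def)
  finally show ?thesis using curve_deriv_lin[OF u] by simp
qed

text \<open>The coordinates of \<open>y\<close> are switched on one at a time through the
  truncations \<open>T k\<close>. Varying coordinate \<open>i\<close> of the right factor changes
  \<open>lin c\<close> of the product at the constant rate \<open>c i\<close>.\<close>

proposition lin_hom:
  assumes c: "brackets_ann c" and x: "x \<in> Vsp d" and y: "y \<in> Vsp d"
  shows "lin c (mul x y) = lin c x + lin c y"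
proof -
  define T where "T k = (\<lambda>l. if l < k then y l else 0)" for k
  have T: "T k \<in> Vsp d" if "k \<le> d" for k using that by (auto simp: T_def Vsp_def)
  have step: "lin c (mul x (z(i := t))) = lin c (mul x (z(i := 0))) + c i * t"
    if z: "z \<in> Vsp d" and i: "i < d" for z i t
  proof -
    let ?e = "\<lambda>t. lin c (mul x (z(i := t))) - c i * t"
    have "(?e has_real_derivative 0) (at t)" for t
    proof -
      define z' where "z' = z(i := t)"
      have z': "z' \<in> Vsp d" using z i by (simp add: z'_def)
      obtain q where q: "q \<in> Vsp d" "\<And>h. z'(i := z' i + h) = mul z' (mul (mul q (sc h i)) (iv q))"
        using coordinate_curve[OF z' i] by blast
      have "mul x (z(i := h + t)) = mul (mul x z') (mul (mul q (sc h i)) (iv q))" for h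
        using q(2)[of h] q(1) x z' i by (simp add: z'_def mul_assoc add.commute)
      moreover have "((\<lambda>h. lin c (mul (mul x z') (mul (mul q (sc h i)) (iv q)))) has_real_derivative
          lin c (\<lambda>l. Adm q l i)) (at 0)"
        using x z' q(1) i by (intro lin_translate_deriv[OF c] curve_deriv_conj_sc) auto
      ultimately have "((\<lambda>h. lin c (mul x (z(i := h + t)))) has_real_derivative c i) (at 0)"
        using lin_Adm[OF c q(1) i] by simp
      then have "((\<lambda>t. lin c (mul x (z(i := t)))) has_real_derivative c i) (at t)"
        using DERIV_shift[of "\<lambda>t. lin c (mul x (z(i := t)))" "c i" 0 t] by simp
      from DERIV_diff[OF this DERIV_cmult_Id[of "c i"]] show ?thesis by simp
    qed
    then have "?e t = ?e 0" using DERIV_isconst_all[of ?e t 0] by blast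
    then show ?thesis by simp
  qed
  have "lin c (mul x (T k)) = lin c x + (\<Sum>l<k. c l * y l)" if "k \<le> d" for k
    using that
  proof (induction k)
    case 0
    then show ?case using x by (simp add: T_def)
  next
    case (Suc k)
    have T': "T (Suc k) = (T k)(k := y k)" "(T k)(k := 0) = T k" by (auto simp: T_def)
    have "lin c (mul x (T (Suc k))) = lin c (mul x (T k)) + c k * y k"
      using step[of "T k" k "y k"] T[of k] Suc.prems by (simp only: T' Suc_le_eq less_imp_le)
    then show ?case using Suc by simp
  qed
  from this[of d] have "lin c (mul x (T d)) = lin c x + lin c y" by (simp add: lin_def)
  moreover have "T d = y" using y by (auto simp: T_def Vsp_def)
  ultimately show ?thesis by simp
qed

end

section \<open>The common kernel of the characters\<close>

context malcev_group
begin

lemma lin_zero[simp]: "lin c (\<lambda>_. 0) = 0"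
  by (simp add: lin_def)

lemma lin_iv:
  assumes "brackets_ann c" "x \<in> Vsp d"
  shows "lin c (iv x) = - lin c x"
  using lin_hom[OF assms(1), of x "iv x"] assms(2) by simp

text \<open>At t = 1 this transfers values of characters between a tangent vector and the element
  exp(v) reached along it.\<close>

lemma lin_one_param:
  assumes c: "brackets_ann c" and \<phi>: "one_param G \<phi>" "curve_deriv \<phi> v 0"
  shows "lin c (\<phi> t) = t * lin c v"
proof -
  have "((\<lambda>t. lin c (\<phi> t) - lin c v * t) has_real_derivative 0) (at s)" for s
  proof -
    have "((\<lambda>h. lin c (\<phi> h) + lin c (\<phi> s)) has_real_derivative lin c v + 0) (at 0)"
      by (intro DERIV_add curve_deriv_lin \<phi>(2) DERIV_const)
    moreover have "lin c (\<phi> (h + s)) = lin c (\<phi> h) + lin c (\<phi> s)" for h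
      using one_paramD(1,2)[OF \<phi>(1)] lin_hom[OF c] by simp
    ultimately have "((\<lambda>t. lin c (\<phi> t)) has_real_derivative lin c v) (at s)"
      using DERIV_shift[of "\<lambda>t. lin c (\<phi> t)" "lin c v" 0 s] by simp
    from DERIV_diff[OF this DERIV_cmult_Id[of "lin c v"]] show ?thesis by simp
  qed
  then have "lin c (\<phi> t) - lin c v * t = lin c (\<phi> 0) - lin c v * 0"
    using DERIV_isconst_all[of "\<lambda>t. lin c (\<phi> t) - lin c v * t" t 0] by blast
  then show ?thesis by (simp add: one_paramD(3)[OF \<phi>(1)])
qed

text \<open>Every one-parameter group in \<open>H\<close> lies in the kernel of the functional, so
  this kernel in \<open>H\<close> has the full Lie algebra of \<open>H\<close>, and connectedness
  makes it all of \<open>H\<close>.\<close>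

lemma lin_vanishes_on_subgroup:
  assumes c: "brackets_ann c" and H: "subgroup H G" "closed H" "connected H"
    and lie: "\<And>v. v \<in> lie_alg G H \<Longrightarrow> lin c v = 0" and g: "g \<in> H"
  shows "lin c g = 0"
proof -
  have HV: "H \<subseteq> Vsp d" using subgroup.subset[OF H(1)] by simp
  define K where "K = {x \<in> H. lin c x = 0}"
  have "H \<subseteq> K"
  proof (rule connected_subgroup_subset[OF H])
    show "subgroup K G"
    proof (rule subgroup.intro)
      show "K \<subseteq> carrier G" using HV by (auto simp: K_def)
      fix x y assume "x \<in> K" "y \<in> K"
      then show "x \<otimes>\<^bsub>G\<^esub> y \<in> K"
        using subgroup.m_closed[OF H(1), of x y] HV lin_hom[OF c, of x y] by (auto simp: K_def)
    next
      show "\<one>\<^bsub>G\<^esub> \<in> K" using subgroup.one_closed[OF H(1)] by (simp add: K_def)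
      fix x assume "x \<in> K"
      then show "iv x \<in> K"
        using subgroup.m_inv_closed[OF H(1), of x] HV lin_iv[OF c, of x] by (auto simp: K_def)
    qed
    show "closed K"
      unfolding K_def by (intro continuous_closed_preimage_constant continuous_on_lin continuous_on_id H)
    show "lie_alg G H \<subseteq> lie_alg G K"
    proof
      fix v assume v: "v \<in> lie_alg G H"
      then obtain \<phi> where \<phi>: "one_param G \<phi>" "range \<phi> \<subseteq> H" "curve_deriv \<phi> v 0" by (rule lie_algD)
      have "lin c (\<phi> t) = 0" for t using lin_one_param[OF c \<phi>(1,3)] lie[OF v] by simp
      then show "v \<in> lie_alg G K" using \<phi> by (intro lie_algI[OF \<phi>(1) _ \<phi>(3)]) (auto simp: K_def)
    qed
  qed (auto simp: K_def)
  then show ?thesis using g by (auto simp: K_def)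
qed

text \<open>Plays the part of the closed commutator subgroup: it contains all commutators and lies
  in every closed subgroup that does. Being a linear subspace in coordinates, it is closed and
  connected.\<close>

definition char_kernel :: "vec set" where
  "char_kernel = {x \<in> Vsp d. \<forall>c. brackets_ann c \<longrightarrow> lin c x = 0}"

lemma char_kernel_subgroup: "subgroup char_kernel G"
  by (rule subgroup.intro) (auto simp: char_kernel_def lin_hom lin_iv)

lemma char_kernel_closed: "closed char_kernel"
proof -
  have "char_kernel = Vsp d \<inter> (\<Inter>c\<in>{c. brackets_ann c}. {x \<in> Vsp d. lin c x = 0})"
    by (auto simp: char_kernel_def)
  moreover have "closed {x \<in> Vsp d. lin c x = 0}" for c
    by (intro continuous_closed_preimage_constant continuous_on_lin continuous_on_id closed_Vsp)
  ultimately show ?thesis by (simp add: closed_Int closed_Vsp closed_INT)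
qed

lemma char_kernel_connected: "connected char_kernel"
proof -
  have "char_kernel = \<Union>((\<lambda>y. (\<lambda>t l. t * y l) ` {0..1}) ` char_kernel)"
  proof (intro equalityI subsetI)
    fix x assume "x \<in> char_kernel"
    moreover have "x \<in> (\<lambda>t l. t * x l) ` {0..1}" by (rule image_eqI[of _ _ 1]) auto
    ultimately show "x \<in> \<Union>((\<lambda>y. (\<lambda>t l. t * y l) ` {0..1}) ` char_kernel)" by blast
  next
    fix x assume "x \<in> \<Union>((\<lambda>y. (\<lambda>t l. t * y l) ` {0..1}) ` char_kernel)"
    then obtain y t where x: "y \<in> char_kernel" "x = (\<lambda>l. t * y l)" by auto
    have "lin c (\<lambda>l. t * y l) = t * lin c y" for c by (simp add: lin_def sum_distrib_left mult_ac)
    then show "x \<in> char_kernel" using x by (auto simp: char_kernel_def Vsp_def)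
  qed
  moreover have "connected (\<Union>((\<lambda>y. (\<lambda>t l. t * y l) ` {0..1}) ` char_kernel))"
  proof (rule connected_Union)
    fix S assume "S \<in> (\<lambda>y. (\<lambda>t l. t * y l) ` {0..1::real}) ` char_kernel"
    then obtain y where S: "S = (\<lambda>t l. t * y l) ` {0..1}" by auto
    have "continuous_on {0..1} (\<lambda>t l. t * y l)"
      by (rule continuous_on_coordinatewise_then_product)
         (intro continuous_on_mult continuous_on_id continuous_on_const)
    then show "connected S" unfolding S by (rule connected_continuous_image) simp
  next
    have "(\<lambda>_. 0) \<in> (\<lambda>t l. t * y l) ` {0..1}" for y :: vec by (rule image_eqI[of _ _ 0]) auto
    then show "\<Inter>((\<lambda>y. (\<lambda>t l. t * y l) ` {0..1}) ` char_kernel) \<noteq> {}" by blast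
  qed
  ultimately show ?thesis by simp
qed

text \<open>A functional annihilating the Lie algebra of a closed subgroup that contains all commutators
  also annihilates all brackets: differentiate \<open>Ad (exp (s X\<^sub>i)) X\<^sub>j - X\<^sub>j\<close> in \<open>s\<close>.\<close>

lemma brackets_annI:
  assumes K: "subgroup K G" "closed K" and comm: "\<And>x y. x \<in> Vsp d \<Longrightarrow> y \<in> Vsp d \<Longrightarrow> gcomm G x y \<in> K"
    and c: "\<And>v. v \<in> lie_alg G K \<Longrightarrow> lin c v = 0"
  shows "brackets_ann c"
  unfolding brackets_ann_def
proof (intro allI impI)
  fix i j assume i: "i < d" and j: "j < d"
  have "lin c (\<lambda>l. Adm (sc s i) l j) = c j" for s
  proof -
    have s: "sc s i \<in> Vsp d" using i by simp
    have "(\<lambda>l. Adm (sc s i) l j + sc (- 1) j l) \<in> lie_alg G K"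
    proof (rule lie_alg_curveI[OF K])
      \<comment> \<open>The curve g exp(t X_j) g^-1 exp(-t X_j) has velocity Ad g X_j - X_j. With
        the convention of \<open>gcomm\<close> it is the commutator of the inverses of g and exp(t
        X_j).\<close>
      let ?X = "\<lambda>t. mul (mul (mul (sc s i) (sc t j)) (iv (sc s i))) (sc (- 1 * t) j)"
      show cd: "curve_deriv ?X (\<lambda>l. Adm (sc s i) l j + sc (- 1) j l) 0"
        using i j by (intro curve_deriv_mul_zero curve_deriv_conj_sc curve_deriv_sc) auto
      show "?X t \<in> K" for t
        using comm[of "iv (sc s i)" "iv (sc t j)"] i j by (simp add: gcomm_def iv_sc)
      show "?X 0 = (\<lambda>_. 0)" using i by simp
      have "Adm (sc s i) l j = 0" if "d \<le> l" for l
      proof -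
        have "mul (mul (sc s i) (sc t j)) (iv (sc s i)) \<in> Vsp d" for t using i j by simp
        then have "(\<lambda>t. mul (mul (sc s i) (sc t j)) (iv (sc s i)) l) = (\<lambda>_. 0)"
          using that unfolding Vsp_def by auto
        then show ?thesis by (simp add: Adm_def)
      qed
      then show "(\<lambda>l. Adm (sc s i) l j + sc (- 1) j l) \<in> Vsp d" using j by (auto simp: Vsp_def sc_def)
    qed
    from c[OF this] j show ?thesis by (simp add: lin_add) (simp add: lin_def sum_sc)
  qed
  then have "((\<lambda>s. lin c (\<lambda>l. Adm (sc s i) l j)) has_real_derivative 0) (at 0)" by simp
  moreover have "((\<lambda>s. lin c (\<lambda>l. Adm (sc s i) l j)) has_real_derivative lin c (lie_br G i j)) (at 0)"
    unfolding lin_def using i j by (intro DERIV_sum DERIV_cmult Adm_sc_deriv)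
  ultimately show "lin c (lie_br G i j) = 0" by (rule DERIV_unique[rotated])
qed

text \<open>By \<open>brackets_annI\<close>, every functional vanishing on the Lie algebra of
  \<open>K'\<close> annihilates the brackets, so it vanishes on the Lie algebra of
  \<open>char_kernel\<close>. By linear duality the latter algebra is contained in the former.
  Intersecting \<open>K\<close> with \<open>char_kernel\<close> supplies the inclusion required by
  \<open>connected_subgroup_subset\<close>.\<close>

proposition char_kernel_subset:
  assumes K: "subgroup K G" "closed K" and comm: "\<And>x y. x \<in> Vsp d \<Longrightarrow> y \<in> Vsp d \<Longrightarrow> gcomm G x y \<in> K"
  shows "char_kernel \<subseteq> K"
proof -
  define K' where "K' = K \<inter> char_kernel"
  have K': "subgroup K' G" "closed K'"
    using G.subgroups_Inter_pair[OF K(1) char_kernel_subgroup] K(2) char_kernel_closed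
    by (auto simp: K'_def)
  have comm': "gcomm G x y \<in> K'" if "x \<in> Vsp d" "y \<in> Vsp d" for x y
    using comm[OF that] that by (auto simp: K'_def char_kernel_def gcomm_def lin_hom lin_iv)
  have "char_kernel \<subseteq> K'"
  proof (rule connected_subgroup_subset[OF char_kernel_subgroup char_kernel_closed char_kernel_connected K'])
    show "lie_alg G char_kernel \<subseteq> lie_alg G K'"
    proof
      fix v assume v: "v \<in> lie_alg G char_kernel"
      then have vV: "v \<in> Vsp d" using lie_alg_subset by auto
      from v obtain \<phi> where \<phi>: "one_param G \<phi>" "range \<phi> \<subseteq> char_kernel" "curve_deriv \<phi> v 0"
        by (rule lie_algD)
      have v0: "lin c v = 0" if c: "brackets_ann c" for c
      proof -
        have "\<phi> 1 \<in> char_kernel" using \<phi>(2) by auto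
        then have "lin c (\<phi> 1) = 0" using c by (auto simp: char_kernel_def)
        then show ?thesis using lin_one_param[OF c \<phi>(1,3), of 1] by simp
      qed
      \<comment> \<open>Used here for duality alone: a vector killed by the rows outside
        \<open>I\<close> is a combination of the \<open>p j\<close> with \<open>j \<in> I\<close>,
        which lie in the Lie algebra.\<close>
      obtain I \<mu> p \<Delta> where I: "I \<subseteq> {..<d}" "\<Delta> \<noteq> 0" "\<forall>i\<in>I. p i \<in> lie_alg G K'"
          "\<forall>j<d. j \<notin> I \<longrightarrow> (\<forall>s\<in>lie_alg G K'. (\<Sum>l<d. \<mu> j l * s l) = 0)"
          "\<forall>x. \<forall>l<d. \<Delta> * x l = (\<Sum>j<d. (\<Sum>m<d. \<mu> j m * x m) * p j l)"
        using dual_basis_extension[of d "lie_alg G K'"] by blast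
      have ann: "lin (\<mu> j) v = 0" if "j < d" "j \<notin> I" for j
      proof (rule v0, rule brackets_annI[OF K' comm'])
        show "lin (\<mu> j) w = 0" if "w \<in> lie_alg G K'" for w
          using I(4) \<open>j < d\<close> \<open>j \<notin> I\<close> that unfolding lin_def by blast
      qed
      have "v l = (\<Sum>j\<in>I. (lin (\<mu> j) v / \<Delta>) * p j l)" for l
      proof (cases "l < d")
        case True
        then have "\<Delta> * v l = (\<Sum>j<d. lin (\<mu> j) v * p j l)" using I(5) by (simp add: lin_def)
        also have "\<dots> = (\<Sum>j\<in>I. lin (\<mu> j) v * p j l)"
          using I(1) ann by (intro sum.mono_neutral_right) auto
        finally have "v l = (\<Sum>j\<in>I. lin (\<mu> j) v * p j l) / \<Delta>" using I(2) by (simp add: field_simps)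
        then show ?thesis by (simp add: sum_divide_distrib)
      next
        case False
        then have "v l = 0" "\<forall>j\<in>I. p j l = 0" using vV I(3) lie_alg_subset[of K'] by (auto simp: Vsp_def)
        then show ?thesis by simp
      qed
      then have "v = (\<lambda>l. \<Sum>j\<in>I. (lin (\<mu> j) v / \<Delta>) * p j l)" by (rule ext)
      moreover have "(\<lambda>l. \<Sum>j\<in>I. (lin (\<mu> j) v / \<Delta>) * p j l) \<in> lie_alg G K'"
        using I(1,3) by (intro lie_alg_sum[OF K']) (auto intro: finite_subset)
      ultimately show "v \<in> lie_alg G K'" by simp
    qed
  qed (auto simp: K'_def)
  then show ?thesis by (auto simp: K'_def)
qed

text \<open>The elements that may be multiplied into any entry of an \<open>s\<close>-fold commutator without changing
  it. Unlike the commutator subgroup itself, this subgroup is visibly closed.\<close>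

definition comm_invisible :: "nat \<Rightarrow> vec set" where
  "comm_invisible s = {h \<in> Vsp d. \<forall>w j. (\<forall>i<s. w i \<in> Vsp d) \<and> j < s \<longrightarrow>
     iter_comm G s (w(j := mul (w j) h)) = iter_comm G s w}"

lemma comm_invisibleD:
  "h \<in> comm_invisible s \<Longrightarrow> (\<And>i. i < s \<Longrightarrow> w i \<in> Vsp d) \<Longrightarrow> j < s \<Longrightarrow>
    iter_comm G s (w(j := mul (w j) h)) = iter_comm G s w"
  by (auto simp: comm_invisible_def)

lemma comm_invisible_subgroup: "subgroup (comm_invisible s) G"
proof (rule subgroup.intro)
  show "comm_invisible s \<subseteq> carrier G" by (auto simp: comm_invisible_def)
  show "\<one>\<^bsub>G\<^esub> \<in> comm_invisible s" by (auto simp: comm_invisible_def)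
next
  fix x y assume xy: "x \<in> comm_invisible s" "y \<in> comm_invisible s"
  then have V: "x \<in> Vsp d" "y \<in> Vsp d" by (auto simp: comm_invisible_def)
  have "iter_comm G s (w(j := mul (w j) (mul x y))) = iter_comm G s w"
    if w: "\<forall>i<s. w i \<in> Vsp d" and j: "j < s" for w j
  proof -
    let ?w = "w(j := mul (w j) x)"
    have eq: "w(j := mul (w j) (mul x y)) = ?w(j := mul (?w j) y)"
      using V w j by (simp add: mul_assoc)
    have "iter_comm G s (?w(j := mul (?w j) y)) = iter_comm G s ?w"
      using w j V by (intro comm_invisibleD[OF xy(2)]) auto
    then show ?thesis unfolding eq using comm_invisibleD[OF xy(1), of w j] w j by simp
  qed
  then show "x \<otimes>\<^bsub>G\<^esub> y \<in> comm_invisible s" using V by (simp add: comm_invisible_def)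
next
  fix x assume x: "x \<in> comm_invisible s"
  then have V: "x \<in> Vsp d" by (auto simp: comm_invisible_def)
  have "iter_comm G s (w(j := mul (w j) (iv x))) = iter_comm G s w"
    if w: "\<forall>i<s. w i \<in> Vsp d" and j: "j < s" for w j
  proof -
    let ?w = "w(j := mul (w j) (iv x))"
    have "?w(j := mul (?w j) x) = w" using V w j by (auto simp: mul_assoc)
    moreover have "iter_comm G s (?w(j := mul (?w j) x)) = iter_comm G s ?w"
      using w j V by (intro comm_invisibleD[OF x]) auto
    ultimately show ?thesis by simp
  qed
  then show "iv x \<in> comm_invisible s" using V by (simp add: comm_invisible_def)
qed

lemma comm_invisible_closed: "closed (comm_invisible s)"
proof -
  have eq: "comm_invisible s = Vsp d \<inter> (\<Inter>(w, j)\<in>{(w, j). (\<forall>i<s. w i \<in> Vsp d) \<and> j < s}.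
      {h \<in> Vsp d. iter_comm G s (w(j := mul (w j) h)) = iter_comm G s w})"
    by (auto simp: comm_invisible_def)
  have "closed {h \<in> Vsp d. iter_comm G s (w(j := mul (w j) h)) = iter_comm G s w}"
    if w: "\<forall>i<s. w i \<in> Vsp d" and j: "j < s" for w j
  proof (rule continuous_closed_preimage_constant[OF _ closed_Vsp])
    have "continuous_on (Vsp d) (\<lambda>h. (w(j := mul (w j) h)) i)" if "i < s" for i
      using w j by (cases "i = j") (auto intro!: continuous_on_mul continuous_on_const continuous_on_id)
    then show "continuous_on (Vsp d) (\<lambda>h. iter_comm G s (w(j := mul (w j) h)))"
      using continuous_on_iter_comm[of s "Vsp d" "\<lambda>h. w(j := mul (w j) h)"] w j by fastforce
  qed
  then show ?thesis unfolding eq by (intro closed_Int closed_Vsp closed_INT) auto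
qed

lemma gcomm_in_comm_invisible:
  assumes "nilp_step_le G (Vsp d) s" "x \<in> Vsp d" "y \<in> Vsp d"
  shows "gcomm G x y \<in> comm_invisible s"
  using G.iter_comm_mult_gcomm[of s] G.gcomm_closed[of x y] assms by (simp add: comm_invisible_def)

lemma char_kernel_comm_invisible: "nilp_step_le G (Vsp d) s \<Longrightarrow> char_kernel \<subseteq> comm_invisible s"
  by (intro char_kernel_subset comm_invisible_subgroup comm_invisible_closed gcomm_in_comm_invisible)

text \<open>The part \<open>v\<close> of \<open>x\<close> along the Lie algebra of \<open>H\<close>
  is realised by g = \<phi>(1) in \<open>H\<close>. The other summands are invisible to functionals
  annihilating the brackets, so \<open>x\<close> and \<open>g\<close> have equal values and g^-1 x
  lies in \<open>char_kernel\<close>.\<close>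

lemma kernel_decomposition:
  assumes H: "subgroup H G" "closed H" and x: "x \<in> Vsp d" and I: "finite I"
    and sum: "\<And>l. l < d \<Longrightarrow> x l = (\<Sum>j\<in>I. a j * p j l)"
    and p: "\<And>j. j \<in> I \<Longrightarrow> p j \<in> lie_alg G H \<or> (\<forall>c. brackets_ann c \<longrightarrow> lin c (p j) = 0)"
  shows "\<exists>g\<in>H. \<exists>h\<in>char_kernel. x = mul g h"
proof -
  define J where "J = {j \<in> I. p j \<in> lie_alg G H}"
  define v where "v l = (\<Sum>j\<in>J. a j * p j l)" for l
  have "v \<in> lie_alg G H"
    unfolding v_def[abs_def] using I by (intro lie_alg_sum[OF H]) (auto simp: J_def)
  then obtain \<phi> where \<phi>: "one_param G \<phi>" "range \<phi> \<subseteq> H" "curve_deriv \<phi> v 0" by (rule lie_algD)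
  define g where "g = \<phi> 1"
  have g: "g \<in> H" "g \<in> Vsp d" using \<phi>(2) one_paramD(1)[OF \<phi>(1)] by (auto simp: g_def)
  have "lin c (mul (iv g) x) = 0" if c: "brackets_ann c" for c
  proof -
    have swap: "lin c (\<lambda>l. \<Sum>j\<in>K. a j * p j l) = (\<Sum>j\<in>K. a j * lin c (p j))" for K
      unfolding lin_def sum_distrib_left by (subst sum.swap) (simp add: mult_ac)
    have "lin c x = lin c (\<lambda>l. \<Sum>j\<in>I. a j * p j l)" by (simp add: lin_def sum)
    also have "\<dots> = (\<Sum>j\<in>J. a j * lin c (p j))"
      unfolding swap using I p c by (intro sum.mono_neutral_right) (auto simp: J_def)
    also have "\<dots> = lin c v" unfolding v_def[abs_def] swap ..
    also have "\<dots> = lin c g" using lin_one_param[OF c \<phi>(1,3), of 1] by (simp add: g_def)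
    finally show ?thesis using g x lin_hom[OF c, of "iv g" x] lin_iv[OF c, of g] by simp
  qed
  then have "mul (iv g) x \<in> char_kernel" using g x by (simp add: char_kernel_def)
  moreover have "x = mul g (mul (iv g) x)" using g x by simp
  ultimately show ?thesis using g(1) by blast
qed

text \<open>The factors in \<open>char_kernel\<close> are absorbed one entry at a time:
  \<open>W n\<close> has the entries of \<open>w\<close> before position \<open>n\<close> and those
  of \<open>g\<close> from there on. What remains is an s-fold commutator in
  \<open>H\<close>.\<close>

lemma iter_comm_trivial:
  assumes s: "1 \<le> s" and nil: "nilp_step_le G (Vsp d) s"
    and H: "H \<subseteq> Vsp d" "nilp_step_le G H (s - 1)"
    and w: "\<And>j. j < s \<Longrightarrow> \<exists>g\<in>H. \<exists>h\<in>char_kernel. w j = mul g h"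
  shows "iter_comm G s w = (\<lambda>_. 0)"
proof -
  obtain g h where gh: "\<And>j. j < s \<Longrightarrow> g j \<in> H" "\<And>j. j < s \<Longrightarrow> h j \<in> char_kernel"
      "\<And>j. j < s \<Longrightarrow> w j = mul (g j) (h j)"
    using w by metis
  define W where "W n = (\<lambda>j. if j < n then w j else g j)" for n
  have hV: "h j \<in> Vsp d" "g j \<in> Vsp d" if "j < s" for j
    using gh that H(1) by (auto simp: char_kernel_def)
  have "iter_comm G s (W n) = iter_comm G s g" if "n \<le> s" for n
    using that
  proof (induction n)
    case 0
    then show ?case by (simp add: W_def)
  next
    case (Suc n)
    have "W (Suc n) = (W n)(n := mul (W n n) (h n))" using gh(3)[of n] Suc.prems by (auto simp: W_def)
    moreover have "iter_comm G s ((W n)(n := mul (W n n) (h n))) = iter_comm G s (W n)"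
    proof (rule comm_invisibleD)
      show "h n \<in> comm_invisible s"
        using char_kernel_comm_invisible[OF nil] gh(2)[of n] Suc.prems by auto
      show "W n i \<in> Vsp d" if "i < s" for i using hV[OF that] gh(3)[OF that] by (simp add: W_def)
    qed (use Suc.prems in auto)
    ultimately have "iter_comm G s (W (Suc n)) = iter_comm G s (W n)" by (simp only:)
    then show ?case using Suc by simp
  qed
  moreover have "iter_comm G s (W s) = iter_comm G s w"
    using s by (intro iter_comm_cong) (auto simp: W_def)
  moreover have "iter_comm G s g \<in> lcs G H (s - 1)" using s gh(1) by (intro iter_comm_in_lcs) auto
  ultimately show ?thesis using H(2) by (simp add: nilp_step_le_def)
qed

end

section \<open>The size of the characters\<close>

text \<open>\<open>N\<close> is the product of the denominators, so an entry of the scaled vector is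
  one numerator times the d - 1 other denominators.\<close>

lemma clear_denominators:
  fixes v :: vec
  assumes R: "1 \<le> R" and v: "\<And>l. l < d \<Longrightarrow> \<exists>q. v l = real_of_rat q \<and> real_of_int (rat_height q) \<le> R"
  shows "\<exists>N. N \<noteq> 0 \<and> (\<forall>l<d. N * v l \<in> \<int> \<and> \<bar>N * v l\<bar> \<le> R ^ d)"
proof -
  have "\<exists>a b::int. 0 < b \<and> v l = real_of_int a / real_of_int b \<and> \<bar>real_of_int a\<bar> \<le> R \<and> real_of_int b \<le> R"
    if l: "l < d" for l
  proof -
    obtain q where q: "v l = real_of_rat q" "real_of_int (rat_height q) \<le> R" using v[OF l] by blast
    obtain a b where ab: "quotient_of q = (a, b)" by fastforce
    have "q = of_int a / of_int b" "0 < b" using quotient_of_div[OF ab] quotient_of_denom_pos[OF ab] by auto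
    then show ?thesis using q ab
      by (intro exI[of _ a] exI[of _ b]) (auto simp: rat_height_def of_rat_divide)
  qed
  then obtain a b :: "nat \<Rightarrow> int" where ab: "\<And>l. l < d \<Longrightarrow> 0 < b l"
      "\<And>l. l < d \<Longrightarrow> v l = real_of_int (a l) / real_of_int (b l)"
      "\<And>l. l < d \<Longrightarrow> \<bar>real_of_int (a l)\<bar> \<le> R" "\<And>l. l < d \<Longrightarrow> real_of_int (b l) \<le> R"
    by metis
  define N where "N = (\<Prod>l<d. real_of_int (b l))"
  have "N \<noteq> 0" using ab(1) by (auto simp: N_def) (metis less_irrefl)
  moreover have "N * v l \<in> \<int> \<and> \<bar>N * v l\<bar> \<le> R ^ d" if l: "l < d" for l
  proof -
    have "N = real_of_int (b l) * (\<Prod>m\<in>{..<d} - {l}. real_of_int (b m))"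
      unfolding N_def using l by (intro prod.remove) auto
    then have eq: "N * v l = real_of_int (a l) * (\<Prod>m\<in>{..<d} - {l}. real_of_int (b m))"
      using ab(1,2)[OF l] by simp
    have "\<bar>\<Prod>m\<in>{..<d} - {l}. real_of_int (b m)\<bar> \<le> (\<Prod>m\<in>{..<d} - {l}. R)"
      unfolding abs_prod using ab(1,4) by (intro prod_mono) (auto simp: less_imp_le)
    also have "\<dots> = R ^ (d - 1)" using l by simp
    finally have "\<bar>N * v l\<bar> \<le> R * R ^ (d - 1)"
      unfolding eq abs_mult using ab(3)[OF l] R by (intro mult_mono) auto
    also have "\<dots> = R ^ d" using l by (cases d) auto
    finally show ?thesis unfolding eq by (auto intro!: Ints_mult Ints_prod)
  qed
  ultimately show ?thesis by blast
qed

text \<open>Since d \<le> 2^d \<le> R^d, the factorial is at most d^d \<le> R^(d^2), the same size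
  as the power; this explains both the base at least 2 and the factor 2 in the exponent.\<close>

lemma fact_power_bound:
  assumes R: "2 \<le> R" and d: "0 < d"
  shows "fact d * (R ^ d) ^ d \<le> R powr (2 * real d powr 2)"
proof -
  have "real d \<le> 2 ^ d" using less_exp[of d] by (metis less_imp_le of_nat_le_iff of_nat_numeral of_nat_power)
  also have "\<dots> \<le> R ^ d" using R by (intro power_mono) auto
  finally have dR: "real d \<le> R ^ d" .
  have "fact d \<le> real d ^ d" using fact_le_power[of d] by simp
  also have "\<dots> \<le> (R ^ d) ^ d" using dR by (intro power_mono) auto
  finally have "fact d * (R ^ d) ^ d \<le> (R ^ d) ^ d * (R ^ d) ^ d" using R by (intro mult_right_mono) auto
  also have "\<dots> = R ^ (2 * (d * d))" by (simp add: power_mult power2_eq_square power_mult_distrib mult.commute)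
  also have "\<dots> = R powr real (2 * (d * d))" using R by (subst powr_realpow) auto
  also have "real (2 * (d * d)) = 2 * real d powr 2" using d by (simp add: powr_numeral power2_eq_square)
  finally show ?thesis .
qed

text \<open>\<open>S1\<close> is a finite-height spanning set for the Lie algebra of
  \<open>H\<close>, expressed by duality. The characters are the dual-basis rows outside
  \<open>I\<close>, and their common kernel is the span of the chosen vectors \<open>p i\<close>
  with \<open>i \<in> I\<close>.\<close>

lemma (in malcev_group) characters_of_subgroup:
  assumes s: "1 \<le> s" and nil: "nilp_step_le G (Vsp d) s" and R: "2 \<le> R"
    and H: "subgroup H G" "closed H" "connected H" "nilp_step_le G H (s - 1)"
    and S1: "\<And>v. v \<in> S1 \<Longrightarrow> v \<in> lie_alg G H"
    and span: "\<And>c v. v \<in> lie_alg G H \<Longrightarrow> (\<And>u. u \<in> S1 \<Longrightarrow> lin c u = 0) \<Longrightarrow> lin c v = 0"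
    and rat: "\<And>v l. v \<in> S1 \<union> {lie_br G i j |i j. i < d \<and> j < d} \<Longrightarrow> l < d \<Longrightarrow>
      \<exists>q. v l = real_of_rat q \<and> real_of_int (rat_height q) \<le> R"
  shows "\<exists>r\<le>d. \<exists>\<eta> :: nat \<Rightarrow> vec \<Rightarrow> real.
         (\<forall>i<r. horiz_char d G (\<eta> i)
            \<and> (\<exists>kk :: nat \<Rightarrow> int. (\<forall>x\<in>carrier G. \<eta> i x = (\<Sum>j<d. real_of_int (kk j) * x j))
                 \<and> (\<forall>j<d. real_of_int \<bar>kk j\<bar> \<le> R powr (2 * real d powr 2)))
            \<and> (\<forall>g\<in>H. \<eta> i g = 0))
       \<and> (\<forall>c. (\<forall>x\<in>carrier G. (\<Sum>i<r. c i * \<eta> i x) = 0) \<longrightarrow> (\<forall>i<r. c i = 0))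
       \<and> (\<forall>w. (\<forall>j<s. w j \<in> carrier G) \<and> (\<forall>i<r. \<forall>j<s. \<eta> i (w j) = 0)
              \<longrightarrow> iter_comm G s w = \<one>\<^bsub>G\<^esub>)"
proof -
  define S0 where "S0 = S1 \<union> {lie_br G i j |i j. i < d \<and> j < d}"
  have "\<exists>N. N \<noteq> 0 \<and> (\<forall>l<d. N * v l \<in> \<int> \<and> \<bar>N * v l\<bar> \<le> R ^ d)" if "v \<in> S0" for v
    using R rat[of v] that by (intro clear_denominators) (auto simp: S0_def)
  then obtain N where N: "\<And>v. v \<in> S0 \<Longrightarrow> N v \<noteq> 0"
      "\<And>v l. v \<in> S0 \<Longrightarrow> l < d \<Longrightarrow> N v * v l \<in> \<int> \<and> \<bar>N v * v l\<bar> \<le> R ^ d"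
    by metis
  \<comment> \<open>Scaling each vector by its own nonzero factor makes it integral and leaves its
    annihilator unchanged.\<close>
  define S where "S = (\<lambda>v l. N v * v l) ` S0"
  obtain I \<mu> p \<Delta> where I: "I \<subseteq> {..<d}" "\<Delta> \<noteq> 0" "\<forall>i\<in>I. p i \<in> S"
      "\<forall>j<d. j \<notin> I \<longrightarrow> (\<forall>s\<in>S. (\<Sum>l<d. \<mu> j l * s l) = 0)"
      "\<forall>i<d. \<forall>j<d. (\<Sum>l<d. \<mu> j l * p i l) = (if i = j then \<Delta> else 0)"
      "\<forall>x. \<forall>l<d. \<Delta> * x l = (\<Sum>j<d. (\<Sum>m<d. \<mu> j m * x m) * p j l)"
      "\<forall>B\<ge>1. (\<forall>s\<in>S. \<forall>l<d. s l \<in> \<int> \<and> \<bar>s l\<bar> \<le> B) \<longrightarrow>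
         (\<forall>j<d. \<forall>l<d. \<mu> j l \<in> \<int> \<and> \<bar>\<mu> j l\<bar> \<le> fact d * B ^ d)"
    using dual_basis_extension[of d S] by blast
  have "(1::real) \<le> R ^ d" using R by simp
  moreover have "\<forall>s\<in>S. \<forall>l<d. s l \<in> \<int> \<and> \<bar>s l\<bar> \<le> R ^ d" using N(2) by (auto simp: S_def)
  ultimately have bound: "\<mu> j l \<in> \<int>" "\<bar>\<mu> j l\<bar> \<le> fact d * (R ^ d) ^ d" if "j < d" "l < d" for j l
    using I(7)[rule_format, of "R ^ d" j l] that by blast+
  define J where "J = {..<d} - I"
  have J: "finite J" "card J \<le> d" using card_mono[of "{..<d}" J] by (auto simp: J_def)
  obtain e where e: "bij_betw e {..<card J} J"
    using ex_bij_betw_nat_finite[OF J(1)] by (auto simp: atLeast0LessThan)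
  have eJ: "e i < d" "e i \<notin> I" if "i < card J" for i
    using bij_betwE[OF e] that by (auto simp: J_def)
  have ann: "lin (\<mu> j) v = 0" if "j < d" "j \<notin> I" "v \<in> S0" for j v
  proof -
    have "(\<Sum>l<d. \<mu> j l * (N v * v l)) = 0" using I(4) that by (auto simp: S_def)
    then have "N v * lin (\<mu> j) v = 0" by (simp add: lin_def sum_distrib_left mult_ac)
    then show ?thesis using N(1)[OF that(3)] by simp
  qed
  have br: "brackets_ann (\<mu> (e i))" if "i < card J" for i
    unfolding brackets_ann_def using ann[OF eJ[OF that]] by (auto simp: S0_def)
  have HV: "H \<subseteq> Vsp d" using subgroup.subset[OF H(1)] by simp
  define \<eta> where "\<eta> i = lin (\<mu> (e i))" for i
  have "horiz_char d G (\<eta> i)" if i: "i < card J" for i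
    unfolding horiz_char_def
  proof (intro conjI ballI)
    show "continuous_on (carrier G) (\<eta> i)"
      unfolding \<eta>_def by (intro continuous_on_lin continuous_on_id)
    show "\<eta> i \<gamma> \<in> \<int>" if "\<gamma> \<in> lattice d" for \<gamma>
      unfolding \<eta>_def lin_def using that bound(1) eJ(1)[OF i]
      by (intro Ints_sum Ints_mult) (auto simp: lattice_def)
  qed (simp add: \<eta>_def lin_hom[OF br[OF i]])
  moreover have "\<exists>kk :: nat \<Rightarrow> int. (\<forall>x\<in>carrier G. \<eta> i x = (\<Sum>j<d. real_of_int (kk j) * x j))
      \<and> (\<forall>j<d. real_of_int \<bar>kk j\<bar> \<le> R powr (2 * real d powr 2))" if i: "i < card J" for i
  proof (intro exI[of _ "\<lambda>j. \<lfloor>\<mu> (e i) j\<rfloor>"] conjI ballI allI impI)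
    have fl: "real_of_int \<lfloor>\<mu> (e i) j\<rfloor> = \<mu> (e i) j" if "j < d" for j
      using bound(1)[OF eJ(1)[OF i] that] by simp
    show "\<eta> i x = (\<Sum>j<d. real_of_int \<lfloor>\<mu> (e i) j\<rfloor> * x j)" for x by (simp add: \<eta>_def lin_def fl)
    fix j assume j: "j < d"
    have "real_of_int \<bar>\<lfloor>\<mu> (e i) j\<rfloor>\<bar> = \<bar>\<mu> (e i) j\<bar>" unfolding of_int_abs fl[OF j] ..
    also have "\<dots> \<le> R powr (2 * real d powr 2)"
      using bound(2)[OF eJ(1)[OF i] j] fact_power_bound[OF R, of d] j by linarith
    finally show "real_of_int \<bar>\<lfloor>\<mu> (e i) j\<rfloor>\<bar> \<le> R powr (2 * real d powr 2)" .
  qed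
  moreover have "\<eta> i g = 0" if i: "i < card J" and g: "g \<in> H" for i g
    unfolding \<eta>_def
  proof (rule lin_vanishes_on_subgroup[OF br[OF i] H(1-3) _ g])
    fix v assume "v \<in> lie_alg G H"
    then show "lin (\<mu> (e i)) v = 0" by (rule span) (auto intro!: ann eJ[OF i] simp: S0_def)
  qed
  moreover have "\<forall>i<card J. c i = 0" if c: "\<forall>x\<in>carrier G. (\<Sum>i<card J. c i * \<eta> i x) = 0" for c
  proof (intro allI impI)
    fix i assume i: "i < card J"
    \<comment> \<open>The vector dual to character \<open>i\<close> up to \<Delta> isolates the
      coefficient \<open>c i\<close>; cutting it off beyond \<open>d\<close> puts it into the
      group.\<close>
    define x where "x l = (if l < d then p (e i) l else 0)" for l
    have "\<eta> k x = (if k = i then \<Delta> else 0)" if k: "k < card J" for k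
    proof -
      have "\<eta> k x = (\<Sum>l<d. \<mu> (e k) l * p (e i) l)" by (simp add: \<eta>_def lin_def x_def)
      also have "\<dots> = (if e i = e k then \<Delta> else 0)" using I(5) eJ(1) i k by auto
      also have "e i = e k \<longleftrightarrow> k = i" using e i k by (auto simp: bij_betw_def inj_on_def)
      finally show ?thesis .
    qed
    then have "(\<Sum>k<card J. c k * \<eta> k x) = (\<Sum>k<card J. if k = i then c i * \<Delta> else 0)"
      by (intro sum.cong) auto
    then have "(\<Sum>k<card J. c k * \<eta> k x) = c i * \<Delta>" using i by simp
    moreover have "x \<in> carrier G" by (simp add: x_def Vsp_def)
    ultimately show "c i = 0" using c I(2) by auto
  qed
  moreover have "iter_comm G s w = \<one>\<^bsub>G\<^esub>"
    if w: "\<forall>j<s. w j \<in> carrier G" "\<forall>i<card J. \<forall>j<s. \<eta> i (w j) = 0" for w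
  proof -
    have "\<exists>g\<in>H. \<exists>h\<in>char_kernel. w k = mul g h" if k: "k < s" for k
    proof (rule kernel_decomposition[OF H(1,2)])
      show "w k \<in> Vsp d" using w k by simp
      show "finite I" using I(1) by (rule finite_subset) simp
      show "w k l = (\<Sum>j\<in>I. (lin (\<mu> j) (w k) / \<Delta>) * p j l)" if l: "l < d" for l
      proof -
        \<comment> \<open>\<open>e\<close> enumerates the indices outside \<open>I\<close>, so
          vanishing of the characters removes precisely those terms of the expansion of
          \<open>w k\<close> in the basis \<open>p\<close>.\<close>
        have z: "lin (\<mu> j) (w k) = 0" if "j \<in> {..<d} - I" for j
        proof -
          have "j \<in> e ` {..<card J}" using that e by (auto simp: bij_betw_def J_def)
          then show ?thesis using w(2) k by (auto simp: \<eta>_def)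
        qed
        have "\<Delta> * w k l = (\<Sum>j<d. lin (\<mu> j) (w k) * p j l)" using I(6) l by (simp add: lin_def)
        also have "\<dots> = (\<Sum>j\<in>I. lin (\<mu> j) (w k) * p j l)"
          using I(1) z by (intro sum.mono_neutral_right) auto
        finally have "w k l = (\<Sum>j\<in>I. lin (\<mu> j) (w k) * p j l) / \<Delta>" using I(2) by (simp add: field_simps)
        then show ?thesis by (simp add: sum_divide_distrib)
      qed
      fix j assume "j \<in> I"
      then obtain v where v: "v \<in> S0" "p j = (\<lambda>l. N v * v l)" using I(3) by (auto simp: S_def)
      have "lin c (p j) = N v * lin c v" for c by (simp add: v lin_def sum_distrib_left mult_ac)
      then show "p j \<in> lie_alg G H \<or> (\<forall>c. brackets_ann c \<longrightarrow> lin c (p j) = 0)"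
        using v S1 lie_alg_scale[of v H "N v"] by (auto simp: S0_def brackets_ann_def)
    qed
    then show ?thesis using iter_comm_trivial[OF s nil HV H(4)] by simp
  qed
  ultimately show ?thesis
    using J(2) by (intro exI[of _ "card J"] exI[of _ \<eta>] conjI) simp_all
qed

lemma nilmanifold_malcev_group:
  assumes "nilmanifold d s k M mul Gf a"
  shows "malcev_group d mul" and "nilp_step_le (nilgrp d mul) (Vsp d) s"
    and "i < d \<Longrightarrow> j < d \<Longrightarrow> l < d \<Longrightarrow> 1 \<le> M \<Longrightarrow>
      \<exists>q. lie_br (nilgrp d mul) i j l = real_of_rat q \<and> real_of_int (rat_height q) \<le> M"
proof -
  have G: "carrier (nilgrp d mul) = Vsp d" "monoid.mult (nilgrp d mul) = mul" "one (nilgrp d mul) = (\<lambda>_. 0)"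
    by (simp_all add: nilgrp_def)
  note nm = assms[unfolded nilmanifold_def Let_def G]
  have "group (nilgrp d mul)" using nm by (elim conjE)
  moreover have "\<forall>l. \<exists>p. polyfun2 p \<and> (\<forall>x\<in>Vsp d. \<forall>y\<in>Vsp d. mul x y l = p x y)" using nm by (elim conjE)
  moreover have "\<forall>i<d. one_param (nilgrp d mul) (\<lambda>t. sc t i)" using nm by (elim conjE)
  moreover have "\<forall>x\<in>Vsp d. x = foldl mul (\<lambda>_. 0) (map (\<lambda>i. sc (x i) i) [0..<d])" using nm by (elim conjE)
  moreover have "lie_alg (nilgrp d mul) (Vsp d) = Vsp d" using nm by (elim conjE)
  ultimately show "malcev_group d mul"
    by (intro malcev_group.intro; blast)
  show "nilp_step_le (nilgrp d mul) (Vsp d) s" using nm by (elim conjE)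
  assume ijl: "i < d" "j < d" "l < d" "1 \<le> M"
  have "lie_br (nilgrp d mul) i j l = (if max i j < l then real_of_rat (a i j l) else 0)
      \<and> (max i j < l \<longrightarrow> real_of_int (rat_height (a i j l)) \<le> M)"
  proof -
    have "\<forall>i<d. \<forall>j<d. \<forall>l<d.
        lie_br (nilgrp d mul) i j l = (if max i j < l then real_of_rat (a i j l) else 0)
        \<and> (max i j < l \<longrightarrow> real_of_int (rat_height (a i j l)) \<le> M)"
      using nm by (elim conjE)
    then show ?thesis using ijl(1-3) by blast
  qed
  then show "\<exists>q. lie_br (nilgrp d mul) i j l = real_of_rat q \<and> real_of_int (rat_height q) \<le> M"
    \<comment> \<open>For l \<le> max i j the coordinate is 0, whose reduced fraction 0/1 has height
      1; hence \<open>1 \<le> M\<close>.\<close>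
    using ijl(4) by (intro exI[of _ "if max i j < l then a i j l else 0"]) (auto simp: rat_height_def)
qed

theorem lemmal:
  fixes k :: nat
  shows "\<exists>C::real. C > 0 \<and>
    (\<forall>d s M Q mul Gf a G'.
      let G = nilgrp d mul in
      (1 \<le> s \<and> 2 \<le> M \<and> 1 \<le> Q
       \<and> nilmanifold d s k M mul Gf a
       \<and> subgroup G' G \<and> closed G' \<and> connected G'
       \<and> Q_rational d G Q G'
       \<and> nilp_step_le G G' (s - 1))
      \<longrightarrow>
      (\<exists>r\<le>d. \<exists>\<eta> :: nat \<Rightarrow> vec \<Rightarrow> real.
         (\<forall>i<r. horiz_char d G (\<eta> i)
            \<and> (\<exists>kk :: nat \<Rightarrow> int. (\<forall>x\<in>carrier G. \<eta> i x = (\<Sum>j<d. real_of_int (kk j) * x j))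
                 \<and> (\<forall>j<d. real_of_int \<bar>kk j\<bar> \<le> (Q * M) powr (C * real d powr C)))
            \<and> (\<forall>g\<in>G'. \<eta> i g = 0))
       \<and> (\<forall>c. (\<forall>x\<in>carrier G. (\<Sum>i<r. c i * \<eta> i x) = 0) \<longrightarrow> (\<forall>i<r. c i = 0))
       \<and> (\<forall>w. (\<forall>j<s. w j \<in> carrier G) \<and> (\<forall>i<r. \<forall>j<s. \<eta> i (w j) = 0)
              \<longrightarrow> iter_comm G s w = \<one>\<^bsub>G\<^esub>)))"
  unfolding Let_def
\<comment> \<open>C = 2 is read off from the exponent \<open>2 * real d powr 2\<close> of
  \<open>fact_power_bound\<close> and is the same for every \<open>k\<close>.\<close>
proof (rule exI[of _ 2], intro conjI allI impI, goal_cases)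
  case 1
  show ?case by simp
next
  case (2 d s M Q mul Gf a G')
  then have s: "1 \<le> s" and M: "2 \<le> M" and Q: "1 \<le> Q" and nm: "nilmanifold d s k M mul Gf a"
    and H: "subgroup G' (nilgrp d mul)" "closed G'" "connected G'" "nilp_step_le (nilgrp d mul) G' (s - 1)"
    and rat: "Q_rational d (nilgrp d mul) Q G'"
    by auto
  interpret malcev_group d mul by (rule nilmanifold_malcev_group(1)[OF nm])
  obtain m :: nat and b :: "nat \<Rightarrow> vec" where b: "\<forall>t<m. b t \<in> Vsp d \<and>
        (\<forall>j<d. \<exists>q. b t j = real_of_rat q \<and> real_of_int (rat_height q) \<le> Q)"
      "lie_alg G G' = {(\<lambda>j. \<Sum>t<m. c t * b t j) | c. True}"
    using rat unfolding Q_rational_def by blast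
  \<comment> \<open>Q M serves as a common height bound for the basis of the Lie algebra of G' and
    for the structure constants, and M \<ge> 2 makes it a base of at least 2.\<close>
  have QM: "Q \<le> Q * M" "M \<le> Q * M" using mult_left_mono[of 1 M Q] mult_right_mono[of 1 Q M] M Q by auto
  show ?case
  proof (rule characters_of_subgroup[OF s nilmanifold_malcev_group(2)[OF nm] _ H, where ?S1.0 = "b ` {..<m}"])
    show "2 \<le> Q * M" using QM M by linarith
    show "v \<in> lie_alg G G'" if v: "v \<in> b ` {..<m}" for v
    proof -
      obtain t where t: "t < m" "v = b t" using v by auto
      have "v = (\<lambda>j. \<Sum>t'<m. (if t' = t then 1 else 0) * b t' j)"
        using t by (simp add: if_distrib[of "\<lambda>x. x * _"] cong: if_cong)
      then show ?thesis unfolding b(2) by (intro CollectI exI[of _ "\<lambda>t'. if t' = t then 1 else 0"]) simp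
    qed
    show "lin c v = 0" if v: "v \<in> lie_alg G G'" and u: "\<And>u. u \<in> b ` {..<m} \<Longrightarrow> lin c u = 0" for c v
    proof -
      obtain f where f: "v = (\<lambda>j. \<Sum>t<m. f t * b t j)" using v unfolding b(2) by auto
      have "lin c v = (\<Sum>t<m. f t * lin c (b t))"
        unfolding f lin_def sum_distrib_left by (subst sum.swap) (simp add: mult_ac)
      then show ?thesis using u by simp
    qed
    show "\<exists>q. v l = real_of_rat q \<and> real_of_int (rat_height q) \<le> Q * M"
      if v: "v \<in> b ` {..<m} \<union> {lie_br G i j |i j. i < d \<and> j < d}" and l: "l < d" for v l
    proof (cases "v \<in> b ` {..<m}")
      case True
      then obtain q where "v l = real_of_rat q" "real_of_int (rat_height q) \<le> Q" using b(1) l by blast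
      then show ?thesis using QM(1) order_trans by blast
    next
      case False
      then obtain i j where ij: "i < d" "j < d" "v = lie_br G i j" using v by auto
      have "1 \<le> M" using M by simp
      from nilmanifold_malcev_group(3)[OF nm ij(1,2) l this]
      obtain q where "v l = real_of_rat q" "real_of_int (rat_height q) \<le> M" unfolding ij(3) by blast
      then show ?thesis using QM(2) order_trans by blast
    qed
  qed
qed

end
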